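(* Let $\mathbb{K}$ be a field with $\mathrm{char}(\mathbb{K})\neq 2$. We have the following lower bounds: $$\mathrm{gap}_{\mathbb{K}}(Br_n^{\leq k})\geq\mathrm{gap}_{\mathbb{K}}(TL_n^{\leq k}),$$ $$\mathrm{ssgap}_{\mathbb{K}}(Br_n^{\leq k})\geq\begin{cases}\mathrm{ssgap}_{\mathbb{K}}(TL_n^{\leq k})&\text{always},\\ (n-1)!!\in\Theta(n^{n/2}e^{-n/2})&\text{if } n\gg 0,\ 0\leq k\leq 2\sqrt{n},\end{cases}$$ $$\mathrm{faith}_{\mathbb{K}}(Br_n^{\leq k})\geq\mathrm{faith}_{\mathbb{K}}(TL_n^{\leq k}).$$ Here $!!$ denotes the double factorial.
   Context: Brauer monoid: $Br_n$ is the finite monoid of perfect matchings of $n$ bottom and $n$ top points. The product $ab$ is obtained by stacking $a$ on top of $b$, reading off the resulting matching and deleting all closed components. $TL_n\subset Br_n$ (the Temperley--Lieb monoid) is the submonoid of planar (crossingless) matchings. A through strand joins a bottom point to a top point. For $k<n$, $k\equiv n\bmod 2$, $Br_n^{\leq k}$ (resp. $TL_n^{\leq k}$) is the submonoid of $Br_n$ (resp. $TL_n$) consisting of the diagrams with at most $k$ through strands together with the identity $1$. Representations are finite-dimensional left representations over $\mathbb{K}$. Let $S$ be a finite monoid with group of units $G$. Trivial representations: $1_b\colon S\to\mathbb{K}$ sends $s$ to $1$ if $s\in G$ and to $0$ otherwise; $1_t\colon S\to\mathbb{K}$ sends every $s$ to $1$. Representation gap: $(S,\mathbb{K})$ is $m$-trivial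 if every representation $M$ with $\dim_{\mathbb{K}}M\leq m$ is a direct sum of $\dim_{\mathbb{K}} M$ representations each isomorphic to $1_b$ or $1_t$. If $S$ is neither the one-element monoid nor $\{1,a\}$ with $aa=a$, then $\mathrm{gap}_{\mathbb{K}}(S)$ is the maximal $m$ such that $(S,\mathbb{K})$ is $(m-1)$-trivial (it is $0$ by convention for these two monoids). Semisimple gap: $a\leq_l b\Leftrightarrow b\in Sa$, $a\leq_r b\Leftrightarrow b\in aS$, $a\leq_{lr}b\Leftrightarrow b\in SaS$; the equivalence classes are the left, right and two-sided cells ($J$-cells), and $H$-cells are the nonempty intersections of a left and a right cell. Within one $J$-cell all left cells have the same size $|\mathcal{L}|$ and all $H$-cells the same size $|\mathcal{H}|$. If a $J$-cell contains an idempotent $e$, its $H$-cell $H(e)$ is a group. By the Clifford--Munn--Ponizovskii theorem, simple $S$-representations up to isomorphism are in bijection with pairs of a $J$-cell containing an idempotent and a simple representation $V$ of the group $H(e)$ for a chosen idempotent $e$ in it; write $L_V$ for the corresponding simple $S$-representation. Its semisimple dimension is $\mathrm{ssdim}_{\mathbb{K}}(L_V)=\frac{|\mathcal{L}|}{|\mathcal{H}|}\dim_{\mathbb{K}} V$, and $\mathrm{ssgap}_{\mathbb{K}}(S)$ is the minimum of $\mathrm{ssdim}_{\mathbb{K}}(L)$ over simple $S$-representations $L\not\cong 1_b,1_t$. Faithfulness: a representation is faithful if distinct elements of $S$ act by distinct linear maps; $\mathrm{faith}_{\mathbb{K}}(S)$ is the minimal dimension of a faithful $S$-representation over $\mathbb{K}$.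 $f\in\Theta(g)$ means $f$ is asymptotically bounded above and below by positive constant multiples of $g$; $n\gg 0$ means $n$ sufficiently large. *)

theory Defs
  imports
    "HOL-Library.Extended_Nat"
    "HOL-Library.Disjoint_Sets"
    "HOL-Library.Landau_Symbols"
    "HOL-Algebra.Group"
    "Jordan_Normal_Form.Matrix"
    "Jordan_Normal_Form.Matrix_Kernel"
begin

section \<open>Representations\<close>

text \<open>
  A representation of a monoid on \<open>K\<^sup>d\<close> (column vectors) is a map into the \<open>d \<times> d\<close> matrices;
  every finite-dimensional left representation is of this form after a choice of basis. The case
  \<open>d = 0\<close> is allowed.
\<close>

definition is_rep :: "('a, 'c) monoid_scheme \<Rightarrow> nat \<Rightarrow> ('a \<Rightarrow> 'k :: field mat) \<Rightarrow> bool" where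
  "is_rep S d \<rho> \<longleftrightarrow>
     (\<forall>a \<in> carrier S. \<rho> a \<in> carrier_mat d d) \<and>
     \<rho> \<one>\<^bsub>S\<^esub> = 1\<^sub>m d \<and>
     (\<forall>a \<in> carrier S. \<forall>b \<in> carrier S. \<rho> (a \<otimes>\<^bsub>S\<^esub> b) = \<rho> a * \<rho> b)"

definition rep_iso ::
  "('a, 'c) monoid_scheme \<Rightarrow> nat \<Rightarrow> ('a \<Rightarrow> 'k :: field mat) \<Rightarrow> nat \<Rightarrow> ('a \<Rightarrow> 'k mat) \<Rightarrow> bool" where
  "rep_iso S d \<rho> d' \<sigma> \<longleftrightarrow>
     d = d' \<and> (\<exists>P \<in> carrier_mat d d. invertible_mat P \<and> (\<forall>a \<in> carrier S. P * \<rho> a = \<sigma> a * P))"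

definition simple_rep :: "('a, 'c) monoid_scheme \<Rightarrow> nat \<Rightarrow> ('a \<Rightarrow> 'k :: field mat) \<Rightarrow> bool" where
  "simple_rep S d \<rho> \<longleftrightarrow>
     is_rep S d \<rho> \<and> d > 0 \<and>
     (\<forall>W. subspace class_ring W (module_vec TYPE('k) d) \<and>
          (\<forall>a \<in> carrier S. \<forall>v \<in> W. \<rho> a *\<^sub>v v \<in> W) \<longrightarrow>
          W = {0\<^sub>v d} \<or> W = carrier_vec d)"

definition faithful_rep :: "('a, 'c) monoid_scheme \<Rightarrow> nat \<Rightarrow> ('a \<Rightarrow> 'k :: field mat) \<Rightarrow> bool" where
  "faithful_rep S d \<rho> \<longleftrightarrow> is_rep S d \<rho> \<and> inj_on \<rho> (carrier S)"

definition direct_sum_rep :: "('a \<Rightarrow> 'k :: field mat) list \<Rightarrow> 'a \<Rightarrow> 'k mat" where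
  "direct_sum_rep \<sigma>s = (\<lambda>a. diag_block_mat (map (\<lambda>\<sigma>. \<sigma> a) \<sigma>s))"

definition triv_b :: "('a, 'c) monoid_scheme \<Rightarrow> 'a \<Rightarrow> 'k :: field mat" where
  "triv_b S = (\<lambda>a. if a \<in> Units S then 1\<^sub>m 1 else 0\<^sub>m 1 1)"

definition triv_t :: "('a, 'c) monoid_scheme \<Rightarrow> 'a \<Rightarrow> 'k :: field mat" where
  "triv_t S = (\<lambda>a. 1\<^sub>m 1)"


section \<open>Representation gap and faithfulness\<close>

definition m_trivial :: "'k :: field itself \<Rightarrow> ('a, 'c) monoid_scheme \<Rightarrow> nat \<Rightarrow> bool" where
  "m_trivial K S m \<longleftrightarrow>
     (\<forall>d \<le> m. \<forall>\<rho> :: 'a \<Rightarrow> 'k mat. is_rep S d \<rho> \<longrightarrow>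
        (\<exists>\<sigma>s. length \<sigma>s = d \<and>
              (\<forall>\<sigma> \<in> set \<sigma>s. is_rep S 1 \<sigma> \<and>
                 (rep_iso S 1 \<sigma> 1 (triv_b S) \<or> rep_iso S 1 \<sigma> 1 (triv_t S))) \<and>
              rep_iso S d \<rho> d (direct_sum_rep \<sigma>s)))"

definition rep_gap :: "'k :: field itself \<Rightarrow> ('a, 'c) monoid_scheme \<Rightarrow> nat" where
  "rep_gap K S =
     (if carrier S = {\<one>\<^bsub>S\<^esub>} \<or> (\<exists>a. carrier S = {\<one>\<^bsub>S\<^esub>, a} \<and> a \<otimes>\<^bsub>S\<^esub> a = a)
      then 0
      else (GREATEST m. m > 0 \<and> m_trivial K S (m - 1)))"

definition rep_faith :: "'k :: field itself \<Rightarrow> ('a, 'c) monoid_scheme \<Rightarrow> nat" where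
  "rep_faith K S = (LEAST d. \<exists>\<rho> :: 'a \<Rightarrow> 'k mat. faithful_rep S d \<rho>)"


section \<open>Cells and the semisimple gap\<close>

text \<open>The orders are oriented so that the unit is minimal.\<close>

definition le_l :: "('a, 'c) monoid_scheme \<Rightarrow> 'a \<Rightarrow> 'a \<Rightarrow> bool" where
  "le_l S a b \<longleftrightarrow> (\<exists>s \<in> carrier S. b = s \<otimes>\<^bsub>S\<^esub> a)"

definition le_r :: "('a, 'c) monoid_scheme \<Rightarrow> 'a \<Rightarrow> 'a \<Rightarrow> bool" where
  "le_r S a b \<longleftrightarrow> (\<exists>s \<in> carrier S. b = a \<otimes>\<^bsub>S\<^esub> s)"

definition le_lr :: "('a, 'c) monoid_scheme \<Rightarrow> 'a \<Rightarrow> 'a \<Rightarrow> bool" where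
  "le_lr S a b \<longleftrightarrow> (\<exists>s \<in> carrier S. \<exists>t \<in> carrier S. b = s \<otimes>\<^bsub>S\<^esub> a \<otimes>\<^bsub>S\<^esub> t)"

definition left_cell :: "('a, 'c) monoid_scheme \<Rightarrow> 'a \<Rightarrow> 'a set" where
  "left_cell S a = {b \<in> carrier S. le_l S a b \<and> le_l S b a}"

definition right_cell :: "('a, 'c) monoid_scheme \<Rightarrow> 'a \<Rightarrow> 'a set" where
  "right_cell S a = {b \<in> carrier S. le_r S a b \<and> le_r S b a}"

definition H_cell :: "('a, 'c) monoid_scheme \<Rightarrow> 'a \<Rightarrow> 'a set" where
  "H_cell S a = left_cell S a \<inter> right_cell S a"

text \<open>The group \<open>H(e)\<close> of an idempotent \<open>e\<close>, with unit \<open>e\<close>.\<close>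

definition H_group :: "('a, 'c) monoid_scheme \<Rightarrow> 'a \<Rightarrow> ('a, 'c) monoid_scheme" where
  "H_group S e = S\<lparr>carrier := H_cell S e, one := e\<rparr>"

text \<open>
  The Clifford--Munn--Ponizovskii correspondence: the simple representation \<open>L\<close> of \<open>S\<close> (of
  dimension \<open>d\<close>) is \<open>L\<^sub>V\<close> for the simple representation \<open>V\<close> of \<open>H(e)\<close> (of dimension \<open>m\<close>) iff
  \<^item> the two-sided cell of \<open>e\<close> is the apex of \<open>L\<close>, that is, \<open>e\<close> does not annihilate \<open>L\<close>, while every
    \<open>a\<close> with \<open>e \<notin> S a S\<close> does, and
  \<^item> \<open>V\<close> is isomorphic to \<open>e L\<close> over \<open>H(e)\<close>; below, \<open>P\<close> is the matrix of an equivariant injection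
    \<open>K\<^sup>m \<rightarrow> K\<^sup>d\<close> with image \<open>e L\<close>.
\<close>

definition cmp_corresponds ::
  "('a, 'c) monoid_scheme \<Rightarrow> 'a \<Rightarrow> nat \<Rightarrow> ('a \<Rightarrow> 'k :: field mat) \<Rightarrow> nat \<Rightarrow> ('a \<Rightarrow> 'k mat) \<Rightarrow> bool"
where
  "cmp_corresponds S e m V d L \<longleftrightarrow>
     L e \<noteq> 0\<^sub>m d d \<and>
     (\<forall>a \<in> carrier S. \<not> le_lr S a e \<longrightarrow> L a = 0\<^sub>m d d) \<and>
     (\<exists>P \<in> carrier_mat d m.
        mat_kernel P = {0\<^sub>v m} \<and>
        (\<lambda>v. P *\<^sub>v v) ` carrier_vec m = (\<lambda>v. L e *\<^sub>v v) ` carrier_vec d \<and>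
        (\<forall>h \<in> H_cell S e. P * V h = L h * P))"

text \<open>
  The graph of the function \<open>ssdim\<close>. It is written as a relation because \<open>e\<close> and \<open>V\<close> are determined
  by \<open>L\<close> only up to the choice of an idempotent in the apex and up to isomorphism. A left cell is a
  disjoint union of \<open>H\<close>-cells of equal size, so the division is exact.
\<close>

definition has_ssdim ::
  "('a, 'c) monoid_scheme \<Rightarrow> nat \<Rightarrow> ('a \<Rightarrow> 'k :: field mat) \<Rightarrow> nat \<Rightarrow> bool" where
  "has_ssdim S d L x \<longleftrightarrow>
     (\<exists>e m. \<exists>V :: 'a \<Rightarrow> 'k mat.
        e \<in> carrier S \<and> e \<otimes>\<^bsub>S\<^esub> e = e \<and>
        simple_rep (H_group S e) m V \<and>
        cmp_corresponds S e m V d L \<and>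
        x = card (left_cell S e) div card (H_cell S e) * m)"

text \<open>
  The value is \<open>\<infinity>\<close>, the minimum of the empty set, if \<open>1\<^sub>b\<close> and \<open>1\<^sub>t\<close> are the only simple
  representations.
\<close>

definition rep_ssgap :: "'k :: field itself \<Rightarrow> ('a, 'c) monoid_scheme \<Rightarrow> enat" where
  "rep_ssgap K S =
     Inf {enat x | x. \<exists>d. \<exists>L :: 'a \<Rightarrow> 'k mat.
        simple_rep S d L \<and>
        \<not> rep_iso S d L 1 (triv_b S) \<and> \<not> rep_iso S d L 1 (triv_t S) \<and>
        has_ssdim S d L x}"


section \<open>Brauer and Temperley--Lieb monoids\<close>

datatype point = Bot nat | Top nat

type_synonym diagram = "point set set"

definition points :: "nat \<Rightarrow> point set" where
  "points n = Bot ` {..<n} \<union> Top ` {..<n}"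

definition perfect_matching :: "nat \<Rightarrow> diagram \<Rightarrow> bool" where
  "perfect_matching n a \<longleftrightarrow> partition_on (points n) a \<and> (\<forall>B \<in> a. card B = 2)"

text \<open>
  Stacking \<open>a\<close> on top of \<open>b\<close>: the bottom points of \<open>a\<close> and the top points of \<open>b\<close> become the middle
  points. Two distinct outer points are matched in the product iff they are joined by a path in the
  resulting graph; components without outer points (the closed ones) do not contribute.
\<close>

datatype level_point = Lower nat | Middle nat | Upper nat

primrec place_above :: "point \<Rightarrow> level_point" where
  "place_above (Bot i) = Middle i"
| "place_above (Top i) = Upper i"

primrec place_below :: "point \<Rightarrow> level_point" where
  "place_below (Bot i) = Lower i"
| "place_below (Top i) = Middle i"

primrec place_outer :: "point \<Rightarrow> level_point" where
  "place_outer (Bot i) = Lower i"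
| "place_outer (Top i) = Upper i"

definition stack_edges :: "diagram \<Rightarrow> diagram \<Rightarrow> (level_point \<times> level_point) set" where
  "stack_edges a b =
     {(place_above x, place_above y) | x y. {x, y} \<in> a} \<union>
     {(place_below x, place_below y) | x y. {x, y} \<in> b}"

definition stack :: "diagram \<Rightarrow> diagram \<Rightarrow> diagram" where
  "stack a b =
     {{x, y} | x y. x \<noteq> y \<and> (place_outer x, place_outer y) \<in> (stack_edges a b)\<^sup>*}"

definition id_diagram :: "nat \<Rightarrow> diagram" where
  "id_diagram n = {{Bot i, Top i} | i. i < n}"

definition Br :: "nat \<Rightarrow> diagram monoid" where
  "Br n = \<lparr>carrier = {a. perfect_matching n a}, mult = stack, one = id_diagram n\<rparr>"

text \<open>
  The points in counterclockwise order around the boundary of the strip: the bottom points from left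
  to right, then the top points from right to left. A matching can be drawn without crossings iff no
  two of its blocks interleave in this order.
\<close>

primrec boundary_pos :: "nat \<Rightarrow> point \<Rightarrow> nat" where
  "boundary_pos n (Bot i) = i"
| "boundary_pos n (Top i) = 2 * n - 1 - i"

definition planar :: "nat \<Rightarrow> diagram \<Rightarrow> bool" where
  "planar n a \<longleftrightarrow>
     \<not> (\<exists>x y z w. {x, y} \<in> a \<and> {z, w} \<in> a \<and>
          boundary_pos n x < boundary_pos n z \<and>
          boundary_pos n z < boundary_pos n y \<and>
          boundary_pos n y < boundary_pos n w)"

definition TL :: "nat \<Rightarrow> diagram monoid" where
  "TL n = (Br n)\<lparr>carrier := {a \<in> carrier (Br n). planar n a}\<rparr>"

definition through_strands :: "diagram \<Rightarrow> nat" where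
  "through_strands a = card {B \<in> a. \<exists>i j. B = {Bot i, Top j}}"

definition truncation :: "diagram monoid \<Rightarrow> nat \<Rightarrow> diagram monoid" where
  "truncation S k = S\<lparr>carrier := {a \<in> carrier S. through_strands a \<le> k} \<union> {\<one>\<^bsub>S\<^esub>}\<rparr>"

abbreviation Br_le :: "nat \<Rightarrow> nat \<Rightarrow> diagram monoid" where
  "Br_le n k \<equiv> truncation (Br n) k"

abbreviation TL_le :: "nat \<Rightarrow> nat \<Rightarrow> diagram monoid" where
  "TL_le n k \<equiv> truncation (TL n) k"


section \<open>Double factorial\<close>

fun double_fact :: "nat \<Rightarrow> nat" where
  "double_fact 0 = 1"
| "double_fact (Suc 0) = 1"
| "double_fact (Suc (Suc n)) = Suc (Suc n) * double_fact n"

end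

theory Submission
  imports
    Defs
    "HOL-Combinatorics.Permutations"
    "HOL-Real_Asymp.Real_Asymp"
    "Jordan_Normal_Form.DL_Rank"
begin

text \<open>
  The rank of a diagram is its number of through strands; the non-units of the truncated monoids
  are the diagrams of rank at most \<open>k\<close>. A representation of the Brauer monoid restricts to the
  Temperley--Lieb monoid, which settles faithfulness at once. For the two gaps, information must also
  flow back from the planar diagrams to all diagrams.

  The main tool is the reflection \<open>a\<^sup>*\<close> of a diagram in a horizontal line. It reverses products, and
  \<open>a a\<^sup>* b = b\<close> as soon as every top arc of \<open>a\<close> is a top arc of \<open>b\<close> (\<open>stack_stack_flip\<close>). Therefore
  right cells are the fibres of the set of top arcs, left cells are the fibres of the set of bottom
  arcs, and \<open>b\<^sup>* b\<close> is the projection given by the bottom arcs of \<open>b\<close>. A planar diagram is determined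
  by its arcs, so the \<open>H\<close>-cells of the planar monoid are singletons. That the planar diagrams are
  closed under products is shown by viewing two stacked diagrams as one matching of points on a line
  and by gluing neighbouring points one pair at a time (\<open>noncrossing_contract\<close>, \<open>stack_involution\<close>).

  Representation gap. Suppose that a representation of the Brauer monoid is so small that every
  Temperley--Lieb representation of its dimension is a sum of trivial ones. Permuting the positions
  by \<open>g\<close> is an automorphism of the Brauer monoid, so the planar non-units, conjugated by \<open>g\<close>, all act
  by one matrix \<open>E\<^sub>g\<close>. A planar non-unit with the arc \<open>{i, i + 1}\<close> on both sides is fixed by the
  transposition of \<open>i\<close> and \<open>i + 1\<close>; hence \<open>E\<^sub>g\<close> does not change when \<open>g\<close> is multiplied by an adjacent
  transposition, and it is a constant \<open>E\<close>. Every projection \<open>b\<^sup>* b\<close> is conjugate to a planar diagram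
  and acts by \<open>E\<close>. Diagrams of rank at most one are products of two projections and act by \<open>E\<close> too.
  Finally \<open>b = b (b\<^sup>* b)\<close> acts like \<open>b E\<close>, hence like \<open>b c\<close> for a planar \<open>c\<close> of rank at most one, hence by
  \<open>E\<close> (\<open>planar_conjugates_constant_imp_constant\<close>). So the given representation is itself a sum of
  trivial ones (\<open>m_trivial_Br_of_TL\<close>).

  Semisimple gap. The simple representations whose apex is the unit or has rank at most one are
  trivial, so a nontrivial one has an apex of some rank \<open>j \<ge> 2\<close> (\<open>nontrivial_simple_apex\<close>). For the
  Brauer monoid its semisimple dimension is a positive multiple of the number of half diagrams of
  rank \<open>j\<close> (\<open>card_left_cell_Br\<close>). Restricted to the planar diagrams it is nonzero on a planar
  projection \<open>p\<close> of rank \<open>j\<close> and zero in smaller rank. A simple subquotient with the same property has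
  apex \<open>p\<close>, and since the \<open>H\<close>-cell of \<open>p\<close> is a singleton, its semisimple dimension is the size of the
  left cell of \<open>p\<close>, which embeds into the same set of half diagrams (\<open>exists_TL_simple\<close>).

  Double factorial. There are at least \<open>(n choose j) (n - j - 1)!!\<close> half diagrams of rank \<open>j\<close>. Passing
  from \<open>j\<close> to \<open>j + 2\<close> multiplies this number by \<open>(n - j) / ((j + 1) (j + 2))\<close>, so it is at least
  \<open>(n - 1)!!\<close> times \<open>(n - j)^(j div 2) / j!\<close>, and the last factor is at least one for large \<open>n \<ge> j\<^sup>2 / 4\<close>
  (\<open>eventually_half_diagrams_bound\<close>). The order of growth of \<open>(n - 1)!!\<close> follows by comparing the
  factors from \<open>n\<close> to \<open>n + 2\<close>, whose logarithms differ by a summable amount (\<open>double_fact_theta\<close>).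
\<close>

section \<open>Gluing neighbouring points of a noncrossing matching\<close>

definition fpf_involution :: "'a set \<Rightarrow> ('a \<Rightarrow> 'a) \<Rightarrow> bool" where
  "fpf_involution X f \<longleftrightarrow> (\<forall>x\<in>X. f x \<in> X \<and> f x \<noteq> x \<and> f (f x) = x)"

text \<open>
  The partner map after gluing \<open>p\<close> to \<open>q\<close> and deleting both: their partners become partners of each
  other. If \<open>p\<close> and \<open>q\<close> are partners, the glued component is closed and nothing else changes.
\<close>
definition contract :: "'a \<Rightarrow> 'a \<Rightarrow> ('a \<Rightarrow> 'a) \<Rightarrow> 'a \<Rightarrow> 'a" where
  "contract p q f = (\<lambda>x. if f x = p then f q else if f x = q then f p else f x)"

text \<open>
  An arc \<open>{x, f x}\<close> separates \<open>y\<close> from \<open>z\<close> iff exactly one of them lies between its ends. No arc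
  separates the two ends of another one. In this symmetric form the condition is a sum modulo 2,
  which makes gluing a matter of adding such sums.
\<close>
definition noncrossing :: "('a \<Rightarrow> nat) \<Rightarrow> 'a set \<Rightarrow> ('a \<Rightarrow> 'a) \<Rightarrow> bool" where
  "noncrossing pos X f \<longleftrightarrow>
     (\<forall>x\<in>X. \<forall>y\<in>X. y \<noteq> x \<longrightarrow> y \<noteq> f x \<longrightarrow>
        ((pos x < pos y) = (pos (f x) < pos y)) = ((pos x < pos (f y)) = (pos (f x) < pos (f y))))"

lemma fpf_contract:
  assumes "fpf_involution X f" "p \<in> X" "q \<in> X" "p \<noteq> q"
  shows "fpf_involution (X - {p, q}) (contract p q f)"
proof -
  have inv: "\<And>x. x \<in> X \<Longrightarrow> f x \<in> X" "\<And>x. x \<in> X \<Longrightarrow> f (f x) = x" "\<And>x. x \<in> X \<Longrightarrow> f x \<noteq> x"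
    using assms(1) by (auto simp: fpf_involution_def)
  show ?thesis unfolding fpf_involution_def
  proof
    fix x assume x: "x \<in> X - {p, q}"
    consider "f x = p" | "f x = q" | "f x \<notin> {p, q}" by blast
    then show "contract p q f x \<in> X - {p, q} \<and> contract p q f x \<noteq> x \<and>
      contract p q f (contract p q f x) = x"
    proof cases
      case 1
      then have "x = f p" using inv(2)[of x] x by auto
      then have "f q \<noteq> p" "f q \<noteq> x" "f q \<in> X" using inv x assms by (metis Diff_iff insertCI)+
      then show ?thesis using 1 \<open>x = f p\<close> inv(2,3)[of q] assms by (simp add: contract_def)
    next
      case 2
      then have "x = f q" using inv(2)[of x] x by auto
      then have "f p \<noteq> q" "f p \<noteq> x" "f p \<in> X" using inv x assms by (metis Diff_iff insertCI)+
      then show ?thesis using 2 \<open>x = f q\<close> inv(2,3)[of p] assms by (simp add: contract_def)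
    next
      case 3
      then show ?thesis using x inv(1-3)[of x] by (simp add: contract_def)
    qed
  qed
qed

text \<open>
  Neighbouring points \<open>p\<close> and \<open>q\<close> lie on the same side of every other point. Hence the new arc between
  the partners of \<open>p\<close> and \<open>q\<close> separates two points iff exactly one of the two old arcs does, and neither
  old arc separates the ends of a third arc.
\<close>
lemma noncrossing_contract:
  assumes f: "fpf_involution X f" and p: "p \<in> X" and q: "q \<in> X" and pq: "p \<noteq> q"
    and nc: "noncrossing pos X f"
    and adj: "\<And>z. z \<in> X - {p, q} \<Longrightarrow> (pos p < pos z) = (pos q < pos z)"
    and adj': "\<And>z. z \<in> X - {p, q} \<Longrightarrow> (pos z < pos p) = (pos z < pos q)"
  shows "noncrossing pos (X - {p, q}) (contract p q f)"
proof -
  have inv: "\<And>x. x \<in> X \<Longrightarrow> f x \<in> X" "\<And>x. x \<in> X \<Longrightarrow> f (f x) = x" "\<And>x. x \<in> X \<Longrightarrow> f x \<noteq> x"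
    using f by (auto simp: fpf_involution_def)
  have N: "((pos x < pos y) = (pos (f x) < pos y)) = ((pos x < pos (f y)) = (pos (f x) < pos (f y)))"
    if "x \<in> X" "y \<in> X" "y \<noteq> x" "y \<noteq> f x" for x y
    using nc that unfolding noncrossing_def by blast
  show ?thesis unfolding noncrossing_def
  proof (intro ballI impI)
    fix x y assume x: "x \<in> X - {p, q}" and y: "y \<in> X - {p, q}" and "y \<noteq> x"
      and ne: "y \<noteq> contract p q f x"
    let ?g = "contract p q f"
    have key: "((pos (f p) < pos z) = (pos (f q) < pos z)) = ((pos (f p) < pos (f z)) = (pos (f q) < pos (f z)))"
      if z: "z \<in> X - {p, q}" "f z \<notin> {p, q}" for z
    proof -
      have "z \<noteq> f p" "z \<noteq> f q" "z \<noteq> p" "z \<noteq> q" "f z \<in> X" using z p q inv by auto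
      then have
        "((pos p < pos z) = (pos (f p) < pos z)) = ((pos p < pos (f z)) = (pos (f p) < pos (f z)))"
        "((pos q < pos z) = (pos (f q) < pos z)) = ((pos q < pos (f z)) = (pos (f q) < pos (f z)))"
        "(pos p < pos z) = (pos q < pos z)" "(pos p < pos (f z)) = (pos q < pos (f z))"
        using N[of p z] N[of q z] adj[of z] adj[of "f z"] z p q by auto
      then show ?thesis by satx
    qed
    consider "f x \<in> {p, q}" "f y \<in> {p, q}" | "f x \<in> {p, q}" "f y \<notin> {p, q}"
      | "f x \<notin> {p, q}" "f y \<in> {p, q}" | "f x \<notin> {p, q}" "f y \<notin> {p, q}" by blast
    then show "((pos x < pos y) = (pos (?g x) < pos y)) = ((pos x < pos (?g y)) = (pos (?g x) < pos (?g y)))"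
    proof cases
      case 1
      have False
      proof (cases "f x = f y")
        case True
        then show False using inv(2)[of x] inv(2)[of y] x y \<open>y \<noteq> x\<close> by auto
      next
        case False
        then consider "f x = p" "f y = q" | "f x = q" "f y = p" using 1 by auto
        then show False
        proof cases
          case a: 1
          then have "contract p q f x = f q" "f q = y" using inv(2)[of y] y by (auto simp: contract_def)
          then show False using ne by simp
        next
          case a: 2
          then have "contract p q f x = f p" "f p = y" using inv(2)[of y] y pq by (auto simp: contract_def)
          then show False using ne by simp
        qed
      qed
      then show ?thesis ..
    next
      case 2
      then have "?g y = f y" by (auto simp: contract_def)
      moreover have "x = f p \<and> ?g x = f q \<or> x = f q \<and> ?g x = f p"
        using 2 inv(2)[of x] x pq by (auto simp: contract_def)
      moreover have "((pos (f p) < pos y) = (pos (f q) < pos y)) = ((pos (f p) < pos (f y)) = (pos (f q) < pos (f y)))"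
        using key[of y] 2(2) y by blast
      ultimately show ?thesis by (metis (no_types, lifting))
    next
      case 3
      then have "?g x = f x" by (auto simp: contract_def)
      moreover have "y = f p \<and> ?g y = f q \<or> y = f q \<and> ?g y = f p"
        using 3 inv(2)[of y] y pq by (auto simp: contract_def)
      moreover have "((pos x < pos (f p)) = (pos (f x) < pos (f p))) =
          ((pos x < pos (f q)) = (pos (f x) < pos (f q)))"
      proof -
        have "p \<noteq> f x" "q \<noteq> f x" using 3 by auto
        then have "((pos x < pos p) = (pos (f x) < pos p)) = ((pos x < pos (f p)) = (pos (f x) < pos (f p)))"
          "((pos x < pos q) = (pos (f x) < pos q)) = ((pos x < pos (f q)) = (pos (f x) < pos (f q)))"
          using N[of x p] N[of x q] x p q by auto
        moreover have "(pos x < pos p) = (pos x < pos q)" "(pos (f x) < pos p) = (pos (f x) < pos q)"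
          using adj'[of x] adj'[of "f x"] x 3 inv(1)[of x] by auto
        ultimately show ?thesis by satx
      qed
      ultimately show ?thesis by (metis (no_types, lifting))
    next
      case 4
      then have "?g x = f x" "?g y = f y" by (auto simp: contract_def)
      then show ?thesis using N[of x y] x y \<open>y \<noteq> x\<close> ne by simp
    qed
  qed
qed

definition graph_on :: "'a set \<Rightarrow> ('a \<Rightarrow> 'a) \<Rightarrow> ('a \<times> 'a) set" where
  "graph_on X f = {(x, f x) | x. x \<in> X}"

lemma rtrancl_map:
  assumes "(x, y) \<in> E\<^sup>*" and "\<And>u v. (u, v) \<in> E \<Longrightarrow> (\<phi> u, \<phi> v) \<in> E'\<^sup>*"
  shows "(\<phi> x, \<phi> y) \<in> E'\<^sup>*"
  using assms(1) by (induction rule: rtrancl_induct) (auto intro: rtrancl_trans assms(2))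

text \<open>
  For connectivity, a glued pair may be bypassed: a path through the edge between \<open>p\<close> and \<open>q\<close> enters and
  leaves through their partners, and these are joined after the contraction.
\<close>
lemma contract_connected:
  assumes f: "fpf_involution X f" and p: "p \<in> X" and q: "q \<in> X" and pq: "p \<noteq> q"
    and C: "C \<subseteq> (X - {p, q}) \<times> (X - {p, q})"
    and x: "x \<in> X - {p, q}" and y: "y \<in> X - {p, q}"
  shows "(x, y) \<in> (graph_on X f \<union> {(p, q), (q, p)} \<union> C)\<^sup>* \<longleftrightarrow>
         (x, y) \<in> (graph_on (X - {p, q}) (contract p q f) \<union> C)\<^sup>*"
    (is "_ \<in> ?E\<^sup>* \<longleftrightarrow> _ \<in> ?E'\<^sup>*")
proof
  have inv: "\<And>x. x \<in> X \<Longrightarrow> f x \<in> X" "\<And>x. x \<in> X \<Longrightarrow> f (f x) = x" "\<And>x. x \<in> X \<Longrightarrow> f x \<noteq> x"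
    using f by (auto simp: fpf_involution_def)
  assume "(x, y) \<in> ?E'\<^sup>*"
  then have "(id x, id y) \<in> ?E\<^sup>*"
  proof (rule rtrancl_map)
    fix u v assume uv: "(u, v) \<in> ?E'"
    have e: "(z, f z) \<in> ?E" if "z \<in> X" for z using that by (auto simp: graph_on_def)
    show "(id u, id v) \<in> ?E\<^sup>*"
    proof (cases "(u, v) \<in> C")
      case True then show ?thesis by auto
    next
      case False
      then have u: "u \<in> X - {p, q}" and v: "v = contract p q f u" using uv by (auto simp: graph_on_def)
      consider "f u = p" "v = f q" | "f u = q" "v = f p" | "v = f u"
        using v by (auto simp: contract_def split: if_splits)
      then show ?thesis
      proof cases
        case 1
        have "(u, p) \<in> ?E" "(p, q) \<in> ?E" "(q, f q) \<in> ?E" using e[of u] e[of q] u q 1 by auto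
        then show ?thesis using 1 unfolding id_apply by (blast intro: converse_rtrancl_into_rtrancl)
      next
        case 2
        have "(u, q) \<in> ?E" "(q, p) \<in> ?E" "(p, f p) \<in> ?E" using e[of u] e[of p] u p 2 by auto
        then show ?thesis using 2 unfolding id_apply by (blast intro: converse_rtrancl_into_rtrancl)
      next
        case 3 then show ?thesis using e[of u] u by auto
      qed
    qed
  qed
  then show "(x, y) \<in> ?E\<^sup>*" by simp
next
  have inv: "\<And>x. x \<in> X \<Longrightarrow> f x \<in> X" "\<And>x. x \<in> X \<Longrightarrow> f (f x) = x" "\<And>x. x \<in> X \<Longrightarrow> f x \<noteq> x"
    using f by (auto simp: fpf_involution_def)
  assume xy: "(x, y) \<in> ?E\<^sup>*"
  \<comment> \<open>The retraction that sends each glued point to the partner of the other one.\<close>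
  define \<phi> where "\<phi> z = (if f p = q \<and> z \<in> {p, q} then p else if z = p then f q else if z = q then f p else z)" for z
  have "(\<phi> x, \<phi> y) \<in> ?E'\<^sup>*"
    using xy
  proof (rule rtrancl_map)
    have g: "(z, contract p q f z) \<in> ?E'" if "z \<in> X - {p, q}" for z using that by (auto simp: graph_on_def)
    fix u v assume "(u, v) \<in> ?E"
    then consider "(u, v) \<in> C" | "u = p" "v = q" | "u = q" "v = p" | "u \<in> X" "v = f u" "(u,v) \<notin> C"
      by (auto simp: graph_on_def)
    then show "(\<phi> u, \<phi> v) \<in> ?E'\<^sup>*"
    proof cases
      case 1
      then have "\<phi> u = u" "\<phi> v = v" using C by (auto simp: \<phi>_def)
      then show ?thesis using 1 by auto
    next
      case 2
      show ?thesis
      proof (cases "f p = q")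
        case False
        then have "f q \<in> X - {p, q}" "contract p q f (f q) = f p" "f q \<noteq> p" "f p \<noteq> q"
          using inv p q pq by (auto simp: contract_def)
        then show ?thesis using g[of "f q"] 2 pq by (auto simp: \<phi>_def)
      qed (use 2 in \<open>auto simp: \<phi>_def\<close>)
    next
      case 3
      show ?thesis
      proof (cases "f p = q")
        case False
        then have "f p \<in> X - {p, q}" "contract p q f (f p) = f q" "f p \<noteq> q"
          using inv p q pq by (auto simp: contract_def)
        then show ?thesis using g[of "f p"] 3 pq by (auto simp: \<phi>_def)
      qed (use 3 in \<open>auto simp: \<phi>_def\<close>)
    next
      case 4
      show ?thesis
      proof (cases "f p = q")
        case True
        then have "f q = p" using inv p by auto
        show ?thesis
        proof (cases "u \<in> {p, q}")
          case True then show ?thesis using 4 \<open>f p = q\<close> \<open>f q = p\<close> by (auto simp: \<phi>_def)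
        next
          case False
          then have "f u \<notin> {p, q}" using \<open>f p = q\<close> \<open>f q = p\<close> inv 4 by (metis insert_iff singletonD)
          then show ?thesis using False g[of u] 4 by (auto simp: \<phi>_def contract_def)
        qed
      next
        case False
        then have fq: "f q \<noteq> p" using inv q by auto
        consider "u = p" | "u = q" | "f u = p" "u \<notin> {p, q}" | "f u = q" "u \<notin> {p, q}" | "u \<notin> {p,q}" "f u \<notin> {p,q}" by blast
        then show ?thesis
        proof cases
          case 1
          have "f q \<in> X - {p, q}" "contract p q f (f q) = f p" using inv p q pq False fq by (auto simp: contract_def)
          then show ?thesis using g[of "f q"] 1 4 False inv(3)[OF p] by (auto simp: \<phi>_def)
        next
          case 2
          have "f p \<in> X - {p, q}" "contract p q f (f p) = f q" using inv p q pq False fq by (auto simp: contract_def)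
          then show ?thesis using g[of "f p"] 2 4 False inv(3)[OF q] fq pq by (auto simp: \<phi>_def)
        next
          case 3
          then have "u = f p" using inv 4 by auto
          then show ?thesis using 3 4 g[of u] False by (auto simp: \<phi>_def contract_def)
        next
          case 4: 4
          then show ?thesis using \<open>u \<in> X\<close> \<open>v = f u\<close> g[of u] False pq by (auto simp: \<phi>_def contract_def)
        next
          case 5
          then show ?thesis using 4 g[of u] by (auto simp: \<phi>_def contract_def)
        qed
      qed
    qed
  qed
  moreover have "\<phi> x = x" "\<phi> y = y" using x y by (auto simp: \<phi>_def)
  ultimately show "(x, y) \<in> ?E'\<^sup>*" by simp
qed

text \<open>
  Gluing the pairs one after the other leaves a matching whose arcs are the connected components of
  the glued graph. Each pair only has to be adjacent at the moment when it is glued.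
\<close>
lemma contract_all:
  fixes p q :: "nat \<Rightarrow> 'a"
  assumes f: "fpf_involution X f"
    and pX: "\<And>i. i < n \<Longrightarrow> p i \<in> X" and qX: "\<And>i. i < n \<Longrightarrow> q i \<in> X"
    and pq: "\<And>i j. i < n \<Longrightarrow> j < n \<Longrightarrow> p i \<noteq> q j"
    and inj: "inj_on p {..<n}" "inj_on q {..<n}"
    and adj: "\<And>i z. i < n \<Longrightarrow> z \<in> X - (p ` {..i} \<union> q ` {..i}) \<Longrightarrow>
      (pos (p i) < pos z) = (pos (q i) < pos z) \<and> (pos z < pos (p i)) = (pos z < pos (q i))"
  shows "\<exists>g. fpf_involution (X - (p ` {..<n} \<union> q ` {..<n})) g \<and>
     (noncrossing pos X f \<longrightarrow> noncrossing pos (X - (p ` {..<n} \<union> q ` {..<n})) g) \<and>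
     (\<forall>x \<in> X - (p ` {..<n} \<union> q ` {..<n}). \<forall>y \<in> X - (p ` {..<n} \<union> q ` {..<n}).
        (x, y) \<in> (graph_on X f \<union> {(u, v). \<exists>i<n. {u, v} = {p i, q i}})\<^sup>* \<longleftrightarrow> y = x \<or> y = g x)"
proof -
  let ?X = "\<lambda>m::nat. X - (p ` {..<m} \<union> q ` {..<m})"
  let ?C = "\<lambda>m::nat. {(u, v). \<exists>i. m \<le> i \<and> i < n \<and> {u, v} = {p i, q i}}"
  \<comment> \<open>Distinct pairs do not share points.\<close>
  have dist: "p i \<noteq> p j \<and> p i \<noteq> q j \<and> q i \<noteq> p j \<and> q i \<noteq> q j" if "i < n" "j < i" for i j
    using pq[of i j] pq[of j i] inj_onD[OF inj(1), of i j] inj_onD[OF inj(2), of i j] that by auto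
  have "\<exists>g. fpf_involution (?X m) g \<and> (noncrossing pos X f \<longrightarrow> noncrossing pos (?X m) g) \<and>
      (\<forall>x\<in>?X m. \<forall>y\<in>?X m. (x, y) \<in> (graph_on X f \<union> ?C 0)\<^sup>* \<longleftrightarrow> (x, y) \<in> (graph_on (?X m) g \<union> ?C m)\<^sup>*)"
    if "m \<le> n" for m
    using that
  proof (induction m)
    case 0
    show ?case using f by (intro exI[of _ f]) auto
  next
    case (Suc m)
    then obtain g where g: "fpf_involution (?X m) g" "noncrossing pos X f \<longrightarrow> noncrossing pos (?X m) g"
      and conn: "\<And>x y. x \<in> ?X m \<Longrightarrow> y \<in> ?X m \<Longrightarrow>
        (x, y) \<in> (graph_on X f \<union> ?C 0)\<^sup>* \<longleftrightarrow> (x, y) \<in> (graph_on (?X m) g \<union> ?C m)\<^sup>*"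
      by (meson Suc_leD)
    have m: "m < n" using Suc by auto
    have pm: "p m \<in> ?X m" and qm: "q m \<in> ?X m" using dist[OF m] pX[OF m] qX[OF m] by auto
    have ne: "p m \<noteq> q m" using pq m by auto
    have X': "?X (Suc m) = ?X m - {p m, q m}" by (auto simp: lessThan_Suc)
    have C': "?C m = {(p m, q m), (q m, p m)} \<union> ?C (Suc m)"
    proof -
      have "m \<le> i \<longleftrightarrow> i = m \<or> Suc m \<le> i" for i by auto
      then show ?thesis using m by (auto simp: doubleton_eq_iff)
    qed
    have Csub: "?C (Suc m) \<subseteq> (?X m - {p m, q m}) \<times> (?X m - {p m, q m})"
    proof (rule subrelI)
      fix u v assume "(u, v) \<in> ?C (Suc m)"
      then obtain i where i: "Suc m \<le> i" "i < n" "{u, v} = {p i, q i}" by blast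
      have dist': "p i \<noteq> p j \<and> p i \<noteq> q j \<and> q i \<noteq> p j \<and> q i \<noteq> q j" if "j \<le> m" for j
        using dist[OF i(2), of j] that i(1) by auto
      have *: "p i \<in> ?X m - {p m, q m}" "q i \<in> ?X m - {p m, q m}"
        using dist'[of m] dist'[OF less_imp_le] pX[OF i(2)] qX[OF i(2)] by blast+
      then show "(u, v) \<in> (?X m - {p m, q m}) \<times> (?X m - {p m, q m})"
        using i(3) by (auto simp: doubleton_eq_iff)
    qed
    let ?h = "contract (p m) (q m) g"
    have aX: "z \<in> X - (p ` {..m} \<union> q ` {..m})" if "z \<in> ?X m - {p m, q m}" for z
      using that X' by (auto simp: atMost_Suc lessThan_Suc_atMost[symmetric])
    have "fpf_involution (?X (Suc m)) ?h" unfolding X' by (rule fpf_contract[OF g(1) pm qm ne])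
    moreover have "noncrossing pos X f \<longrightarrow> noncrossing pos (?X (Suc m)) ?h" unfolding X'
    proof
      assume "noncrossing pos X f"
      then have "noncrossing pos (?X m) g" using g(2) by blast
      then show "noncrossing pos (?X m - {p m, q m}) ?h"
        by (rule noncrossing_contract[OF g(1) pm qm ne]) (use adj[OF m aX] in blast)+
    qed
    moreover have "(x, y) \<in> (graph_on X f \<union> ?C 0)\<^sup>* \<longleftrightarrow> (x, y) \<in> (graph_on (?X (Suc m)) ?h \<union> ?C (Suc m))\<^sup>*"
      if "x \<in> ?X (Suc m)" "y \<in> ?X (Suc m)" for x y
    proof -
      have xy: "x \<in> ?X m - {p m, q m}" "y \<in> ?X m - {p m, q m}" using that X' by auto
      have "(x, y) \<in> (graph_on X f \<union> ?C 0)\<^sup>* \<longleftrightarrow> (x, y) \<in> (graph_on (?X m) g \<union> ?C m)\<^sup>*"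
        using conn xy by blast
      then show ?thesis
        using contract_connected[OF g(1) pm qm ne Csub xy] unfolding C' X' by (simp only: Un_assoc)
    qed
    ultimately show ?case by blast
  qed
  from this[of n] obtain g where g: "fpf_involution (?X n) g" "noncrossing pos X f \<longrightarrow> noncrossing pos (?X n) g"
    and conn: "\<And>x y. x \<in> ?X n \<Longrightarrow> y \<in> ?X n \<Longrightarrow>
        (x, y) \<in> (graph_on X f \<union> ?C 0)\<^sup>* \<longleftrightarrow> (x, y) \<in> (graph_on (?X n) g \<union> ?C n)\<^sup>*"
    by auto
  have "(x, y) \<in> (graph_on (?X n) g \<union> ?C n)\<^sup>* \<longleftrightarrow> y = x \<or> y = g x" if x: "x \<in> ?X n" for x y
  proof
    assume "(x, y) \<in> (graph_on (?X n) g \<union> ?C n)\<^sup>*"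
    then show "y = x \<or> y = g x"
      by (induction rule: rtrancl_induct) (use g(1) x in \<open>auto simp: graph_on_def fpf_involution_def\<close>)
  next
    assume "y = x \<or> y = g x"
    then show "(x, y) \<in> (graph_on (?X n) g \<union> ?C n)\<^sup>*" using x by (auto simp: graph_on_def)
  qed
  moreover have "?C 0 = {(u, v). \<exists>i<n. {u, v} = {p i, q i}}" by auto
  ultimately show ?thesis using g conn by (intro exI[of _ g]) simp
qed

section \<open>Perfect matchings and planarity\<close>

lemma pm_block:
  assumes "perfect_matching n a" "{x, y} \<in> a"
  shows "x \<in> points n" "y \<in> points n" "x \<noteq> y"
  using assms by (auto simp: perfect_matching_def partition_on_def card_2_iff doubleton_eq_iff)

lemma pm_blockE:
  assumes "perfect_matching n a" "B \<in> a"
  obtains x y where "B = {x, y}" "x \<in> points n" "y \<in> points n" "x \<noteq> y"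
proof -
  obtain x y where "B = {x, y}" "x \<noteq> y" using assms by (auto simp: perfect_matching_def card_2_iff)
  then show ?thesis using that[of x y] pm_block[OF assms(1), of x y] assms(2) by auto
qed

lemma pm_unique:
  assumes "perfect_matching n a" "{x, y} \<in> a" "{x, z} \<in> a"
  shows "y = z"
proof -
  have "disjoint a" using assms by (simp add: perfect_matching_def partition_on_def)
  then have "{x, y} = {x, z}" using assms(2,3) disjointD by fastforce
  then show ?thesis by (auto simp: doubleton_eq_iff)
qed

lemma pm_partner:
  assumes "perfect_matching n a" "x \<in> points n"
  obtains y where "{x, y} \<in> a"
proof -
  obtain B where "B \<in> a" "x \<in> B" using assms by (auto simp: perfect_matching_def partition_on_def)
  moreover obtain u v where "B = {u, v}" using pm_blockE[OF assms(1) \<open>B \<in> a\<close>] by blast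
  ultimately consider "{x, v} \<in> a" | "{x, u} \<in> a" by (auto simp: insert_commute)
  then show ?thesis using that by cases
qed

lemma pmI:
  assumes "\<And>B. B \<in> a \<Longrightarrow> \<exists>x\<in>points n. \<exists>y\<in>points n. x \<noteq> y \<and> B = {x, y}"
    and "\<And>x. x \<in> points n \<Longrightarrow> \<exists>y. {x, y} \<in> a"
    and "\<And>x y z. {x, y} \<in> a \<Longrightarrow> {x, z} \<in> a \<Longrightarrow> y = z"
  shows "perfect_matching n a"
proof -
  have "\<Union>a \<subseteq> points n"
  proof
    fix x assume "x \<in> \<Union>a"
    then obtain B where "B \<in> a" "x \<in> B" by auto
    then show "x \<in> points n" using assms(1)[of B] by auto
  qed
  moreover have "points n \<subseteq> \<Union>a" using assms(2) by blast
  moreover have "disjoint a"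
  proof (rule disjointI, rule ccontr)
    fix B C assume BC: "B \<in> a" "C \<in> a" "B \<noteq> C" "B \<inter> C \<noteq> {}"
    then obtain x where x: "x \<in> B" "x \<in> C" by auto
    have "\<exists>y. D = {x, y}" if "D \<in> a" "x \<in> D" for D using assms(1)[OF that(1)] that(2) by auto
    then obtain y z where "B = {x, y}" "C = {x, z}" using BC x by metis
    then show False using assms(3) BC by blast
  qed
  moreover have "{} \<notin> a" "\<forall>B\<in>a. card B = 2" using assms(1) by (fastforce simp: card_2_iff)+
  ultimately show ?thesis by (simp add: perfect_matching_def partition_on_def)
qed

lemma pm_eqI:
  assumes a: "perfect_matching n a" and b: "perfect_matching n b" and sub: "a \<subseteq> b"
  shows "a = b"
proof
  show "b \<subseteq> a"
  proof
    fix B assume B: "B \<in> b"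
    then obtain x y where xy: "B = {x, y}" "x \<in> points n" using pm_blockE[OF b] by metis
    obtain z where "{x, z} \<in> a" using pm_partner[OF a xy(2)] by metis
    then show "B \<in> a" using pm_unique[OF b, of x y z] xy B sub by auto
  qed
qed (rule sub)

definition partner :: "diagram \<Rightarrow> point \<Rightarrow> point" where
  "partner a x = (THE y. {x, y} \<in> a)"

lemma partner_iff:
  assumes "perfect_matching n a"
  shows "{x, y} \<in> a \<longleftrightarrow> x \<in> points n \<and> y = partner a x"
proof -
  have "{x, y} \<in> a \<Longrightarrow> partner a x = y" for y
    unfolding partner_def using pm_unique[OF assms] by (intro the_equality) auto
  then show ?thesis using pm_block[OF assms] pm_partner[OF assms] by metis
qed

lemma fpf_partner:
  assumes "perfect_matching n a"
  shows "fpf_involution (points n) (partner a)"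
  unfolding fpf_involution_def
proof
  fix x assume x: "x \<in> points n"
  then have "{x, partner a x} \<in> a" using partner_iff[OF assms] by auto
  then show "partner a x \<in> points n \<and> partner a x \<noteq> x \<and> partner a (partner a x) = x"
    using pm_block[OF assms] partner_iff[OF assms] by (metis insert_commute)
qed

lemma boundary_pos_inj: "inj_on (boundary_pos n) (points n)"
  by (auto simp: inj_on_def points_def)

text \<open>
  The combinatorial core of the next lemma: two disjoint arcs on a line do not interleave in any of
  the eight possible orders iff neither separates the ends of the other.
\<close>
lemma separation_eq:
  fixes a b c d :: nat
  assumes "a \<noteq> c" "a \<noteq> b" "a \<noteq> d" "c \<noteq> b" "c \<noteq> d" "b \<noteq> d"
    and "\<not> (a < c \<and> c < b \<and> b < d)" "\<not> (a < d \<and> d < b \<and> b < c)"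
    and "\<not> (b < c \<and> c < a \<and> a < d)" "\<not> (b < d \<and> d < a \<and> a < c)"
    and "\<not> (c < a \<and> a < d \<and> d < b)" "\<not> (c < b \<and> b < d \<and> d < a)"
    and "\<not> (d < a \<and> a < c \<and> c < b)" "\<not> (d < b \<and> b < c \<and> c < a)"
  shows "((a < c) = (b < c)) = ((a < d) = (b < d))"
proof -
  have *: "((a < c) = (b < c)) = ((a < d) = (b < d))"
    if "a < b" "c < d" "a \<noteq> c" "a \<noteq> d" "c \<noteq> b" "b \<noteq> d" "\<not> (a < c \<and> c < b \<and> b < d)" "\<not> (c < a \<and> a < d \<and> d < b)" for a b c d :: nat
    using that by linarith
  consider "a < b" "c < d" | "a < b" "d < c" | "b < a" "c < d" | "b < a" "d < c"
    using assms(2,5) by linarith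
  then show ?thesis
  proof cases
    case 1 show ?thesis by (rule *[OF 1]) (use assms in auto)
  next
    case 2
    have "((a < d) = (b < d)) = ((a < c) = (b < c))" by (rule *[OF 2]) (use assms in auto)
    then show ?thesis by satx
  next
    case 3
    have "((b < c) = (a < c)) = ((b < d) = (a < d))" by (rule *[OF 3]) (use assms in auto)
    then show ?thesis by satx
  next
    case 4
    have "((b < d) = (a < d)) = ((b < c) = (a < c))" by (rule *[OF 4]) (use assms in auto)
    then show ?thesis by satx
  qed
qed

lemma planar_iff_noncrossing:
  assumes F: "fpf_involution (points n) F" and a: "\<And>x y. {x, y} \<in> a \<longleftrightarrow> x \<in> points n \<and> y = F x"
  shows "planar n a \<longleftrightarrow> noncrossing (boundary_pos n) (points n) F"
proof
  let ?p = "boundary_pos n"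
  assume pl: "planar n a"
  show "noncrossing (boundary_pos n) (points n) F" unfolding noncrossing_def
  proof (intro ballI impI)
    fix x y assume x: "x \<in> points n" and y: "y \<in> points n" and ne: "y \<noteq> x" "y \<noteq> F x"
    have FX: "F x \<in> points n" "F y \<in> points n" "F (F x) = x" "F (F y) = y" "F x \<noteq> x" "F y \<noteq> y"
      using F x y by (auto simp: fpf_involution_def)
    then have ne': "F y \<noteq> x" "F y \<noteq> F x" using ne by metis+
    have I: "?p u \<noteq> ?p v" if "u \<in> points n" "v \<in> points n" "u \<noteq> v" for u v
      using that boundary_pos_inj[of n] by (auto dest: inj_onD)
    have d: "?p x \<noteq> ?p y" "?p x \<noteq> ?p (F x)" "?p x \<noteq> ?p (F y)" "?p y \<noteq> ?p (F x)" "?p y \<noteq> ?p (F y)" "?p (F x) \<noteq> ?p (F y)"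
      using I[OF x y] I[OF x FX(1)] I[OF x FX(2)] I[OF y FX(1)] I[OF y FX(2)] I[OF FX(1,2)]
        ne ne' FX(5,6) by metis+
    have P: "\<not> (?p u < ?p v \<and> ?p v < ?p (F u) \<and> ?p (F u) < ?p (F v))" if "u \<in> points n" "v \<in> points n" for u v
      using pl that a unfolding planar_def by blast
    show "((?p x < ?p y) = (?p (F x) < ?p y)) = ((?p x < ?p (F y)) = (?p (F x) < ?p (F y)))"
      by (rule separation_eq[OF d]; rule P[OF x y] P[OF x FX(2), unfolded FX(3,4)]
        P[OF FX(1) y, unfolded FX(3,4)] P[OF FX(1) FX(2), unfolded FX(3,4)]
        P[OF y x] P[OF y FX(1), unfolded FX(3,4)] P[OF FX(2) x, unfolded FX(3,4)]
        P[OF FX(2) FX(1), unfolded FX(3,4)])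
  qed
next
  assume nc: "noncrossing (boundary_pos n) (points n) F"
  show "planar n a" unfolding planar_def
  proof (rule notI, elim exE conjE)
    fix x y z w assume *: "{x, y} \<in> a" "{z, w} \<in> a" "boundary_pos n x < boundary_pos n z"
      "boundary_pos n z < boundary_pos n y" "boundary_pos n y < boundary_pos n w"
    then have "z \<noteq> x" "z \<noteq> y" "x \<in> points n" "z \<in> points n" "F x = y" "F z = w" using a by auto
    then show False
      using nc[unfolded noncrossing_def, rule_format, of x z] *(3-5) by simp
  qed
qed

section \<open>Products of perfect matchings\<close>

lemma stack_edges_sym: "sym (stack_edges a b)"
  unfolding stack_edges_def sym_def by (auto simp: insert_commute; metis insert_commute)

lemma stack_iff:
  "{x, y} \<in> stack a b \<longleftrightarrow> x \<noteq> y \<and> (place_outer x, place_outer y) \<in> (stack_edges a b)\<^sup>*"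
proof -
  have "sym ((stack_edges a b)\<^sup>*)" using stack_edges_sym by (rule sym_rtrancl)
  then show ?thesis unfolding stack_def by (auto simp: doubleton_eq_iff sym_def)
qed

text \<open>
  Two stacked diagrams before gluing: \<open>True\<close> marks the points of the upper diagram and \<open>False\<close> those of
  the lower one.
\<close>
definition copy_partner :: "diagram \<Rightarrow> diagram \<Rightarrow> bool \<times> point \<Rightarrow> bool \<times> point" where
  "copy_partner a b = (\<lambda>(h, x). (h, partner (if h then a else b) x))"

definition gluing :: "nat \<Rightarrow> ((bool \<times> point) \<times> (bool \<times> point)) set" where
  "gluing n = {(u, v). \<exists>i<n. {u, v} = {(False, Top i), (True, Bot i)}}"

definition outer_copy :: "point \<Rightarrow> bool \<times> point" where
  "outer_copy x = (case x of Bot i \<Rightarrow> (False, x) | Top i \<Rightarrow> (True, x))"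

lemma fpf_copy_partner:
  assumes "perfect_matching n a" "perfect_matching n b"
  shows "fpf_involution (UNIV \<times> points n) (copy_partner a b)"
  using fpf_partner[OF assms(1)] fpf_partner[OF assms(2)] by (auto simp: fpf_involution_def copy_partner_def)

text \<open>
  Splitting each middle point into its two copies, joined by a gluing edge, does not change which
  outer points are connected.
\<close>
lemma stack_connected_copies:
  assumes a: "perfect_matching n a" and b: "perfect_matching n b"
  shows "(place_outer x, place_outer y) \<in> (stack_edges a b)\<^sup>* \<longleftrightarrow>
    (outer_copy x, outer_copy y) \<in> (graph_on (UNIV \<times> points n) (copy_partner a b) \<union> gluing n)\<^sup>*"
    (is "_ \<longleftrightarrow> _ \<in> ?E\<^sup>*")
proof
  \<comment> \<open>A section of the projection from copies to levels, placing middle points in the upper copy.\<close>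
  define \<sigma> where
    "\<sigma> z = (case z of Lower i \<Rightarrow> (False, Bot i) | Middle i \<Rightarrow> (True, Bot i) | Upper i \<Rightarrow> (True, Top i))" for z
  assume "(place_outer x, place_outer y) \<in> (stack_edges a b)\<^sup>*"
  then have "(\<sigma> (place_outer x), \<sigma> (place_outer y)) \<in> ?E\<^sup>*"
  proof (rule rtrancl_map)
    fix u v assume "(u, v) \<in> stack_edges a b"
    then consider x y where "u = place_above x" "v = place_above y" "{x, y} \<in> a"
      | x y where "u = place_below x" "v = place_below y" "{x, y} \<in> b"
      unfolding stack_edges_def by blast
    then show "(\<sigma> u, \<sigma> v) \<in> ?E\<^sup>*"
    proof cases
      case 1
      have "\<sigma> (place_above z) = (True, z)" for z by (cases z) (auto simp: \<sigma>_def)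
      moreover have "((True, x), (True, y)) \<in> graph_on (UNIV \<times> points n) (copy_partner a b)"
        using 1(3) partner_iff[OF a] by (auto simp: graph_on_def copy_partner_def)
      ultimately show ?thesis using 1 by auto
    next
      case 2
      have *: "(\<sigma> (place_below z), (False, z)) \<in> ?E\<^sup>*" "((False, z), \<sigma> (place_below z)) \<in> ?E\<^sup>*"
        if "z \<in> points n" for z
      proof -
        have "\<sigma> (place_below z) = (False, z) \<or>
          ((\<sigma> (place_below z), (False, z)) \<in> gluing n \<and> ((False, z), \<sigma> (place_below z)) \<in> gluing n)"
          using that by (cases z) (auto simp: \<sigma>_def gluing_def points_def)
        then show "(\<sigma> (place_below z), (False, z)) \<in> ?E\<^sup>*" "((False, z), \<sigma> (place_below z)) \<in> ?E\<^sup>*"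
          by auto
      qed
      have "((False, x), (False, y)) \<in> ?E"
        using 2(3) partner_iff[OF b] by (auto simp: graph_on_def copy_partner_def)
      then show ?thesis
        using *[of x] *[of y] pm_block[OF b 2(3)] 2(1,2)
        by (meson r_into_rtrancl rtrancl_trans)
    qed
  qed
  moreover have "\<sigma> (place_outer z) = outer_copy z" for z by (cases z) (auto simp: \<sigma>_def outer_copy_def)
  ultimately show "(outer_copy x, outer_copy y) \<in> ?E\<^sup>*" by simp
next
  define \<pi> where "\<pi> = (\<lambda>(h, x). if h then place_above x else place_below x)"
  assume "(outer_copy x, outer_copy y) \<in> ?E\<^sup>*"
  then have "(\<pi> (outer_copy x), \<pi> (outer_copy y)) \<in> (stack_edges a b)\<^sup>*"
  proof (rule rtrancl_map)
    fix u v assume "(u, v) \<in> ?E"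
    then consider h x where "u = (h, x)" "v = (h, partner (if h then a else b) x)" "x \<in> points n"
      | "(u, v) \<in> gluing n"
      by (auto simp: graph_on_def copy_partner_def)
    then show "(\<pi> u, \<pi> v) \<in> (stack_edges a b)\<^sup>*"
    proof cases
      case 1
      then have "{x, partner (if h then a else b) x} \<in> (if h then a else b)"
        using partner_iff[OF a] partner_iff[OF b] by auto
      then have "(\<pi> u, \<pi> v) \<in> stack_edges a b"
        using 1(1,2) unfolding \<pi>_def stack_edges_def by (cases h) auto
      then show ?thesis by blast
    next
      case 2
      then have "\<pi> u = \<pi> v" by (auto simp: gluing_def \<pi>_def doubleton_eq_iff)
      then show ?thesis by simp
    qed
  qed
  moreover have "\<pi> (outer_copy z) = place_outer z" for z by (cases z) (auto simp: \<pi>_def outer_copy_def)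
  ultimately show "(place_outer x, place_outer y) \<in> (stack_edges a b)\<^sup>*" by simp
qed

text \<open>
  The boundary word of the lower diagram is followed by the one of the upper diagram, so arcs of
  different copies are far apart. In this order, the top points of the lower copy appear from right
  to left, immediately before the bottom points of the upper copy from left to right.
\<close>
lemma noncrossing_copies:
  assumes a: "perfect_matching n a" "planar n a" and b: "perfect_matching n b" "planar n b"
  shows "noncrossing (\<lambda>(h, x). boundary_pos n x + (if h then 2 * n else 0)) (UNIV \<times> points n) (copy_partner a b)"
    (is "noncrossing ?pos _ ?f")
  unfolding noncrossing_def
proof (intro ballI impI)
  have na: "noncrossing (boundary_pos n) (points n) (partner a)"
    and nb: "noncrossing (boundary_pos n) (points n) (partner b)"
    using planar_iff_noncrossing[OF fpf_partner partner_iff] a b by auto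
  have lt: "boundary_pos n x < 2 * n" if "x \<in> points n" for x using that by (auto simp: points_def)
  fix u v assume u: "u \<in> UNIV \<times> points n" and v: "v \<in> UNIV \<times> points n" and ne: "v \<noteq> u" "v \<noteq> ?f u"
  obtain h x where hx: "u = (h, x)" by force
  obtain k y where ky: "v = (k, y)" by force
  have xy: "x \<in> points n" "y \<in> points n" using u v hx ky by auto
  let ?c = "if h then a else b" and ?d = "if k then a else b"
  have l: "boundary_pos n x < 2 * n" "boundary_pos n y < 2 * n" "boundary_pos n (partner ?c x) < 2 * n"
     "boundary_pos n (partner ?d y) < 2 * n"
    using lt xy fpf_partner[OF a(1)] fpf_partner[OF b(1)] by (auto simp: fpf_involution_def)
  show "((?pos u < ?pos v) = (?pos (?f u) < ?pos v)) = ((?pos u < ?pos (?f v)) = (?pos (?f u) < ?pos (?f v)))"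
  proof (cases "h = k")
    case True
    have nc: "noncrossing (boundary_pos n) (points n) (partner ?c)" using na nb by auto
    have "y \<noteq> x" "y \<noteq> partner ?c x" using ne hx ky True by (auto simp: copy_partner_def)
    then show ?thesis using nc[unfolded noncrossing_def, rule_format, OF xy] True
      by (simp add: hx ky copy_partner_def)
  next
    case False
    then show ?thesis using l by (auto simp: hx ky copy_partner_def)
  qed
qed

text \<open>
  The gluing pairs \<open>0, 1, 2, \<dots>\<close> are nested around the border between the two boundary words, so each is
  adjacent once the previous ones are removed. Thus the product is again a matching, and it is planar
  if the factors are.
\<close>
lemma stack_involution:
  assumes a: "perfect_matching n a" and b: "perfect_matching n b"
  shows "\<exists>F. fpf_involution (points n) F \<and> (\<forall>x y. {x, y} \<in> stack a b \<longleftrightarrow> x \<in> points n \<and> y = F x) \<and>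
    (planar n a \<longrightarrow> planar n b \<longrightarrow> noncrossing (boundary_pos n) (points n) F)"
proof -
  let ?X = "UNIV \<times> points n" and ?f = "copy_partner a b"
  let ?p = "\<lambda>i. (False, Top i)" and ?q = "\<lambda>i. (True, Bot i)"
  define pos :: "bool \<times> point \<Rightarrow> nat" where "pos = (\<lambda>(h, x). boundary_pos n x + (if h then 2 * n else 0))"
  define Y where "Y = ?X - (?p ` {..<n} \<union> ?q ` {..<n})"
  note f = fpf_copy_partner[OF a b]
  have "\<exists>g. fpf_involution Y g \<and> (noncrossing pos ?X ?f \<longrightarrow> noncrossing pos Y g) \<and>
     (\<forall>x \<in> Y. \<forall>y \<in> Y. (x, y) \<in> (graph_on ?X ?f \<union> gluing n)\<^sup>* \<longleftrightarrow> y = x \<or> y = g x)"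
    unfolding Y_def gluing_def
  proof (rule contract_all[OF f])
    show "?p i \<in> ?X" "?q i \<in> ?X" if "i < n" for i using that by (auto simp: points_def)
    show "inj_on ?p {..<n}" "inj_on ?q {..<n}" by (auto simp: inj_on_def)
    fix i z assume i: "i < n" and z: "z \<in> ?X - (?p ` {..i} \<union> ?q ` {..i})"
    then consider l where "z = (False, Bot l)" "l < n" | l where "z = (False, Top l)" "l < n" "i < l"
      | l where "z = (True, Bot l)" "l < n" "i < l" | l where "z = (True, Top l)" "l < n"
      unfolding points_def by force
    then show "(pos (?p i) < pos z) = (pos (?q i) < pos z) \<and> (pos z < pos (?p i)) = (pos z < pos (?q i))"
      by cases (use i in \<open>auto simp: pos_def\<close>)
  qed simp
  then obtain g where g: "fpf_involution Y g" "noncrossing pos ?X ?f \<Longrightarrow> noncrossing pos Y g"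
    and conn: "\<And>x y. x \<in> Y \<Longrightarrow> y \<in> Y \<Longrightarrow> (x, y) \<in> (graph_on ?X ?f \<union> gluing n)\<^sup>* \<longleftrightarrow> y = x \<or> y = g x"
    by blast
  have Y: "Y = outer_copy ` points n"
  proof -
    have "Y = Pair False ` Bot ` {..<n} \<union> Pair True ` Top ` {..<n}" by (auto simp: Y_def points_def)
    then show ?thesis by (simp add: outer_copy_def points_def image_Un image_image)
  qed
  have snd: "snd (outer_copy x) = x" for x by (simp add: outer_copy_def split: point.splits)
  then have inj: "outer_copy x = outer_copy y \<longleftrightarrow> x = y" for x y by metis
  define F where "F x = snd (g (outer_copy x))" for x
  have copy_F: "outer_copy (F x) = g (outer_copy x)" "F x \<in> points n" if "x \<in> points n" for x
  proof -
    have "g (outer_copy x) \<in> Y" using g(1) that Y by (auto simp: fpf_involution_def)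
    then show "outer_copy (F x) = g (outer_copy x)" "F x \<in> points n" using Y snd by (auto simp: F_def)
  qed
  have F: "fpf_involution (points n) F" unfolding fpf_involution_def
  proof
    fix x assume x: "x \<in> points n"
    then have "outer_copy x \<in> Y" using Y by auto
    then have "g (outer_copy x) \<noteq> outer_copy x" "g (g (outer_copy x)) = outer_copy x"
      using g(1) by (auto simp: fpf_involution_def)
    then show "F x \<in> points n \<and> F x \<noteq> x \<and> F (F x) = x" using copy_F x inj by metis
  qed
  moreover have "{x, y} \<in> stack a b \<longleftrightarrow> x \<in> points n \<and> y = F x" for x y
  proof -
    let ?E = "graph_on ?X ?f \<union> gluing n"
    have pts: "x \<in> points n \<and> y \<in> points n" if "x \<noteq> y" "(outer_copy x, outer_copy y) \<in> ?E\<^sup>*"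
    proof -
      have "?E \<subseteq> ?X \<times> ?X"
      proof (rule subrelI)
        fix u v assume "(u, v) \<in> ?E"
        then consider "u \<in> ?X" "v = ?f u" | i where "i < n" "{u, v} = {?p i, ?q i}"
          by (auto simp: graph_on_def gluing_def)
        then show "(u, v) \<in> ?X \<times> ?X"
        proof cases
          case 1 then show ?thesis using f unfolding fpf_involution_def by blast
        next
          case 2 then show ?thesis by (auto simp: doubleton_eq_iff points_def)
        qed
      qed
      moreover have "outer_copy x \<noteq> outer_copy y" using that(1) inj by simp
      ultimately have "outer_copy x \<in> ?X" "outer_copy y \<in> ?X"
        using that(2) by (blast elim: converse_rtranclE rtranclE)+
      then show ?thesis by (auto simp: outer_copy_def split: point.splits)
    qed
    have "{x, y} \<in> stack a b \<longleftrightarrow> x \<noteq> y \<and> (outer_copy x, outer_copy y) \<in> ?E\<^sup>*"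
      unfolding stack_iff stack_connected_copies[OF a b] ..
    also have "\<dots> \<longleftrightarrow> x \<noteq> y \<and> x \<in> points n \<and> y \<in> points n \<and> (outer_copy x, outer_copy y) \<in> ?E\<^sup>*"
      using pts by blast
    also have "\<dots> \<longleftrightarrow> x \<noteq> y \<and> x \<in> points n \<and> y \<in> points n \<and>
        (outer_copy y = outer_copy x \<or> outer_copy y = g (outer_copy x))"
      using conn[of "outer_copy x" "outer_copy y"] Y by auto
    also have "\<dots> \<longleftrightarrow> x \<in> points n \<and> y = F x"
      using copy_F[of x] inj F by (metis fpf_involution_def)
    finally show ?thesis .
  qed
  moreover have "noncrossing (boundary_pos n) (points n) F" if pl: "planar n a" "planar n b"
  proof -
    have nc: "noncrossing pos Y g"
      using g(2) noncrossing_copies[OF a pl(1) b pl(2)] unfolding pos_def by blast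
    have lt: "(pos (outer_copy x) < pos (outer_copy y)) = (boundary_pos n x < boundary_pos n y)"
      if "x \<in> points n" "y \<in> points n" for x y
      using that by (auto simp: points_def outer_copy_def pos_def)
    show ?thesis unfolding noncrossing_def
    proof (intro ballI impI)
      fix x y assume xy: "x \<in> points n" "y \<in> points n" "y \<noteq> x" "y \<noteq> F x"
      then have "outer_copy x \<in> Y" "outer_copy y \<in> Y" "outer_copy y \<noteq> outer_copy x" "outer_copy y \<noteq> g (outer_copy x)"
        using Y inj copy_F(1)[of x, symmetric] by auto
      note nc[unfolded noncrossing_def, rule_format, OF this]
      then show "((boundary_pos n x < boundary_pos n y) = (boundary_pos n (F x) < boundary_pos n y)) =
        ((boundary_pos n x < boundary_pos n (F y)) = (boundary_pos n (F x) < boundary_pos n (F y)))"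
        using lt xy copy_F by (metis (no_types, lifting))
    qed
  qed
  ultimately show ?thesis by blast
qed

lemma pm_stack:
  assumes a: "perfect_matching n a" and b: "perfect_matching n b"
  shows "perfect_matching n (stack a b)"
proof -
  obtain F where F: "fpf_involution (points n) F" "\<And>x y. {x, y} \<in> stack a b \<longleftrightarrow> x \<in> points n \<and> y = F x"
    using stack_involution[OF a b] by blast
  show ?thesis
  proof (rule pmI)
    fix B assume B: "B \<in> stack a b"
    then obtain x y where "B = {x, y}" "x \<noteq> y" unfolding stack_def by blast
    then show "\<exists>x\<in>points n. \<exists>y\<in>points n. x \<noteq> y \<and> B = {x, y}"
      using F B by (metis fpf_involution_def)
  qed (use F in auto)
qed

lemma planar_stack:
  assumes "perfect_matching n a" "perfect_matching n b" "planar n a" "planar n b"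
  shows "planar n (stack a b)"
  using stack_involution[OF assms(1,2)] planar_iff_noncrossing assms(3,4) by metis

section \<open>Associativity of stacking\<close>

text \<open>
  Placing diagrams between numbered levels, instead of the fixed lower, middle and upper level, allows
  three diagrams to be stacked in one graph.
\<close>
primrec at_levels :: "nat \<Rightarrow> nat \<Rightarrow> point \<Rightarrow> nat \<times> nat" where
  "at_levels l u (Bot i) = (l, i)"
| "at_levels l u (Top i) = (u, i)"

definition layer :: "nat \<Rightarrow> nat \<Rightarrow> diagram \<Rightarrow> ((nat \<times> nat) \<times> (nat \<times> nat)) set" where
  "layer l u a = {(at_levels l u x, at_levels l u y) | x y. {x, y} \<in> a}"

lemma stack_layers:
  assumes "l \<noteq> m" "m \<noteq> u" "l \<noteq> u"
  shows "{x, y} \<in> stack a b \<longleftrightarrow>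
    x \<noteq> y \<and> (at_levels l u x, at_levels l u y) \<in> (layer m u a \<union> layer l m b)\<^sup>*"
proof -
  let ?L = "layer m u a \<union> layer l m b"
  define up where "up z = (case z of Lower i \<Rightarrow> (l, i) | Middle i \<Rightarrow> (m, i) | Upper i \<Rightarrow> (u, i))" for z
  define down where "down = (\<lambda>(j, i). if j = l then Lower i else if j = m then Middle i else Upper i)"
  have up: "up (place_above z) = at_levels m u z" "up (place_below z) = at_levels l m z"
    "up (place_outer z) = at_levels l u z" for z
    by (cases z; simp add: up_def)+
  have down: "down (up z) = z" for z using assms by (cases z) (auto simp: up_def down_def)
  have "(place_outer x, place_outer y) \<in> (stack_edges a b)\<^sup>* \<longleftrightarrow> (up (place_outer x), up (place_outer y)) \<in> ?L\<^sup>*"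
  proof
    assume "(place_outer x, place_outer y) \<in> (stack_edges a b)\<^sup>*"
    then show "(up (place_outer x), up (place_outer y)) \<in> ?L\<^sup>*"
    proof (rule rtrancl_map)
      fix v w assume "(v, w) \<in> stack_edges a b"
      then have "(up v, up w) \<in> ?L" unfolding stack_edges_def layer_def using up by fastforce
      then show "(up v, up w) \<in> ?L\<^sup>*" by blast
    qed
  next
    assume "(up (place_outer x), up (place_outer y)) \<in> ?L\<^sup>*"
    then have "(down (up (place_outer x)), down (up (place_outer y))) \<in> (stack_edges a b)\<^sup>*"
    proof (rule rtrancl_map)
      fix v w assume "(v, w) \<in> ?L"
      then consider x y where "v = up (place_above x)" "w = up (place_above y)" "{x, y} \<in> a"
        | x y where "v = up (place_below x)" "w = up (place_below y)" "{x, y} \<in> b"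
        unfolding layer_def up by blast
      then have "(down v, down w) \<in> stack_edges a b"
        unfolding stack_edges_def by cases (auto simp: down)
      then show "(down v, down w) \<in> (stack_edges a b)\<^sup>*" by blast
    qed
    then show "(place_outer x, place_outer y) \<in> (stack_edges a b)\<^sup>*" by (simp add: down)
  qed
  then show ?thesis by (simp add: stack_iff up)
qed

lemma stack_subset_doubletons: "B \<in> stack a b \<Longrightarrow> \<exists>x y. B = {x, y}"
  unfolding stack_def by blast

lemma stack_eqI:
  assumes "\<And>x y. {x, y} \<in> stack a b \<longleftrightarrow> {x, y} \<in> stack c d"
  shows "stack a b = stack c d"
proof (rule Set.set_eqI)
  fix B
  show "B \<in> stack a b \<longleftrightarrow> B \<in> stack c d"
    using assms stack_subset_doubletons[of B] by metis
qed

text \<open>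
  A part \<open>E1\<close> of a graph that meets the rest only in \<open>D\<close> influences connectivity only through the
  relation that it induces on \<open>D\<close>.
\<close>
lemma replace_by_connectivity:
  assumes E2: "E2 \<subseteq> V \<times> V" and E1: "Field E1 \<inter> V \<subseteq> D" and DV: "D \<subseteq> V"
    and R: "R \<subseteq> E1\<^sup>*" "E1\<^sup>* \<inter> D \<times> D \<subseteq> R \<union> Id" and x: "x \<in> V" and y: "y \<in> V"
  shows "(x, y) \<in> (E1 \<union> E2)\<^sup>* \<longleftrightarrow> (x, y) \<in> (R \<union> E2)\<^sup>*"
proof
  assume "(x, y) \<in> (R \<union> E2)\<^sup>*"
  then have "(id x, id y) \<in> (E1 \<union> E2)\<^sup>*"
  proof (rule rtrancl_map)
    fix u v assume "(u, v) \<in> R \<union> E2"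
    then have "(u, v) \<in> E1\<^sup>* \<union> E2" using R(1) by blast
    then show "(id u, id v) \<in> (E1 \<union> E2)\<^sup>*" using rtrancl_mono[of E1 "E1 \<union> E2"] by auto
  qed
  then show "(x, y) \<in> (E1 \<union> E2)\<^sup>*" by simp
next
  have joined: "(x, z) \<in> (R \<union> E2)\<^sup>*" if w: "w \<in> V" "(x, w) \<in> (R \<union> E2)\<^sup>*" "(w, z) \<in> E1\<^sup>*" "z \<in> V" for w z
  proof (cases "w = z")
    case False
    then have "w \<in> Field E1" "z \<in> Field E1"
      using w(3) by (auto simp: Field_def elim: converse_rtranclE rtranclE)
    then have "(w, z) \<in> R \<union> Id" using w E1 R(2) by blast
    then have "(w, z) \<in> R \<union> E2" using False by blast
    then show ?thesis by (rule rtrancl.rtrancl_into_rtrancl[OF w(2)])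
  qed (use w in simp)
  assume "(x, y) \<in> (E1 \<union> E2)\<^sup>*"
  then have "\<exists>w\<in>V. (x, w) \<in> (R \<union> E2)\<^sup>* \<and> (w, y) \<in> E1\<^sup>*"
  proof (induction rule: rtrancl_induct)
    case base
    show ?case using x by blast
  next
    case (step z z')
    then obtain w where w: "w \<in> V" "(x, w) \<in> (R \<union> E2)\<^sup>*" "(w, z) \<in> E1\<^sup>*" by blast
    show ?case
    proof (cases "(z, z') \<in> E1")
      case True
      then show ?thesis using w by (meson rtrancl.rtrancl_into_rtrancl)
    next
      case False
      then have zz: "(z, z') \<in> E2" using step by blast
      then have "z \<in> V" "z' \<in> V" using E2 by auto
      then have "(x, z') \<in> (R \<union> E2)\<^sup>*" using joined[OF w] zz by (meson UnI2 rtrancl.rtrancl_into_rtrancl)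
      then show ?thesis using \<open>z' \<in> V\<close> by blast
    qed
  qed
  then show "(x, y) \<in> (R \<union> E2)\<^sup>*" using joined y by blast
qed

lemma layer_subset: "layer l u a \<subseteq> ({l, u} \<times> UNIV) \<times> ({l, u} \<times> UNIV)"
proof -
  have "at_levels l u x \<in> {l, u} \<times> UNIV" for x by (cases x) auto
  then show ?thesis unfolding layer_def by blast
qed

lemma layer_stack:
  fixes a b :: diagram
  assumes "l \<noteq> m" "m \<noteq> u" "l \<noteq> u"
  defines "E \<equiv> layer m u a \<union> layer l m b" and "D \<equiv> {l, u} \<times> UNIV"
  shows "layer l u (stack a b) \<subseteq> E\<^sup>*" "E\<^sup>* \<inter> D \<times> D \<subseteq> layer l u (stack a b) \<union> Id"
proof -
  show "layer l u (stack a b) \<subseteq> E\<^sup>*"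
    using stack_layers[OF assms(1-3)] unfolding layer_def[of l u] E_def by blast
  show "E\<^sup>* \<inter> D \<times> D \<subseteq> layer l u (stack a b) \<union> Id"
  proof (rule subrelI)
    fix v w assume vw: "(v, w) \<in> E\<^sup>* \<inter> D \<times> D"
    have "\<exists>x. v = at_levels l u x" if "v \<in> D" for v
    proof -
      obtain i where "v = (l, i) \<or> v = (u, i)" using \<open>v \<in> D\<close> by (auto simp: D_def)
      then have "v = at_levels l u (Bot i) \<or> v = at_levels l u (Top i)" by simp
      then show ?thesis by blast
    qed
    then obtain x y where xy: "v = at_levels l u x" "w = at_levels l u y" using vw by blast
    show "(v, w) \<in> layer l u (stack a b) \<union> Id"
    proof (cases "x = y")
      case False
      then have "{x, y} \<in> stack a b" using stack_layers[OF assms(1-3)] vw xy by (simp add: E_def)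
      then show ?thesis using xy by (auto simp: layer_def)
    qed (use xy in simp)
  qed
qed

text \<open>
  Both bracketings describe connectivity in the graph of all three diagrams, since a product may be
  replaced by the graph that it comes from.
\<close>
lemma stack_assoc: "stack (stack a b) c = stack a (stack b c)"
proof (rule stack_eqI)
  fix x y
  let ?E = "layer 2 3 a \<union> layer 1 2 b \<union> layer 0 1 c"
  let ?c = "x \<noteq> y \<and> (at_levels 0 3 x, at_levels 0 3 y) \<in> ?E\<^sup>*"
  have pts: "at_levels 0 3 z \<in> {0, 1, 3} \<times> UNIV" "at_levels 0 3 z \<in> {0, 2, 3} \<times> UNIV" for z
    by (cases z; simp)+
  have "(at_levels 0 3 x, at_levels 0 3 y) \<in> ((layer 2 3 a \<union> layer 1 2 b) \<union> layer 0 1 c)\<^sup>* \<longleftrightarrow>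
    (at_levels 0 3 x, at_levels 0 3 y) \<in> (layer 1 3 (stack a b) \<union> layer 0 1 c)\<^sup>*"
  proof (rule replace_by_connectivity[where V = "{0, 1, 3} \<times> UNIV" and D = "{1, 3} \<times> UNIV"])
    show "layer 0 1 c \<subseteq> ({0, 1, 3} \<times> UNIV) \<times> {0, 1, 3} \<times> UNIV" using layer_subset by fastforce
    show "Field (layer 2 3 a \<union> layer 1 2 b) \<inter> {0, 1, 3} \<times> UNIV \<subseteq> {1, 3} \<times> UNIV"
      using layer_subset[of 2 3 a] layer_subset[of 1 2 b] by (fastforce simp: Field_def)
  qed (use layer_stack[of 1 2 3 a b] pts in auto)
  then have 1: "{x, y} \<in> stack (stack a b) c \<longleftrightarrow> ?c"
    using stack_layers[of 0 1 3 x y "stack a b" c] by simp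
  have "(at_levels 0 3 x, at_levels 0 3 y) \<in> ((layer 1 2 b \<union> layer 0 1 c) \<union> layer 2 3 a)\<^sup>* \<longleftrightarrow>
    (at_levels 0 3 x, at_levels 0 3 y) \<in> (layer 0 2 (stack b c) \<union> layer 2 3 a)\<^sup>*"
  proof (rule replace_by_connectivity[where V = "{0, 2, 3} \<times> UNIV" and D = "{0, 2} \<times> UNIV"])
    show "layer 2 3 a \<subseteq> ({0, 2, 3} \<times> UNIV) \<times> {0, 2, 3} \<times> UNIV" using layer_subset by fastforce
    show "Field (layer 1 2 b \<union> layer 0 1 c) \<inter> {0, 2, 3} \<times> UNIV \<subseteq> {0, 2} \<times> UNIV"
      using layer_subset[of 1 2 b] layer_subset[of 0 1 c] by (fastforce simp: Field_def)
  qed (use layer_stack[of 0 1 2 b c] pts in auto)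
  then have 2: "{x, y} \<in> stack a (stack b c) \<longleftrightarrow> ?c"
    using stack_layers[of 0 2 3 x y a "stack b c"] by (simp add: Un_ac)
  show "{x, y} \<in> stack (stack a b) c \<longleftrightarrow> {x, y} \<in> stack a (stack b c)" using 1 2 by simp
qed

section \<open>Reflecting and relabelling diagrams\<close>

primrec flip_point :: "point \<Rightarrow> point" where
  "flip_point (Bot i) = Top i"
| "flip_point (Top i) = Bot i"

primrec relabel_point :: "(nat \<Rightarrow> nat) \<Rightarrow> point \<Rightarrow> point" where
  "relabel_point g (Bot i) = Bot (g i)"
| "relabel_point g (Top i) = Top (g i)"

definition flip :: "diagram \<Rightarrow> diagram" where "flip a = image flip_point ` a"

definition relabel :: "(nat \<Rightarrow> nat) \<Rightarrow> diagram \<Rightarrow> diagram" where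
  "relabel g a = image (relabel_point g) ` a"

lemma flip_flip_point [simp]: "flip_point (flip_point x) = x" by (cases x) auto

lemma flip_flip [simp]: "flip (flip a) = a"
  by (simp add: flip_def image_image)

lemma flip_iff: "{x, y} \<in> flip a \<longleftrightarrow> {flip_point x, flip_point y} \<in> a"
proof -
  have 1: "{flip_point x, flip_point y} \<in> flip a" if "{x, y} \<in> a" for x y a
    using imageI[OF that, of "image flip_point"] by (simp add: flip_def)
  then show ?thesis using 1[of x y "flip a"] 1[of "flip_point x" "flip_point y" a] by auto
qed

lemma flip_points: "flip_point x \<in> points n \<longleftrightarrow> x \<in> points n"
  by (cases x) (auto simp: points_def)

lemma pm_image:
  assumes a: "perfect_matching n a"
    and inv: "\<And>x. r' (r x) = x" "\<And>x. r (r' x) = x" and pts: "\<And>x. r x \<in> points n \<longleftrightarrow> x \<in> points n"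
  shows "perfect_matching n (image r ` a)"
proof -
  have iff: "{x, y} \<in> image r ` a \<longleftrightarrow> {r' x, r' y} \<in> a" for x y
  proof
    assume "{x, y} \<in> image r ` a"
    then obtain C where "C \<in> a" "{x, y} = r ` C" by blast
    then have "r' ` {x, y} = C" by (simp add: image_image inv)
    then show "{r' x, r' y} \<in> a" using \<open>C \<in> a\<close> by simp
  next
    assume "{r' x, r' y} \<in> a"
    then show "{x, y} \<in> image r ` a" using imageI[of "{r' x, r' y}" a "image r"] by (simp add: inv)
  qed
  show ?thesis
  proof (rule pmI)
    fix B assume "B \<in> image r ` a"
    then obtain C where C: "C \<in> a" "B = r ` C" by blast
    obtain x y where xy: "C = {x, y}" "x \<in> points n" "y \<in> points n" "x \<noteq> y" using pm_blockE[OF a C(1)] .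
    have "r x \<noteq> r y" using xy(4) inv(1) by metis
    then show "\<exists>x\<in>points n. \<exists>y\<in>points n. x \<noteq> y \<and> B = {x, y}"
      using C xy pts by (intro bexI[of _ "r x"] bexI[of _ "r y"]) auto
  next
    fix x assume "x \<in> points n"
    then obtain y where "{r' x, y} \<in> a" using pm_partner[OF a, of "r' x"] pts[of "r' x"] by (auto simp: inv)
    then show "\<exists>y. {x, y} \<in> image r ` a" by (intro exI[of _ "r y"]) (simp add: iff inv)
  next
    fix x y z assume "{x, y} \<in> image r ` a" "{x, z} \<in> image r ` a"
    then show "y = z" using pm_unique[OF a] inv(2) unfolding iff by metis
  qed
qed

lemma pm_flip: "perfect_matching n a \<Longrightarrow> perfect_matching n (flip a)"
  unfolding flip_def by (rule pm_image[where r' = flip_point]) (simp_all add: flip_points)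

lemma planar_flip:
  assumes a: "perfect_matching n a" and pl: "planar n a"
  shows "planar n (flip a)"
  unfolding planar_def
proof (rule notI, elim exE conjE)
  have pos: "boundary_pos n (flip_point x) = 2 * n - 1 - boundary_pos n x" if "x \<in> points n" for x
    using that by (auto simp: points_def)
  have lt: "boundary_pos n x < 2 * n" if "x \<in> points n" for x using that by (auto simp: points_def)
  fix x y z w assume *: "{x, y} \<in> flip a" "{z, w} \<in> flip a"
    "boundary_pos n x < boundary_pos n z" "boundary_pos n z < boundary_pos n y" "boundary_pos n y < boundary_pos n w"
  have pts: "x \<in> points n" "y \<in> points n" "z \<in> points n" "w \<in> points n"
    using pm_block[OF pm_flip[OF a]] *(1,2) by auto
  have "{flip_point w, flip_point z} \<in> a" "{flip_point y, flip_point x} \<in> a"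
    using *(1,2) by (auto simp: flip_iff insert_commute)
  moreover have "boundary_pos n (flip_point w) < boundary_pos n (flip_point y)"
    "boundary_pos n (flip_point y) < boundary_pos n (flip_point z)"
    "boundary_pos n (flip_point z) < boundary_pos n (flip_point x)"
    using *(3-5) pts pos lt[OF pts(1)] lt[OF pts(2)] lt[OF pts(3)] lt[OF pts(4)] by auto
  ultimately show False using pl unfolding planar_def by blast
qed

text \<open>
  Reflecting a diagram is the same as exchanging the levels of its bottom and top points; this makes
  the compatibility with products immediate.
\<close>
lemma layer_flip: "layer l u (flip a) = layer u l a"
proof -
  have at: "at_levels l u (flip_point x) = at_levels u l x" for l u x by (cases x) auto
  have *: "layer u l a \<subseteq> layer l u (flip a)" for l u a
  proof (rule subrelI)
    fix v w assume "(v, w) \<in> layer u l a"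
    then obtain x y where "{x, y} \<in> a" "v = at_levels u l x" "w = at_levels u l y" by (auto simp: layer_def)
    then have "{flip_point x, flip_point y} \<in> flip a" "v = at_levels l u (flip_point x)" "w = at_levels l u (flip_point y)"
      by (simp_all add: flip_iff at)
    then show "(v, w) \<in> layer l u (flip a)" unfolding layer_def by blast
  qed
  show ?thesis using *[of u l a] *[of l u "flip a"] by auto
qed

lemma flip_stack: "flip (stack a b) = stack (flip b) (flip a)"
proof -
  have at: "at_levels l u (flip_point x) = at_levels u l x" for l u x by (cases x) auto
  have e: "{x, y} \<in> flip (stack a b) \<longleftrightarrow> {x, y} \<in> stack (flip b) (flip a)" for x y
  proof -
    have ne: "flip_point x \<noteq> flip_point y \<longleftrightarrow> x \<noteq> y" by (metis flip_flip_point)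
    show ?thesis
      using stack_layers[of 2 1 0 "flip_point x" "flip_point y" a b] stack_layers[of 0 1 2 x y "flip b" "flip a"]
      by (simp add: flip_iff layer_flip at ne Un_commute)
  qed
  moreover have "\<exists>x y. B = {x, y}" if B: "B \<in> flip (stack a b)" for B
  proof -
    obtain C where C: "C \<in> stack a b" "B = flip_point ` C" using B by (auto simp: flip_def)
    then obtain x y where "C = {x, y}" using stack_subset_doubletons by blast
    then show ?thesis using C by auto
  qed
  ultimately show ?thesis using stack_subset_doubletons[of _ "flip b" "flip a"] by blast
qed

lemma relabel_comp: "relabel g (relabel h a) = relabel (g \<circ> h) a"
proof -
  have "relabel_point g (relabel_point h x) = relabel_point (g \<circ> h) x" for x by (cases x) auto
  then show ?thesis by (simp add: relabel_def image_image)
qed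

lemma relabel_id [simp]: "relabel id a = a"
proof -
  have "relabel_point id x = x" for x by (cases x) auto
  then have "relabel_point id = (\<lambda>x. x)" by auto
  then show ?thesis by (simp add: relabel_def)
qed

lemma relabel_mem: "{x, y} \<in> a \<Longrightarrow> {relabel_point g x, relabel_point g y} \<in> relabel g a"
  using imageI[of "{x, y}" a "image (relabel_point g)"] by (simp add: relabel_def)

lemma relabel_iff:
  assumes "bij g"
  shows "{x, y} \<in> relabel g a \<longleftrightarrow> {relabel_point (Hilbert_Choice.inv g) x, relabel_point (Hilbert_Choice.inv g) y} \<in> a"
proof
  have inv: "Hilbert_Choice.inv g \<circ> g = id" "g \<circ> Hilbert_Choice.inv g = id" using assms by (auto simp: bij_def surj_iff inj_iff)
  have rp: "relabel_point h (relabel_point k z) = relabel_point (h \<circ> k) z" for h k z by (cases z) auto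
  have rid: "relabel_point id z = z" for z by (cases z) auto
  show "{relabel_point (Hilbert_Choice.inv g) x, relabel_point (Hilbert_Choice.inv g) y} \<in> a" if "{x, y} \<in> relabel g a"
    using relabel_mem[OF that, of "Hilbert_Choice.inv g"] by (simp add: relabel_comp inv)
  show "{x, y} \<in> relabel g a" if "{relabel_point (Hilbert_Choice.inv g) x, relabel_point (Hilbert_Choice.inv g) y} \<in> a"
    using relabel_mem[OF that, of g] by (simp add: rp inv rid)
qed

lemma stack_relabel:
  assumes "bij g"
  shows "stack (relabel g a) (relabel g b) = relabel g (stack a b)"
proof -
  have sub: "relabel g (stack a b) \<subseteq> stack (relabel g a) (relabel g b)" if g: "inj g" for g a b
  proof
    fix B assume "B \<in> relabel g (stack a b)"
    then obtain C where C: "C \<in> stack a b" "B = relabel_point g ` C" by (auto simp: relabel_def)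
    then obtain x y where xy: "C = {x, y}" using stack_subset_doubletons by blast
    let ?m = "\<lambda>(l, i). (l :: nat, g i)"
    have at: "?m (at_levels l u z) = at_levels l u (relabel_point g z)" for l u z by (cases z) auto
    have "x \<noteq> y" and conn: "(at_levels 0 2 x, at_levels 0 2 y) \<in> (layer 1 2 a \<union> layer 0 1 b)\<^sup>*"
      using C xy stack_layers[of 0 1 2 x y a b] by auto
    have "(?m (at_levels 0 2 x), ?m (at_levels 0 2 y)) \<in> (layer 1 2 (relabel g a) \<union> layer 0 1 (relabel g b))\<^sup>*"
    proof (rule rtrancl_map[OF conn])
      fix v w assume vw: "(v, w) \<in> layer 1 2 a \<union> layer 0 1 b"
      have "(?m v, ?m w) \<in> layer l u (relabel g c)" if "(v, w) \<in> layer l u c" for l u c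
        using that relabel_mem[of _ _ c g] unfolding layer_def at[symmetric] using at by fastforce
      then show "(?m v, ?m w) \<in> (layer 1 2 (relabel g a) \<union> layer 0 1 (relabel g b))\<^sup>*" using vw by blast
    qed
    moreover have "relabel_point g x \<noteq> relabel_point g y"
      using \<open>x \<noteq> y\<close> g by (cases x; cases y) (auto dest: injD)
    ultimately have "{relabel_point g x, relabel_point g y} \<in> stack (relabel g a) (relabel g b)"
      using stack_layers[of 0 1 2 "relabel_point g x" "relabel_point g y" "relabel g a" "relabel g b"] unfolding at by simp
    then show "B \<in> stack (relabel g a) (relabel g b)" using C xy by simp
  qed
  have inv: "Hilbert_Choice.inv g \<circ> g = id" "g \<circ> Hilbert_Choice.inv g = id" using assms by (auto simp: bij_def surj_iff inj_iff)
  have "relabel (Hilbert_Choice.inv g) (stack (relabel g a) (relabel g b)) \<subseteq> stack a b"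
    using sub[of "Hilbert_Choice.inv g" "relabel g a" "relabel g b"] assms
    by (simp add: relabel_comp inv bij_imp_bij_inv bij_is_inj)
  then have "relabel g (relabel (Hilbert_Choice.inv g) (stack (relabel g a) (relabel g b))) \<subseteq> relabel g (stack a b)"
    unfolding relabel_def by blast
  then show ?thesis using sub[of g a b] assms by (auto simp: relabel_comp inv bij_is_inj)
qed

lemma permutes_points:
  assumes "g permutes {..<n}"
  shows "relabel_point g x \<in> points n \<longleftrightarrow> x \<in> points n"
  using permutes_in_image[OF assms] by (cases x) (auto simp: points_def image_iff)

lemma pm_relabel:
  assumes a: "perfect_matching n a" and g: "g permutes {..<n}"
  shows "perfect_matching n (relabel g a)"
  unfolding relabel_def
proof (rule pm_image[OF a])
  show "relabel_point (Hilbert_Choice.inv g) (relabel_point g x) = x"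
    "relabel_point g (relabel_point (Hilbert_Choice.inv g) x) = x" for x
    using permutes_inverses[OF g] by (cases x; simp)+
qed (rule permutes_points[OF g])

section \<open>Arcs and through strands\<close>

definition top_arcs :: "diagram \<Rightarrow> nat set set" where
  "top_arcs a = {{i, j} | i j. {Top i, Top j} \<in> a}"

definition bot_arcs :: "diagram \<Rightarrow> nat set set" where
  "bot_arcs a = {{i, j} | i j. {Bot i, Bot j} \<in> a}"

definition partial_matching :: "nat \<Rightarrow> nat set set \<Rightarrow> bool" where
  "partial_matching n u \<longleftrightarrow> (\<forall>B\<in>u. B \<subseteq> {..<n} \<and> card B = 2) \<and> disjoint u"

text \<open>
  The points left uncovered by the arcs; on each side of a diagram these are the ends of the through
  strands.
\<close>
definition free :: "nat \<Rightarrow> nat set set \<Rightarrow> nat set" where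
  "free n u = {..<n} - \<Union>u"

lemma top_arcs_iff: "{i, j} \<in> top_arcs a \<longleftrightarrow> {Top i, Top j} \<in> a"
  unfolding top_arcs_def by (auto simp: doubleton_eq_iff insert_commute)

lemma bot_arcs_iff: "{i, j} \<in> bot_arcs a \<longleftrightarrow> {Bot i, Bot j} \<in> a"
  unfolding bot_arcs_def by (auto simp: doubleton_eq_iff insert_commute)

lemma top_arcs_flip: "top_arcs (flip a) = bot_arcs a"
  by (simp add: top_arcs_def bot_arcs_def flip_iff)

lemma top_arcs_stack:
  assumes "perfect_matching n a"
  shows "top_arcs a \<subseteq> top_arcs (stack a b)"
proof
  fix B assume "B \<in> top_arcs a"
  then obtain i j where ij: "B = {i, j}" "{Top i, Top j} \<in> a" by (auto simp: top_arcs_def)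
  then have "(place_above (Top i), place_above (Top j)) \<in> stack_edges a b"
    unfolding stack_edges_def by blast
  then have "{Top i, Top j} \<in> stack a b"
    using pm_block(3)[OF assms ij(2)] by (auto simp: stack_iff)
  then show "B \<in> top_arcs (stack a b)" using ij by (simp add: top_arcs_iff)
qed

lemma bot_arcs_stack:
  assumes "perfect_matching n b"
  shows "bot_arcs b \<subseteq> bot_arcs (stack a b)"
  using top_arcs_stack[OF pm_flip[OF assms], of "flip a"]
  by (simp add: top_arcs_flip flip_stack[symmetric])

lemma partial_matching_top_arcs:
  assumes "perfect_matching n a"
  shows "partial_matching n (top_arcs a)"
  unfolding partial_matching_def
proof (intro conjI ballI disjointI)
  fix B assume "B \<in> top_arcs a"
  then obtain i j where ij: "B = {i, j}" "{Top i, Top j} \<in> a" by (auto simp: top_arcs_def)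
  then show "B \<subseteq> {..<n}" "card B = 2" using pm_block[OF assms ij(2)] by (auto simp: points_def)
next
  fix B C assume B: "B \<in> top_arcs a" and C: "C \<in> top_arcs a" and "B \<noteq> C"
  show "B \<inter> C = {}"
  proof (rule ccontr)
    assume "B \<inter> C \<noteq> {}"
    then obtain i where i: "i \<in> B" "i \<in> C" by blast
    have "\<exists>j. D = {i, j} \<and> {Top i, Top j} \<in> a" if "D \<in> top_arcs a" "i \<in> D" for D
      using that by (auto simp: top_arcs_def insert_commute)
    then obtain j l where "B = {i, j}" "{Top i, Top j} \<in> a" "C = {i, l}" "{Top i, Top l} \<in> a"
      using i B C by metis
    then show False using pm_unique[OF assms] \<open>B \<noteq> C\<close> by blast
  qed
qed

lemma partial_matching_bot_arcs:
  "perfect_matching n a \<Longrightarrow> partial_matching n (bot_arcs a)"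
  using partial_matching_top_arcs[OF pm_flip] by (simp add: top_arcs_flip)

lemma partial_matching_finite: "partial_matching n u \<Longrightarrow> finite u"
  by (rule finite_subset[of _ "Pow {..<n}"]) (auto simp: partial_matching_def)

lemma partial_matching_arc:
  assumes "partial_matching n u" "B \<in> u"
  obtains i j where "B = {i, j}" "i \<noteq> j" "i < n" "j < n"
proof -
  have "card B = 2" "B \<subseteq> {..<n}" using assms by (auto simp: partial_matching_def)
  then show ?thesis using that by (auto simp: card_2_iff)
qed

lemma card_free:
  assumes u: "partial_matching n u"
  shows "2 * card u + card (free n u) = n"
proof -
  have "card (\<Union>u) = sum card u"
    using u by (intro card_Union_disjoint) (auto simp: partial_matching_def intro: finite_subset)
  also have "\<dots> = 2 * card u" using u by (simp add: partial_matching_def)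
  finally have "card (\<Union>u) = 2 * card u" .
  moreover have "\<Union>u \<subseteq> {..<n}" using u by (auto simp: partial_matching_def)
  ultimately show ?thesis
    using card_Diff_subset[of "\<Union>u" "{..<n}"] card_mono[of "{..<n}" "\<Union>u"]
    by (simp add: free_def finite_subset)
qed

lemma free_top_partner:
  assumes a: "perfect_matching n a"
  shows "i \<in> free n (top_arcs a) \<longleftrightarrow> (\<exists>l. {Bot l, Top i} \<in> a)"
proof
  assume i: "i \<in> free n (top_arcs a)"
  then have "Top i \<in> points n" by (auto simp: free_def points_def)
  then obtain y where y: "{Top i, y} \<in> a" using pm_partner[OF a] by blast
  show "\<exists>l. {Bot l, Top i} \<in> a"
  proof (cases y)
    case (Bot l)
    then show ?thesis using y by (auto simp: insert_commute)
  next
    case (Top l)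
    then have "{i, l} \<in> top_arcs a" using y by (simp add: top_arcs_iff)
    then show ?thesis using i by (auto simp: free_def)
  qed
next
  assume "\<exists>l. {Bot l, Top i} \<in> a"
  then obtain l where l: "{Top i, Bot l} \<in> a" by (auto simp: insert_commute)
  have "B \<notin> top_arcs a" if iB: "i \<in> B" for B
  proof
    assume "B \<in> top_arcs a"
    then obtain j where "{Top i, Top j} \<in> a" using iB by (auto simp: top_arcs_def insert_commute)
    then show False using pm_unique[OF a l] by blast
  qed
  then show "i \<in> free n (top_arcs a)" using pm_block(1)[OF a l] by (auto simp: free_def points_def)
qed

lemma free_bot_partner:
  assumes a: "perfect_matching n a"
  shows "i \<in> free n (bot_arcs a) \<longleftrightarrow> (\<exists>l. {Bot i, Top l} \<in> a)"
  using free_top_partner[OF pm_flip[OF a], of i]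
  by (simp add: top_arcs_flip flip_iff insert_commute)

lemma through_strands_free:
  assumes a: "perfect_matching n a"
  shows "through_strands a = card (free n (top_arcs a))"
proof -
  \<comment> \<open>Through strands are enumerated by their top ends.\<close>
  let ?f = "\<lambda>j. {partner a (Top j), Top j}"
  have p: "partner a (Top j) = Bot i" if "{Bot i, Top j} \<in> a" for i j
    using partner_iff[OF a, of "Top j" "Bot i"] that by (simp add: insert_commute)
  have "{B \<in> a. \<exists>i j. B = {Bot i, Top j}} = ?f ` free n (top_arcs a)"
  proof (intro equalityI subsetI)
    fix B assume "B \<in> {B \<in> a. \<exists>i j. B = {Bot i, Top j}}"
    then obtain i j where ij: "{Bot i, Top j} \<in> a" "B = {Bot i, Top j}" by blast
    then have "j \<in> free n (top_arcs a)" using free_top_partner[OF a] by blast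
    then show "B \<in> ?f ` free n (top_arcs a)" using ij p[OF ij(1)] by (intro image_eqI[of _ _ j]) auto
  next
    fix B assume "B \<in> ?f ` free n (top_arcs a)"
    then obtain j where j: "j \<in> free n (top_arcs a)" "B = ?f j" by blast
    then obtain i where "{Bot i, Top j} \<in> a" using free_top_partner[OF a] by blast
    then show "B \<in> {B \<in> a. \<exists>i j. B = {Bot i, Top j}}" using p j by auto
  qed
  moreover have "inj_on ?f (free n (top_arcs a))"
  proof (rule inj_onI)
    fix j j' assume j: "j \<in> free n (top_arcs a)" "j' \<in> free n (top_arcs a)" "?f j = ?f j'"
    obtain i i' where "{Bot i, Top j} \<in> a" "{Bot i', Top j'} \<in> a"
      using j(1,2) unfolding free_top_partner[OF a] by blast
    then show "j = j'" using j(3) p by (auto simp: doubleton_eq_iff)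
  qed
  ultimately show ?thesis unfolding through_strands_def by (simp add: card_image)
qed

lemma through_strands_flip: "through_strands (flip a) = through_strands a"
proof -
  have inj: "inj (image flip_point)"
    by (rule inj_on_inverseI[where g = "image flip_point"]) (simp add: image_image)
  have "{B \<in> flip a. \<exists>i j. B = {Bot i, Top j}} = image flip_point ` {B \<in> a. \<exists>i j. B = {Bot i, Top j}}"
  proof (intro equalityI subsetI)
    fix B assume "B \<in> {B \<in> flip a. \<exists>i j. B = {Bot i, Top j}}"
    then obtain i j where B: "B = {Bot i, Top j}" "{Bot i, Top j} \<in> flip a" by blast
    then have "{Bot j, Top i} \<in> a" by (simp add: flip_iff insert_commute)
    moreover have "B = flip_point ` {Bot j, Top i}" using B by (simp add: insert_commute)
    ultimately show "B \<in> image flip_point ` {B \<in> a. \<exists>i j. B = {Bot i, Top j}}" by blast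
  next
    fix B assume "B \<in> image flip_point ` {B \<in> a. \<exists>i j. B = {Bot i, Top j}}"
    then obtain i j where B: "{Bot i, Top j} \<in> a" "B = {Bot j, Top i}" by (auto simp: insert_commute)
    then show "B \<in> {B \<in> flip a. \<exists>i j. B = {Bot i, Top j}}" by (auto simp: flip_iff insert_commute)
  qed
  then show ?thesis unfolding through_strands_def
    by (simp add: card_image inj_on_subset[OF inj])
qed

lemma through_strands_free_bot:
  "perfect_matching n a \<Longrightarrow> through_strands a = card (free n (bot_arcs a))"
  using through_strands_free[OF pm_flip, of n a] by (simp add: through_strands_flip top_arcs_flip)

lemma through_strands_top_arcs:
  "perfect_matching n a \<Longrightarrow> 2 * card (top_arcs a) + through_strands a = n"
  using card_free[OF partial_matching_top_arcs] by (simp add: through_strands_free)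

lemma through_strands_bot_arcs:
  "perfect_matching n a \<Longrightarrow> 2 * card (bot_arcs a) + through_strands a = n"
  using card_free[OF partial_matching_bot_arcs] by (simp add: through_strands_free_bot)

text \<open>
  Arcs and through strands compete for the \<open>n\<close> points of one side, so the rank determines the number of
  top arcs.
\<close>
lemma through_strands_antimono:
  assumes a: "perfect_matching n a" and b: "perfect_matching n b" and sub: "top_arcs a \<subseteq> top_arcs b"
  shows "through_strands b \<le> through_strands a"
    and "through_strands b = through_strands a \<Longrightarrow> top_arcs a = top_arcs b"
proof -
  have f: "finite (top_arcs b)" using partial_matching_finite[OF partial_matching_top_arcs[OF b]] .
  show "through_strands b \<le> through_strands a"
    using through_strands_top_arcs[OF a] through_strands_top_arcs[OF b] card_mono[OF f sub] by simp
  show "top_arcs a = top_arcs b" if "through_strands b = through_strands a"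
    using through_strands_top_arcs[OF a] through_strands_top_arcs[OF b] that card_subset_eq[OF f sub] by simp
qed

lemma bot_arcs_eqI:
  assumes a: "perfect_matching n a" and b: "perfect_matching n b" and sub: "bot_arcs a \<subseteq> bot_arcs b"
    and "through_strands b = through_strands a"
  shows "bot_arcs a = bot_arcs b"
  using through_strands_antimono(2)[OF pm_flip[OF a] pm_flip[OF b]] assms
  by (simp add: through_strands_flip top_arcs_flip)

lemma through_strands_stack:
  assumes a: "perfect_matching n a" and b: "perfect_matching n b"
  shows "through_strands (stack a b) \<le> through_strands a" "through_strands (stack a b) \<le> through_strands b"
proof -
  show "through_strands (stack a b) \<le> through_strands a"
    by (rule through_strands_antimono(1)[OF a pm_stack[OF a b] top_arcs_stack[OF a]])
  have "through_strands (stack (flip b) (flip a)) \<le> through_strands (flip b)"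
    by (rule through_strands_antimono(1)[OF pm_flip[OF b] pm_stack[OF pm_flip[OF b] pm_flip[OF a]] top_arcs_stack[OF pm_flip[OF b]]])
  then show "through_strands (stack a b) \<le> through_strands b"
    by (simp add: flip_stack[symmetric] through_strands_flip)
qed

text \<open>
  It suffices to find every block of \<open>b\<close> in the product. Bottom arcs of \<open>b\<close> and top arcs of \<open>a\<close> survive
  by themselves. Any other end of a block of \<open>b\<close> at the top sits at the end of a through strand of \<open>a\<close>,
  and the path goes down that strand, up again along its mirror image, through the block of \<open>b\<close>, and
  back in the same way.
\<close>
lemma stack_stack_flip:
  assumes a: "perfect_matching n a" and b: "perfect_matching n b" and sub: "top_arcs a \<subseteq> top_arcs b"
  shows "stack a (stack (flip a) b) = b"
proof -
  let ?c = "stack (flip a) b"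
  have fa: "perfect_matching n (flip a)" and c: "perfect_matching n ?c"
    using pm_flip[OF a] pm_stack[OF _ b] by auto
  have above: "(place_above x, place_above y) \<in> (stack_edges c d)\<^sup>*" if "{x, y} \<in> c" for x y c d
    using that unfolding stack_edges_def by blast
  have below: "(place_below x, place_below y) \<in> (stack_edges c d)\<^sup>*" if "{x, y} \<in> d" for x y c d
    using that unfolding stack_edges_def by blast
  have thr: "\<exists>l. {Top i, Bot l} \<in> a \<and> {Bot i, Top l} \<in> flip a" if "i \<in> free n (top_arcs a)" for i
    using free_top_partner[OF a] that by (auto simp: flip_iff insert_commute)
  have "b \<subseteq> stack a ?c"
  proof
    fix B assume B: "B \<in> b"
    obtain x y where xy: "B = {x, y}" "x \<noteq> y" using pm_blockE[OF b B] by metis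
    have through: "{Bot i, Top j} \<in> stack a ?c" if ij: "{Bot i, Top j} \<in> b" for i j
    proof -
      have "j \<in> free n (top_arcs b)" using free_top_partner[OF b] ij by blast
      then have "j \<in> free n (top_arcs a)" using sub by (auto simp: free_def)
      then obtain l where l: "{Top j, Bot l} \<in> a" "{Bot j, Top l} \<in> flip a" using thr by blast
      have "(Lower i, Middle j) \<in> (stack_edges (flip a) b)\<^sup>*" "(Middle j, Upper l) \<in> (stack_edges (flip a) b)\<^sup>*"
        using above[of "Bot j" "Top l" "flip a" b] below[of "Bot i" "Top j" b "flip a"] l(2) ij
        by simp_all
      then have "(place_outer (Bot i), place_outer (Top l)) \<in> (stack_edges (flip a) b)\<^sup>*"
        using rtrancl_trans by fastforce
      then have "{Bot i, Top l} \<in> ?c" by (simp add: stack_iff)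
      then have "(Lower i, Middle l) \<in> (stack_edges a ?c)\<^sup>*" "(Middle l, Upper j) \<in> (stack_edges a ?c)\<^sup>*"
        using below[of "Bot i" "Top l" ?c a] above[of "Bot l" "Top j" a ?c] l(1)
        by (simp_all add: insert_commute)
      then have "(place_outer (Bot i), place_outer (Top j)) \<in> (stack_edges a ?c)\<^sup>*"
        using rtrancl_trans by fastforce
      then show ?thesis by (simp add: stack_iff)
    qed
    show "B \<in> stack a ?c"
    proof (cases x; cases y)
      fix i j assume "x = Bot i" "y = Bot j"
      then have "{i, j} \<in> bot_arcs b" using B xy by (simp add: bot_arcs_iff)
      then have "{i, j} \<in> bot_arcs (stack a ?c)" using bot_arcs_stack[OF b] bot_arcs_stack[OF c] by blast
      then show ?thesis using \<open>x = Bot i\<close> \<open>y = Bot j\<close> xy by (simp add: bot_arcs_iff)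
    next
      fix i j assume *: "x = Top i" "y = Top j"
      then have ij: "{Top i, Top j} \<in> b" using B xy by simp
      show ?thesis
      proof (cases "{i, j} \<in> top_arcs a")
        case True
        then have "{i, j} \<in> top_arcs (stack a ?c)" using top_arcs_stack[OF a] by blast
        then show ?thesis using * xy by (simp add: top_arcs_iff)
      next
        case False
        have fr: "l \<in> free n (top_arcs a)" if l: "l \<in> {i, j}" for l
        proof -
          have "C \<notin> top_arcs a" if "l \<in> C" for C
          proof
            assume C: "C \<in> top_arcs a"
            then have "C \<in> top_arcs b" "{i, j} \<in> top_arcs b" using sub ij by (auto simp: top_arcs_iff)
            then have "C = {i, j}"
              using partial_matching_top_arcs[OF b] that l disjointD[of "top_arcs b" C "{i, j}"]
              unfolding partial_matching_def by blast
            then show False using False C by simp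
          qed
          moreover have "l < n" using l pm_block[OF b ij] by (auto simp: points_def)
          ultimately show ?thesis by (auto simp: free_def)
        qed
        obtain l where l: "{Top i, Bot l} \<in> a" "{Bot i, Top l} \<in> flip a" using thr fr by blast
        obtain m where m: "{Top j, Bot m} \<in> a" "{Bot j, Top m} \<in> flip a" using thr fr by blast
        have lm: "l \<noteq> m"
          using pm_unique[OF a, of "Bot l" "Top i" "Top j"] l(1) m(1) xy(2) * by (auto simp: insert_commute)
        have 1: "(Upper l, Middle i) \<in> (stack_edges (flip a) b)\<^sup>*" "(Middle i, Middle j) \<in> (stack_edges (flip a) b)\<^sup>*"
          "(Middle j, Upper m) \<in> (stack_edges (flip a) b)\<^sup>*"
          using above[of "Top l" "Bot i" "flip a" b] below[of "Top i" "Top j" b "flip a"]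
            above[of "Bot j" "Top m" "flip a" b] l m ij by (simp_all add: insert_commute)
        then have "(Upper l, Upper m) \<in> (stack_edges (flip a) b)\<^sup>*" by (meson rtrancl_trans)
        then have "{Top l, Top m} \<in> ?c" using lm by (simp add: stack_iff)
        then have "(Upper i, Middle l) \<in> (stack_edges a ?c)\<^sup>*" "(Middle l, Middle m) \<in> (stack_edges a ?c)\<^sup>*"
          "(Middle m, Upper j) \<in> (stack_edges a ?c)\<^sup>*"
          using above[of "Top i" "Bot l" a ?c] below[of "Top l" "Top m" ?c a]
            above[of "Bot m" "Top j" a ?c] l m by (simp_all add: insert_commute)
        then have "(Upper i, Upper j) \<in> (stack_edges a ?c)\<^sup>*" by (meson rtrancl_trans)
        then show ?thesis using * xy by (simp add: stack_iff)
      qed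
    next
      fix i j assume "x = Bot i" "y = Top j"
      then show ?thesis using through B xy by simp
    next
      fix i j assume "x = Top i" "y = Bot j"
      then show ?thesis using through B xy by (simp add: insert_commute)
    qed
  qed
  then show ?thesis using pm_eqI[OF b pm_stack[OF a c]] by simp
qed

lemma stack_flip_stack:
  assumes a: "perfect_matching n a" and b: "perfect_matching n b" and sub: "bot_arcs a \<subseteq> bot_arcs b"
  shows "stack (stack b (flip a)) a = b"
proof -
  have "stack (flip a) (stack (flip (flip a)) (flip b)) = flip b"
    using assms by (intro stack_stack_flip pm_flip) (simp_all add: top_arcs_flip)
  then have "flip (stack (flip a) (stack a (flip b))) = b" by (simp only: flip_flip)
  then show ?thesis by (simp add: flip_stack)
qed

section \<open>Diagrams with prescribed arcs\<close>

text \<open>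
  The diagram with top arcs \<open>u\<close>, bottom arcs \<open>v\<close>, and through strands from each top point \<open>i\<close> to the
  bottom point \<open>\<beta> i\<close>.
\<close>
definition join :: "nat \<Rightarrow> nat set set \<Rightarrow> nat set set \<Rightarrow> (nat \<Rightarrow> nat) \<Rightarrow> diagram" where
  "join n u v \<beta> = image Top ` u \<union> image Bot ` v \<union> (\<lambda>i. {Bot (\<beta> i), Top i}) ` free n u"

abbreviation projection :: "nat \<Rightarrow> nat set set \<Rightarrow> diagram" where
  "projection n u \<equiv> join n u u id"

lemma join_mem:
  "{Top i, Top j} \<in> join n u v \<beta> \<longleftrightarrow> {i, j} \<in> u"
  "{Bot i, Bot j} \<in> join n u v \<beta> \<longleftrightarrow> {i, j} \<in> v"
  "{Bot i, Top j} \<in> join n u v \<beta> \<longleftrightarrow> j \<in> free n u \<and> i = \<beta> j"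
  "{Top j, Bot i} \<in> join n u v \<beta> \<longleftrightarrow> j \<in> free n u \<and> i = \<beta> j"
proof -
  have inj: "inj (image Top)" "inj (image Bot)" by (auto simp: inj_image_eq_iff inj_def)
  have B: "Bot l \<notin> Top ` C" "Top l \<notin> Bot ` C" for l C by auto
  show "{Top i, Top j} \<in> join n u v \<beta> \<longleftrightarrow> {i, j} \<in> u"
  proof -
    have "{Top i, Top j} \<notin> image Bot ` v" using B by (metis imageE insertI1)
    moreover have "{Top i, Top j} \<notin> (\<lambda>i. {Bot (\<beta> i), Top i}) ` free n u" by (auto simp: doubleton_eq_iff)
    moreover have "{Top i, Top j} \<in> image Top ` u \<longleftrightarrow> {i, j} \<in> u"
      using inj_image_mem_iff[OF inj(1), of "{i, j}" u] by simp
    ultimately show ?thesis unfolding join_def by blast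
  qed
  show "{Bot i, Bot j} \<in> join n u v \<beta> \<longleftrightarrow> {i, j} \<in> v"
  proof -
    have "{Bot i, Bot j} \<notin> image Top ` u" using B by (metis imageE insertI1)
    moreover have "{Bot i, Bot j} \<notin> (\<lambda>i. {Bot (\<beta> i), Top i}) ` free n u" by (auto simp: doubleton_eq_iff)
    moreover have "{Bot i, Bot j} \<in> image Bot ` v \<longleftrightarrow> {i, j} \<in> v"
      using inj_image_mem_iff[OF inj(2), of "{i, j}" v] by simp
    ultimately show ?thesis unfolding join_def by blast
  qed
  have BT: "{Bot i, Top j} \<in> join n u v \<beta> \<longleftrightarrow> j \<in> free n u \<and> i = \<beta> j"
  proof -
    have "{Bot i, Top j} \<notin> image Top ` u" "{Bot i, Top j} \<notin> image Bot ` v"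
      using B by (metis imageE insertI1 insert_commute)+
    moreover have "{Bot i, Top j} \<in> (\<lambda>i. {Bot (\<beta> i), Top i}) ` free n u \<longleftrightarrow> j \<in> free n u \<and> i = \<beta> j"
      by (auto simp: doubleton_eq_iff)
    ultimately show ?thesis unfolding join_def by blast
  qed
  then show "{Bot i, Top j} \<in> join n u v \<beta> \<longleftrightarrow> j \<in> free n u \<and> i = \<beta> j" .
  show "{Top j, Bot i} \<in> join n u v \<beta> \<longleftrightarrow> j \<in> free n u \<and> i = \<beta> j"
    using BT by (simp add: insert_commute)
qed

lemma pm_join:
  assumes u: "partial_matching n u" and v: "partial_matching n v"
    and \<beta>: "bij_betw \<beta> (free n u) (free n v)"
  shows "perfect_matching n (join n u v \<beta>)"
proof (rule pmI)
  fix B assume "B \<in> join n u v \<beta>"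
  then consider C where "C \<in> u" "B = Top ` C" | C where "C \<in> v" "B = Bot ` C"
    | i where "i \<in> free n u" "B = {Bot (\<beta> i), Top i}"
    unfolding join_def by blast
  then show "\<exists>x\<in>points n. \<exists>y\<in>points n. x \<noteq> y \<and> B = {x, y}"
  proof cases
    case 1
    obtain i j where "C = {i, j}" "i \<noteq> j" "i < n" "j < n" using partial_matching_arc[OF u 1(1)] .
    then show ?thesis using 1 by (intro bexI[of _ "Top i"] bexI[of _ "Top j"]) (auto simp: points_def)
  next
    case 2
    obtain i j where "C = {i, j}" "i \<noteq> j" "i < n" "j < n" using partial_matching_arc[OF v 2(1)] .
    then show ?thesis using 2 by (intro bexI[of _ "Bot i"] bexI[of _ "Bot j"]) (auto simp: points_def)
  next
    case 3
    then have "\<beta> i \<in> free n v" using \<beta> by (auto simp: bij_betw_def)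
    then show ?thesis using 3 by (intro bexI[of _ "Bot (\<beta> i)"] bexI[of _ "Top i"]) (auto simp: points_def free_def)
  qed
next
  have arc: "\<exists>j. {i, j} \<in> w" if w: "partial_matching n w" "i < n" "i \<notin> free n w" for w i
  proof -
    obtain B where B: "B \<in> w" "i \<in> B" using w by (auto simp: free_def)
    then obtain l j where "B = {l, j}" using partial_matching_arc[OF w(1)] by metis
    then show ?thesis using B by (auto simp: insert_commute)
  qed
  fix x assume "x \<in> points n"
  then consider i where "x = Top i" "i < n" | i where "x = Bot i" "i < n" by (auto simp: points_def)
  then show "\<exists>y. {x, y} \<in> join n u v \<beta>"
  proof cases
    case 1
    show ?thesis
    proof (cases "i \<in> free n u")
      case True
      then have "{x, Bot (\<beta> i)} \<in> join n u v \<beta>" using 1 by (simp add: join_mem)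
      then show ?thesis by blast
    next
      case False
      then obtain j where "{i, j} \<in> u" using arc[OF u] 1 by blast
      then have "{x, Top j} \<in> join n u v \<beta>" using 1 by (simp add: join_mem)
      then show ?thesis by blast
    qed
  next
    case 2
    show ?thesis
    proof (cases "i \<in> free n v")
      case True
      then obtain j where "j \<in> free n u" "i = \<beta> j" using \<beta> by (auto simp: bij_betw_def)
      then have "{x, Top j} \<in> join n u v \<beta>" using 2 by (simp add: join_mem)
      then show ?thesis by blast
    next
      case False
      then obtain j where "{i, j} \<in> v" using arc[OF v] 2 by blast
      then have "{x, Bot j} \<in> join n u v \<beta>" using 2 by (simp add: join_mem)
      then show ?thesis by blast
    qed
  qed
next
  have un: "j = l" if "partial_matching n w" "{i, j} \<in> w" "{i, l} \<in> w" for w i j l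
  proof -
    have "{i, j} = {i, l}" using that disjointD[of w "{i, j}" "{i, l}"] unfolding partial_matching_def by blast
    then show ?thesis by (auto simp: doubleton_eq_iff)
  qed
  have nf: "i \<notin> free n w" if "{i, j} \<in> w" for i j w using that by (auto simp: free_def)
  have bf: "\<beta> i \<in> free n v" if "i \<in> free n u" for i using that \<beta> by (auto simp: bij_betw_def)
  fix x y z assume xy: "{x, y} \<in> join n u v \<beta>" and xz: "{x, z} \<in> join n u v \<beta>"
  show "y = z"
  proof (cases x)
    case (Top i)
    then show ?thesis using xy xz un[OF u] nf
      by (cases y; cases z) (auto simp: join_mem)
  next
    case (Bot i)
    have nfb: "{\<beta> j, l} \<notin> v" if "j \<in> free n u" for j l using nf bf[OF that] by blast
    then show ?thesis using Bot xy xz un[OF v] bij_betw_imp_inj_on[OF \<beta>]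
      by (cases y; cases z) (auto simp: join_mem inj_on_def)
  qed
qed

lemma top_arcs_join [simp]:
  assumes "partial_matching n u" shows "top_arcs (join n u v \<beta>) = u"
proof (intro equalityI subsetI)
  fix B assume "B \<in> u"
  then obtain i j where "B = {i, j}" using partial_matching_arc[OF assms] by metis
  then show "B \<in> top_arcs (join n u v \<beta>)" using \<open>B \<in> u\<close> by (simp add: top_arcs_iff join_mem)
qed (auto simp: top_arcs_def join_mem)

lemma bot_arcs_join [simp]:
  assumes "partial_matching n v" shows "bot_arcs (join n u v \<beta>) = v"
proof (intro equalityI subsetI)
  fix B assume "B \<in> v"
  then obtain i j where "B = {i, j}" using partial_matching_arc[OF assms] by metis
  then show "B \<in> bot_arcs (join n u v \<beta>)" using \<open>B \<in> v\<close> by (simp add: bot_arcs_iff join_mem)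
qed (auto simp: bot_arcs_def join_mem)

lemma pm_projection: "partial_matching n u \<Longrightarrow> perfect_matching n (projection n u)"
  by (rule pm_join) auto

lemma exists_join:
  assumes u: "partial_matching n u" and v: "partial_matching n v" and "card u = card v"
  obtains x where "perfect_matching n x" "top_arcs x = u" "bot_arcs x = v"
proof -
  have "card (free n u) = card (free n v)" using card_free[OF u] card_free[OF v] assms(3) by simp
  then obtain \<beta> where "bij_betw \<beta> (free n u) (free n v)"
    using finite_same_card_bij[of "free n u" "free n v"] by (auto simp: free_def)
  then show ?thesis using that[of "join n u v \<beta>"] pm_join[OF u v] u v by simp
qed

lemma through_strands_join:
  assumes "partial_matching n u" "partial_matching n v" "bij_betw \<beta> (free n u) (free n v)"
  shows "through_strands (join n u v \<beta>) = card (free n u)"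
  using through_strands_free[OF pm_join[OF assms]] assms by simp

text \<open>
  A through strand of \<open>b\<close> followed by its mirror image returns to the same position.
\<close>
lemma stack_flip_eq_projection:
  assumes b: "perfect_matching n b"
  shows "stack (flip b) b = projection n (bot_arcs b)"
proof -
  note u = partial_matching_bot_arcs[OF b]
  let ?s = "stack (flip b) b"
  have s: "perfect_matching n ?s" using pm_stack[OF pm_flip[OF b] b] .
  have "projection n (bot_arcs b) \<subseteq> ?s"
  proof
    fix B assume "B \<in> projection n (bot_arcs b)"
    then consider C where "C \<in> bot_arcs b" "B = Top ` C" | C where "C \<in> bot_arcs b" "B = Bot ` C"
      | i where "i \<in> free n (bot_arcs b)" "B = {Bot i, Top i}"
      unfolding join_def by auto
    then show "B \<in> ?s"
    proof cases
      case 1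
      obtain i j where C: "C = {i, j}" using partial_matching_arc[OF u 1(1)] by metis
      have "C \<in> top_arcs ?s" using top_arcs_stack[OF pm_flip[OF b], of b] 1 by (auto simp: top_arcs_flip)
      then show ?thesis using 1 C by (simp add: top_arcs_iff)
    next
      case 2
      obtain i j where C: "C = {i, j}" using partial_matching_arc[OF u 2(1)] by metis
      have "C \<in> bot_arcs ?s" using bot_arcs_stack[OF b, of "flip b"] 2 by auto
      then show ?thesis using 2 C by (simp add: bot_arcs_iff)
    next
      case 3
      then obtain l where l: "{Bot i, Top l} \<in> b" using free_bot_partner[OF b] by blast
      then have l': "{Bot l, Top i} \<in> flip b" by (simp add: flip_iff insert_commute)
      have "(place_below (Bot i), place_below (Top l)) \<in> stack_edges (flip b) b"
        "(place_above (Bot l), place_above (Top i)) \<in> stack_edges (flip b) b"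
        unfolding stack_edges_def using l l' by blast+
      then have "(Lower i, Upper i) \<in> (stack_edges (flip b) b)\<^sup>*" by simp
      then show ?thesis using 3 by (simp add: stack_iff)
    qed
  qed
  then show ?thesis using pm_eqI[OF pm_projection[OF u] s] by simp
qed

lemma id_diagram_projection: "id_diagram n = projection n {}"
  unfolding id_diagram_def join_def free_def by auto

lemma pm_id: "perfect_matching n (id_diagram n)"
  unfolding id_diagram_projection by (rule pm_projection) (simp add: partial_matching_def)

lemma top_arcs_id: "top_arcs (id_diagram n) = {}" "bot_arcs (id_diagram n) = {}"
  unfolding id_diagram_projection by (simp_all add: partial_matching_def)

lemma through_strands_id: "through_strands (id_diagram n) = n"
  using through_strands_top_arcs[OF pm_id[of n]] by (simp add: top_arcs_id)

lemma flip_id: "flip (id_diagram n) = id_diagram n"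
proof -
  have "id_diagram n \<subseteq> flip (id_diagram n)"
  proof
    fix B assume B: "B \<in> id_diagram n"
    then obtain i where "B = {Bot i, Top i}" by (auto simp: id_diagram_def)
    then show "B \<in> flip (id_diagram n)" using B by (simp add: flip_iff insert_commute)
  qed
  then show ?thesis using pm_eqI[OF pm_id pm_flip[OF pm_id]] by metis
qed

text \<open>
  Both laws follow from the regularity \<open>a a\<^sup>* b = b\<close>, applied to the self-reflected idempotent given by
  the identity diagram.
\<close>
lemma stack_id:
  assumes a: "perfect_matching n a"
  shows "stack (id_diagram n) a = a" "stack a (id_diagram n) = a"
proof -
  have "stack (id_diagram n) (stack (flip (id_diagram n)) b) = b" if "perfect_matching n b" for b
    using that by (intro stack_stack_flip pm_id) (simp_all add: top_arcs_id pm_id)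
  then have i: "stack (id_diagram n) (stack (id_diagram n) b) = b" if "perfect_matching n b" for b
    using that by (simp add: flip_id)
  have ii: "stack (id_diagram n) (id_diagram n) = id_diagram n"
    using stack_flip_eq_projection[OF pm_id[of n]] by (simp add: flip_id top_arcs_id id_diagram_projection[symmetric])
  have l: "stack (id_diagram n) b = b" if "perfect_matching n b" for b
    using i[OF that] by (simp add: stack_assoc[symmetric] ii)
  show "stack (id_diagram n) a = a" using l a .
  have "flip (stack (id_diagram n) (flip a)) = a" using l[OF pm_flip[OF a]] by simp
  then show "stack a (id_diagram n) = a" by (simp add: flip_stack flip_id)
qed

section \<open>Planar diagrams\<close>

text \<open>
  The ends of an arc between neighbours have consecutive boundary positions and leave no room for an
  interleaving; vertical strands are nested.
\<close>
lemma planar_projection: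
  assumes u: "partial_matching n u" and adj: "\<And>B. B \<in> u \<Longrightarrow> \<exists>i. B = {i, Suc i}"
  shows "planar n (projection n u)"
  unfolding planar_def
proof (rule notI, elim exE conjE)
  fix x y z w assume xy: "{x, y} \<in> projection n u" and zw: "{z, w} \<in> projection n u"
    and lt: "boundary_pos n x < boundary_pos n z" "boundary_pos n z < boundary_pos n y" "boundary_pos n y < boundary_pos n w"
  have pts: "x \<in> points n" "y \<in> points n" "z \<in> points n" "w \<in> points n"
    using pm_block[OF pm_projection[OF u]] xy zw by blast+
  have arc: "j = Suc i \<or> i = Suc j" if "{i, j} \<in> u" for i j
    using adj[OF that] by (auto simp: doubleton_eq_iff)
  have *: "\<exists>i. p = Bot i \<and> q = Top i"
    if pq: "{p, q} \<in> projection n u" "boundary_pos n p < boundary_pos n r" "boundary_pos n r < boundary_pos n q"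
      and p: "p \<in> points n" "q \<in> points n" for p q r
  proof (cases p; cases q)
    fix i j assume "p = Bot i" "q = Bot j"
    then show ?thesis using arc[of i j] pq by (auto simp: join_mem)
  next
    fix i j assume "p = Top i" "q = Top j"
    moreover from this have "i < n" "j < n" using p by (auto simp: points_def)
    ultimately show ?thesis using arc[of i j] pq by (auto simp: join_mem)
  next
    fix i j assume "p = Bot i" "q = Top j"
    then show ?thesis using pq by (auto simp: join_mem)
  next
    fix i j assume "p = Top i" "q = Bot j"
    moreover from this have "i < n" "j < n" using p by (auto simp: points_def)
    ultimately show ?thesis using pq by (auto simp: join_mem)
  qed
  obtain i where "x = Bot i" "y = Top i" using *[OF xy lt(1,2) pts(1,2)] by blast
  moreover obtain l where "z = Bot l" "w = Top l" using *[OF zw lt(2,3) pts(3,4)] by blast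
  ultimately show False using lt by auto
qed

lemma planar_through_order:
  assumes a: "perfect_matching n a" and pl: "planar n a"
    and ij: "{Bot i, Top j} \<in> a" and kl: "{Bot i', Top j'} \<in> a" and "i < i'"
  shows "\<not> j' < j"
proof
  assume "j' < j"
  have "j < n" "j' < n" "i < n" "i' < n" using pm_block[OF a ij] pm_block[OF a kl] by (auto simp: points_def)
  then have "boundary_pos n (Bot i) < boundary_pos n (Bot i')" "boundary_pos n (Bot i') < boundary_pos n (Top j)"
    "boundary_pos n (Top j) < boundary_pos n (Top j')"
    using \<open>i < i'\<close> \<open>j' < j\<close> by auto
  then show False using pl ij kl unfolding planar_def by blast
qed

text \<open>
  In a planar diagram the through strands join the free points in order. A leftmost strand on which two
  such diagrams differ would cross another strand in one of them.
\<close>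
lemma planar_determined_by_arcs:
  assumes a: "perfect_matching n a" "planar n a" and b: "perfect_matching n b" "planar n b"
    and top: "top_arcs a = top_arcs b" and bot: "bot_arcs a = bot_arcs b"
  shows "a = b"
proof -
  have thr: "{Bot i, Top j} \<in> a \<Longrightarrow> {Bot i, Top j} \<in> b" for i j
  proof (induction i arbitrary: j rule: less_induct)
    case (less i)
    have "i \<in> free n (bot_arcs b)" "j \<in> free n (top_arcs b)"
      using free_bot_partner[OF a(1)] free_top_partner[OF a(1)] less(2) top bot by auto
    then obtain j' i' where j': "{Bot i, Top j'} \<in> b" and i': "{Bot i', Top j} \<in> b"
      unfolding free_bot_partner[OF b(1)] free_top_partner[OF b(1)] by blast
    have "j' \<in> free n (top_arcs a)" using free_top_partner[OF b(1)] j' top by auto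
    then obtain i'' where i'': "{Bot i'', Top j'} \<in> a" unfolding free_top_partner[OF a(1)] by blast
    have "i' \<in> free n (bot_arcs a)" using free_bot_partner[OF b(1)] i' bot by auto
    then obtain j'' where j'': "{Bot i', Top j''} \<in> a" unfolding free_bot_partner[OF a(1)] by blast
    have ub: "p = q" if "{Bot p, Top l} \<in> b" "{Bot q, Top l} \<in> b" for p q l
      using pm_unique[OF b(1), of "Top l" "Bot p" "Bot q"] that by (auto simp: insert_commute)
    have ua: "p = q" if "{Bot p, Top l} \<in> a" "{Bot q, Top l} \<in> a" for p q l
      using pm_unique[OF a(1), of "Top l" "Bot p" "Bot q"] that by (auto simp: insert_commute)
    have ut: "p = q" if "{Bot l, Top p} \<in> b" "{Bot l, Top q} \<in> b" for p q l
      using pm_unique[OF b(1), of "Bot l" "Top p" "Top q"] that by auto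
    consider "j < j'" | "j' < j" | "j = j'" by linarith
    then show ?case
    proof cases
      case 1
      have "\<not> i' < i" 
      proof
        assume "i' < i"
        then have "{Bot i', Top j''} \<in> b" using less(1) j'' by blast
        then have "j'' = j" using ut i' by blast
        then show False using ua[OF j''] less(2) \<open>i' < i\<close> by blast
      qed
      moreover have "\<not> i < i'" using planar_through_order[OF b j' i'] 1 by blast
      ultimately have "i' = i" by simp
      then show ?thesis using i' by simp
    next
      case 2
      have "\<not> i'' < i"
      proof
        assume "i'' < i"
        then have "{Bot i'', Top j'} \<in> b" using less(1) i'' by blast
        then show False using ub[OF j'] \<open>i'' < i\<close> by blast
      qed
      moreover have "\<not> i < i''" using planar_through_order[OF a less(2) i''] 2 by blast
      ultimately have "i'' = i" by simp
      then have "j' = j" using pm_unique[OF a(1) less(2)] i'' by blast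
      then show ?thesis using 2 by simp
    next
      case 3
      then show ?thesis using j' by simp
    qed
  qed
  have "a \<subseteq> b"
  proof
    fix B assume B: "B \<in> a"
    obtain x y where xy: "B = {x, y}" using pm_blockE[OF a(1) B] by metis
    show "B \<in> b"
    proof (cases x; cases y)
      fix i j assume "x = Bot i" "y = Bot j"
      then show ?thesis using B xy bot bot_arcs_iff by metis
    next
      fix i j assume "x = Top i" "y = Top j"
      then show ?thesis using B xy top top_arcs_iff by metis
    next
      fix i j assume "x = Bot i" "y = Top j"
      then show ?thesis using B xy thr by simp
    next
      fix i j assume "x = Top i" "y = Bot j"
      then show ?thesis using B xy thr by (simp add: insert_commute)
    qed
  qed
  then show ?thesis using pm_eqI[OF a(1) b(1)] by simp
qed

lemma relabel_projection:
  assumes g: "g permutes {..<n}"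
  shows "relabel g (projection n u) = projection n (image g ` u)"
proof -
  have 1: "image (relabel_point g) ` image Top ` u = image Top ` image g ` u" 
    "image (relabel_point g) ` image Bot ` u = image Bot ` image g ` u"
    by (simp_all add: image_image)
  have "free n (image g ` u) = g ` free n u"
    unfolding free_def
    by (simp add: image_Union[symmetric] image_set_diff[OF permutes_inj[OF g]] permutes_image[OF g])
  then have "image (relabel_point g) ` (\<lambda>i. {Bot (id i), Top i}) ` free n u =
    (\<lambda>i. {Bot (id i), Top i}) ` free n (image g ` u)"
    by (simp add: image_image)
  then show ?thesis unfolding relabel_def join_def image_Un 1 by (rule arg_cong)
qed

section \<open>Conjugating projections to planar ones\<close>

text \<open>
  The standard half diagram of rank \<open>j\<close>: the first \<open>j\<close> points are free and the others are paired with
  their neighbours.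
\<close>
definition adjacent_arcs :: "nat \<Rightarrow> nat \<Rightarrow> nat set set" where
  "adjacent_arcs n j = {{j + 2 * i, Suc (j + 2 * i)} | i. Suc (j + 2 * i) < n}"

lemma partial_matching_adjacent_arcs: "partial_matching n (adjacent_arcs n j)"
  unfolding partial_matching_def
proof (intro conjI ballI disjointI)
  fix B assume "B \<in> adjacent_arcs n j"
  then show "B \<subseteq> {..<n}" "card B = 2" by (auto simp: adjacent_arcs_def)
next
  fix B C assume "B \<in> adjacent_arcs n j" "C \<in> adjacent_arcs n j" and ne: "B \<noteq> C"
  then obtain i l where il: "B = {j + 2 * i, Suc (j + 2 * i)}" "C = {j + 2 * l, Suc (j + 2 * l)}"
    by (auto simp: adjacent_arcs_def)
  then have "i \<noteq> l" using ne by auto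
  then have "j + 2 * i \<noteq> j + 2 * l" "j + 2 * i \<noteq> Suc (j + 2 * l)" "Suc (j + 2 * i) \<noteq> j + 2 * l" by presburger+
  then show "B \<inter> C = {}" using il by auto
qed

lemma free_adjacent_arcs:
  assumes "j \<le> n" "j mod 2 = n mod 2"
  shows "free n (adjacent_arcs n j) = {..<j}"
proof (intro equalityI subsetI)
  fix x assume x: "x \<in> free n (adjacent_arcs n j)"
  show "x \<in> {..<j}"
  proof (rule ccontr)
    assume "x \<notin> {..<j}"
    define i where "i = (x - j) div 2"
    have "x = j + 2 * i \<or> x = Suc (j + 2 * i)" using \<open>x \<notin> {..<j}\<close> unfolding i_def by (simp; presburger)
    moreover have "x < n" "j \<le> x" using x \<open>x \<notin> {..<j}\<close> by (auto simp: free_def)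
    moreover have "Suc (j + 2 * i) < n"
    proof -
      have "even (n - j)" using mod_eq_dvd_iff_nat[of j n 2] assms by simp
      then obtain r where "n - j = 2 * r" by blast
      moreover have "x - j < n - j" using \<open>x < n\<close> \<open>j \<le> x\<close> by simp
      ultimately have "Suc (2 * i) < n - j" unfolding i_def by presburger
      then show ?thesis by simp
    qed
    ultimately show False using x unfolding free_def adjacent_arcs_def by blast
  qed
next
  fix x assume "x \<in> {..<j}"
  then show "x \<in> free n (adjacent_arcs n j)" using assms by (auto simp: free_def adjacent_arcs_def)
qed

text \<open>
  Number the arcs, and send the two ends of the \<open>i\<close>-th arc to the \<open>i\<close>-th adjacent pair and the free
  points to the first positions.
\<close>
lemma exists_permutation_to_adjacent:
  assumes u: "partial_matching n u"
  shows "\<exists>g. g permutes {..<n} \<and> image g ` u = adjacent_arcs n (card (free n u))"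
proof -
  define j where "j = card (free n u)"
  have n: "n = 2 * card u + j" using card_free[OF u] by (simp add: j_def)
  obtain h where h: "bij_betw h u {..<card u}"
    using ex_bij_betw_finite_nat[OF partial_matching_finite[OF u]] atLeast0LessThan by metis
  obtain \<phi> where \<phi>: "bij_betw \<phi> (free n u) {..<j}"
    using ex_bij_betw_finite_nat[of "free n u"] atLeast0LessThan unfolding j_def
    by (metis finite_Diff finite_lessThan free_def)
  define blk where "blk x = (THE B. B \<in> u \<and> x \<in> B)" for x
  have blk: "blk x = B" if "B \<in> u" "x \<in> B" for x B
    unfolding blk_def
  proof (rule the_equality)
    fix C assume "C \<in> u \<and> x \<in> C"
    then show "C = B" using u that disjointD[of u B C] unfolding partial_matching_def by blast
  qed (use that in simp)
  define e where "e x = (if x = Min (blk x) then 0 else Suc 0)" for x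
  \<comment> \<open>The offset \<open>e\<close> tells the two ends of an arc apart.\<close>
  define g where "g x = (if x \<in> \<Union>u then j + (2 * h (blk x) + e x) else if x < n then \<phi> x else x)" for x
  have hlt: "h B < card u" if "B \<in> u" for B using h that by (auto simp: bij_betw_def)
  have in_Un: "\<exists>B\<in>u. x \<in> B \<and> blk x = B" if "x \<in> \<Union>u" for x using that blk by blast
  have free_iff: "x \<in> free n u" if "x < n" "x \<notin> \<Union>u" for x using that by (auto simp: free_def)
  have \<phi>lt: "\<phi> x < j" if "x < n" "x \<notin> \<Union>u" for x
    using \<phi> free_iff[OF that] by (auto simp: bij_betw_def)
  have e: "e x \<le> 1" for x by (simp add: e_def)
  have Un: "\<Union>u \<subseteq> {..<n}" using u by (auto simp: partial_matching_def)
  have "inj_on g {..<n}"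
  proof (rule inj_onI)
    fix x y assume x: "x \<in> {..<n}" and y: "y \<in> {..<n}" and eq: "g x = g y"
    consider "x \<in> \<Union>u" "y \<in> \<Union>u" | "x \<in> \<Union>u" "y \<notin> \<Union>u" | "x \<notin> \<Union>u" "y \<in> \<Union>u" | "x \<notin> \<Union>u" "y \<notin> \<Union>u" by blast
    then show "x = y"
    proof cases
      case 1
      then have "2 * h (blk x) + e x = 2 * h (blk y) + e y" using eq by (simp add: g_def)
      then have he: "h (blk x) = h (blk y)" "e x = e y" using e[of x] e[of y] by presburger+
      obtain B C where B: "B \<in> u" "x \<in> B" "blk x = B" and C: "C \<in> u" "y \<in> C" "blk y = C"
        using in_Un 1 by blast
      then have "B = C" using he(1) h by (auto simp: bij_betw_def dest: inj_onD)
      obtain p q where pq: "B = {p, q}" "p \<noteq> q" using partial_matching_arc[OF u B(1)] by metis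
      then have "Min B = p \<or> Min B = q" by (auto simp: min_def)
      moreover have "x = Min B \<longleftrightarrow> y = Min B"
        using he(2) B(3) C(3) \<open>B = C\<close> by (auto simp: e_def split: if_splits)
      moreover have "x = p \<or> x = q" "y = p \<or> y = q" using B(2) C(2) \<open>B = C\<close> pq(1) by auto
      ultimately show ?thesis using pq(2) by metis
    next
      case 2
      then show ?thesis using eq \<phi>lt[of y] y by (simp add: g_def)
    next
      case 3
      then show ?thesis using eq \<phi>lt[of x] x by (simp add: g_def)
    next
      case 4
      then have "\<phi> x = \<phi> y" using eq x y by (simp add: g_def)
      then show ?thesis using \<phi> free_iff x y 4 by (auto simp: bij_betw_def dest: inj_onD)
    qed
  qed
  moreover have "g ` {..<n} \<subseteq> {..<n}"
  proof (rule image_subsetI)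
    fix x assume x: "x \<in> {..<n}"
    show "g x \<in> {..<n}"
    proof (cases "x \<in> \<Union>u")
      case True
      then have "h (blk x) < card u" using in_Un hlt by blast
      then show ?thesis using True e[of x] n by (simp add: g_def)
    next
      case False
      then show ?thesis using \<phi>lt[of x] x n by (simp add: g_def)
    qed
  qed
  ultimately have "bij_betw g {..<n} {..<n}"
    by (simp add: bij_betw_def endo_inj_surj)
  then have "g permutes {..<n}"
    by (rule bij_imp_permutes) (use Un in \<open>auto simp: g_def\<close>)
  moreover have gB: "g ` B = {j + 2 * h B, Suc (j + 2 * h B)}" if B: "B \<in> u" for B
  proof -
    obtain p q where pq: "B = {p, q}" "p < q"
      using partial_matching_arc[OF u B] by (metis insert_commute linorder_neqE_nat)
    then have "blk p = B" "blk q = B" "p \<in> \<Union>u" "q \<in> \<Union>u" "Min B = p" using blk B by auto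
    then show ?thesis using pq by (auto simp: g_def e_def)
  qed
  moreover have "image g ` u = adjacent_arcs n j"
  proof (intro equalityI subsetI)
    fix C assume "C \<in> image g ` u"
    then obtain B where "B \<in> u" "C = g ` B" by blast
    then show "C \<in> adjacent_arcs n j"
      using gB[of B] hlt[of B] n unfolding adjacent_arcs_def by auto
  next
    fix C assume "C \<in> adjacent_arcs n j"
    then obtain i where i: "C = {j + 2 * i, Suc (j + 2 * i)}" "Suc (j + 2 * i) < n" by (auto simp: adjacent_arcs_def)
    then have "i \<in> h ` u" using h n by (auto simp: bij_betw_def)
    then show "C \<in> image g ` u" using i gB by auto
  qed
  ultimately show ?thesis unfolding j_def by blast
qed

lemma through_strands_projection:
  "partial_matching n u \<Longrightarrow> through_strands (projection n u) = card (free n u)"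
  by (rule through_strands_join) auto

lemma through_strands_relabel:
  assumes a: "perfect_matching n a" and g: "g permutes {..<n}"
  shows "through_strands (relabel g a) = through_strands a"
proof -
  have inj: "inj (image g)" using permutes_inj[OF g] by (simp add: inj_image_eq_iff inj_def)
  have inv: "g (Hilbert_Choice.inv g i) = i" "Hilbert_Choice.inv g (g i) = i" for i using permutes_inverses[OF g] by auto
  have "top_arcs (relabel g a) = image g ` top_arcs a"
  proof (intro equalityI subsetI)
    fix B assume "B \<in> top_arcs (relabel g a)"
    then obtain i j where ij: "B = {i, j}" "{Top i, Top j} \<in> relabel g a" by (auto simp: top_arcs_def)
    then have "{Hilbert_Choice.inv g i, Hilbert_Choice.inv g j} \<in> top_arcs a"
      using relabel_iff[OF permutes_bij[OF g]] by (simp add: top_arcs_iff)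
    moreover have "B = g ` {Hilbert_Choice.inv g i, Hilbert_Choice.inv g j}" using ij inv by simp
    ultimately show "B \<in> image g ` top_arcs a" by blast
  next
    fix B assume "B \<in> image g ` top_arcs a"
    then obtain i j where "{Top i, Top j} \<in> a" "B = {g i, g j}" by (auto simp: top_arcs_def)
    then show "B \<in> top_arcs (relabel g a)" using relabel_mem[of "Top i" "Top j" a g] by (simp add: top_arcs_iff)
  qed
  then have "card (top_arcs (relabel g a)) = card (top_arcs a)"
    by (simp add: card_image inj_on_subset[OF inj])
  then show ?thesis
    using through_strands_top_arcs[OF a] through_strands_top_arcs[OF pm_relabel[OF a g]] by simp
qed

lemma relabel_id_diagram: "g permutes {..<n} \<Longrightarrow> relabel g (id_diagram n) = id_diagram n"
  by (simp add: id_diagram_projection relabel_projection)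

lemma relabel_transpose_fixed:
  assumes a: "perfect_matching n a" and top: "{i, j} \<in> top_arcs a" and bot: "{i, j} \<in> bot_arcs a"
  shows "relabel (transpose i j) a = a"
proof -
  have ij: "{Top i, Top j} \<in> a" "{Bot i, Bot j} \<in> a" using top bot by (simp_all add: top_arcs_iff bot_arcs_iff)
  have g: "transpose i j permutes {..<n}"
    using pm_block[OF a ij(1)] by (intro permutes_swap_id) (auto simp: points_def)
  have "relabel (transpose i j) a \<subseteq> a"
  proof
    fix B assume "B \<in> relabel (transpose i j) a"
    then obtain C where C: "C \<in> a" "B = relabel_point (transpose i j) ` C" by (auto simp: relabel_def)
    show "B \<in> a"
    proof (cases "C = {Top i, Top j} \<or> C = {Bot i, Bot j}")
      case True
      then show ?thesis using C ij by (auto simp: insert_commute)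
    next
      case False
      have "C \<inter> {Top i, Top j} = {}" "C \<inter> {Bot i, Bot j} = {}"
        using False C(1) ij a disjointD[of a C] unfolding perfect_matching_def partition_on_def by blast+
      then have "relabel_point (transpose i j) x = x" if "x \<in> C" for x
        using that by (cases x) (auto simp: transpose_def)
      then have "B = C" using C(2) by force
      then show ?thesis using C by simp
    qed
  qed
  then show ?thesis using pm_eqI[OF pm_relabel[OF a g] a] by simp
qed

section \<open>The truncated monoids and their cells\<close>

definition singular :: "nat \<Rightarrow> nat \<Rightarrow> diagram set" where
  "singular n k = {a. perfect_matching n a \<and> through_strands a \<le> k}"

definition planar_singular :: "nat \<Rightarrow> nat \<Rightarrow> diagram set" where
  "planar_singular n k = {a \<in> singular n k. planar n a}"

lemma truncation_simps [simp]:
  "mult (Br_le n k) = stack" "one (Br_le n k) = id_diagram n"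
  "mult (TL_le n k) = stack" "one (TL_le n k) = id_diagram n"
  by (simp_all add: truncation_def TL_def Br_def)

lemma carrier_Br_le: "carrier (Br_le n k) = insert (id_diagram n) (singular n k)"
  by (auto simp: truncation_def Br_def singular_def)

lemma carrier_TL_le: "carrier (TL_le n k) = insert (id_diagram n) (planar_singular n k)"
  by (auto simp: truncation_def TL_def Br_def singular_def planar_singular_def)

text \<open>
  The common features of the truncated Brauer and Temperley--Lieb monoids: the non-units \<open>N\<close> form an
  ideal that is closed under reflection.
\<close>
locale diagram_monoid =
  fixes S :: "diagram monoid" and n k :: nat and N :: "diagram set"
  assumes carrier: "carrier S = insert (id_diagram n) N"
    and mult [simp]: "mult S = stack" and one [simp]: "one S = id_diagram n"
    and k_less: "k < n" and N_sub: "N \<subseteq> singular n k"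
    and N_stack: "\<And>a b. a \<in> N \<Longrightarrow> b \<in> N \<Longrightarrow> stack a b \<in> N"
    and N_flip: "\<And>a. a \<in> N \<Longrightarrow> flip a \<in> N"
begin

lemma pm: "a \<in> N \<Longrightarrow> perfect_matching n a" and through_le: "a \<in> N \<Longrightarrow> through_strands a \<le> k"
  using N_sub by (auto simp: singular_def)

lemma id_notin: "id_diagram n \<notin> N"
  using through_le k_less by (metis leD through_strands_id)

lemma pm_carrier: "a \<in> carrier S \<Longrightarrow> perfect_matching n a"
  using pm pm_id carrier by auto

lemma ideal_left: "a \<in> carrier S \<Longrightarrow> b \<in> N \<Longrightarrow> stack a b \<in> N"
  using N_stack pm by (auto simp: carrier stack_id)

lemma ideal_right: "a \<in> N \<Longrightarrow> b \<in> carrier S \<Longrightarrow> stack a b \<in> N"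
  using N_stack pm by (auto simp: carrier stack_id)

lemma is_monoid: "monoid S"
proof
  show "x \<otimes>\<^bsub>S\<^esub> y \<in> carrier S" if "x \<in> carrier S" "y \<in> carrier S" for x y
    using that ideal_left[of x y] by (auto simp: carrier stack_id pm_id stack_id[OF pm])
qed (use pm_carrier in \<open>auto simp: stack_assoc stack_id carrier\<close>)

lemma finite_carrier: "finite (carrier S)"
proof (rule finite_subset)
  show "carrier S \<subseteq> Pow (Pow (points n))"
    using pm_carrier by (fastforce simp: perfect_matching_def partition_on_def)
  show "finite (Pow (Pow (points n)))" by (simp add: points_def)
qed

lemma N_in_carrier: "a \<in> N \<Longrightarrow> a \<in> carrier S"
  by (simp add: carrier)

lemma Units_eq: "Units S = {id_diagram n}"
proof -
  have "id_diagram n \<in> Units S" using monoid.Units_one_closed[OF is_monoid] by simp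
  moreover have "a \<notin> Units S" if "a \<in> N" for a
  proof
    assume "a \<in> Units S"
    then obtain b where "b \<in> carrier S" "stack b a = id_diagram n" unfolding Units_def by auto
    then show False using ideal_left[OF _ that] id_notin by metis
  qed
  ultimately show ?thesis using carrier by (auto simp: Units_def)
qed

text \<open>
  Right multiplication can only add top arcs. Conversely, if the top arcs of \<open>a\<close> and \<open>b\<close> agree, then
  \<open>b = a (a\<^sup>* b)\<close>.
\<close>
lemma right_cell_eq:
  assumes a: "a \<in> N"
  shows "right_cell S a = {b \<in> N. top_arcs b = top_arcs a}"
proof (intro equalityI subsetI)
  fix b assume "b \<in> right_cell S a"
  then obtain s t where b: "b \<in> carrier S" and s: "s \<in> carrier S" "b = stack a s"
    and t: "t \<in> carrier S" "a = stack b t"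
    unfolding right_cell_def le_r_def mult by blast
  have "b \<in> N" using ideal_right[OF a s(1)] s(2) by simp
  moreover have "top_arcs a \<subseteq> top_arcs b" using top_arcs_stack[OF pm[OF a]] s(2) by simp
  moreover have "top_arcs b \<subseteq> top_arcs a" using top_arcs_stack[OF pm_carrier[OF b]] t(2) by metis
  ultimately show "b \<in> {b \<in> N. top_arcs b = top_arcs a}" by blast
next
  fix b assume b: "b \<in> {b \<in> N. top_arcs b = top_arcs a}"
  then have bN: "b \<in> N" and eq: "top_arcs b = top_arcs a" by auto
  have "stack a (stack (flip a) b) = b" "stack b (stack (flip b) a) = a"
    using stack_stack_flip[OF pm[OF a] pm[OF bN]] stack_stack_flip[OF pm[OF bN] pm[OF a]] eq by simp_all
  moreover have "stack (flip a) b \<in> carrier S" "stack (flip b) a \<in> carrier S"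
    using a bN N_flip N_stack N_in_carrier by blast+
  ultimately have "le_r S a b" "le_r S b a" unfolding le_r_def mult by metis+
  then show "b \<in> right_cell S a" using N_in_carrier[OF bN] unfolding right_cell_def by blast
qed

lemma left_cell_eq:
  assumes a: "a \<in> N"
  shows "left_cell S a = {b \<in> N. bot_arcs b = bot_arcs a}"
proof (intro equalityI subsetI)
  fix b assume "b \<in> left_cell S a"
  then obtain s t where b: "b \<in> carrier S" and s: "s \<in> carrier S" "b = stack s a"
    and t: "t \<in> carrier S" "a = stack t b"
    unfolding left_cell_def le_l_def mult by blast
  have "b \<in> N" using ideal_left[OF s(1) a] s(2) by simp
  moreover have "bot_arcs a \<subseteq> bot_arcs b" using bot_arcs_stack[OF pm[OF a]] s(2) by simp
  moreover have "bot_arcs b \<subseteq> bot_arcs a" using bot_arcs_stack[OF pm_carrier[OF b]] t(2) by metis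
  ultimately show "b \<in> {b \<in> N. bot_arcs b = bot_arcs a}" by blast
next
  fix b assume b: "b \<in> {b \<in> N. bot_arcs b = bot_arcs a}"
  then have bN: "b \<in> N" and eq: "bot_arcs b = bot_arcs a" by auto
  have "stack (stack b (flip a)) a = b" "stack (stack a (flip b)) b = a"
    using stack_flip_stack[OF pm[OF a] pm[OF bN]] stack_flip_stack[OF pm[OF bN] pm[OF a]] eq by simp_all
  moreover have "stack b (flip a) \<in> carrier S" "stack a (flip b) \<in> carrier S"
    using a bN N_flip N_stack N_in_carrier by blast+
  ultimately have "le_l S a b" "le_l S b a" unfolding le_l_def mult by metis+
  then show "b \<in> left_cell S a" using N_in_carrier[OF bN] unfolding left_cell_def by blast
qed

lemma H_cell_eq:
  assumes a: "a \<in> N"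
  shows "H_cell S a = {b \<in> N. top_arcs b = top_arcs a \<and> bot_arcs b = bot_arcs a}"
  unfolding H_cell_def left_cell_eq[OF a] right_cell_eq[OF a] by blast

lemma le_lr_through:
  assumes "le_lr S a b" "a \<in> carrier S"
  shows "through_strands b \<le> through_strands a"
proof -
  obtain s t where st: "s \<in> carrier S" "t \<in> carrier S" "b = stack (stack s a) t"
    using assms by (auto simp: le_lr_def)
  have "perfect_matching n s" "perfect_matching n a" "perfect_matching n t"
    using st assms pm_carrier by auto
  then show ?thesis
    using through_strands_stack(1)[of n "stack s a" t] through_strands_stack(2)[of n s a] pm_stack[of n s a] st(3)
    by simp
qed

end

lemma Br_diagram_monoid:
  assumes "k < n" shows "diagram_monoid (Br_le n k) n k (singular n k)"
proof
  show "stack a b \<in> singular n k" if "a \<in> singular n k" "b \<in> singular n k" for a b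
    using that pm_stack through_strands_stack by (fastforce simp: singular_def)
qed (use assms carrier_Br_le pm_flip in \<open>auto simp: singular_def through_strands_flip\<close>)

lemma TL_diagram_monoid:
  assumes "k < n" shows "diagram_monoid (TL_le n k) n k (planar_singular n k)"
proof -
  interpret B: diagram_monoid "Br_le n k" n k "singular n k" using Br_diagram_monoid[OF assms] .
  show ?thesis
  proof
    show "stack a b \<in> planar_singular n k" if "a \<in> planar_singular n k" "b \<in> planar_singular n k" for a b
      using that B.N_stack planar_stack B.pm by (auto simp: planar_singular_def)
    show "flip a \<in> planar_singular n k" if "a \<in> planar_singular n k" for a
      using that B.N_flip planar_flip B.pm by (auto simp: planar_singular_def)
  qed (use assms carrier_TL_le in \<open>auto simp: planar_singular_def\<close>)
qed

lemma TL_subset_Br: "carrier (TL_le n k) \<subseteq> carrier (Br_le n k)"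
  by (auto simp: carrier_TL_le carrier_Br_le planar_singular_def)

definition half_diagrams :: "nat \<Rightarrow> nat \<Rightarrow> nat set set set" where
  "half_diagrams n j = {u. partial_matching n u \<and> card (free n u) = j}"

lemma finite_half_diagrams: "finite (half_diagrams n j)"
  by (rule finite_subset[of _ "Pow (Pow {..<n})"]) (auto simp: half_diagrams_def partial_matching_def)

lemma half_diagrams_card_eq:
  assumes "u \<in> half_diagrams n j" "v \<in> half_diagrams n j"
  shows "card u = card v"
  using assms card_free[of n u] card_free[of n v] by (simp add: half_diagrams_def)

lemma arcs_half_diagrams:
  assumes "perfect_matching n a"
  shows "top_arcs a \<in> half_diagrams n (through_strands a)" "bot_arcs a \<in> half_diagrams n (through_strands a)"
  using assms partial_matching_top_arcs partial_matching_bot_arcs through_strands_free through_strands_free_bot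
  by (auto simp: half_diagrams_def)

text \<open>
  A left cell is the disjoint union of the \<open>H\<close>-cells over all half diagrams of its rank. All of them are
  nonempty since arcs at the top and bottom can be prescribed. They have the same size by Green's
  lemma: if \<open>x\<close> and \<open>y\<close> are in the left cell, then multiplication by \<open>y x\<^sup>*\<close> moves the \<open>H\<close>-cell of \<open>x\<close> to
  that of \<open>y\<close>, with inverse \<open>x y\<^sup>*\<close>.
\<close>
lemma card_left_cell_Br:
  assumes kn: "k < n" and e: "e \<in> singular n k"
  shows "card (left_cell (Br_le n k) e) =
    card (half_diagrams n (through_strands e)) * card (H_cell (Br_le n k) e)"
proof -
  interpret diagram_monoid "Br_le n k" n k "singular n k" using Br_diagram_monoid[OF kn] .
  let ?j = "through_strands e"
  define C where "C u = {b \<in> singular n k. top_arcs b = u \<and> bot_arcs b = bot_arcs e}" for u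
  have finC: "finite (C u)" for u
    by (rule finite_subset[OF _ finite_carrier]) (auto simp: C_def carrier_Br_le)
  have rank: "through_strands b = ?j" if "b \<in> C u" for b u
    using that through_strands_bot_arcs[OF pm[of b]] through_strands_bot_arcs[OF pm[OF e]] by (simp add: C_def)
  have ex: "\<exists>x. x \<in> C u" if u: "u \<in> half_diagrams n ?j" for u
  proof -
    have "card u = card (bot_arcs e)" using half_diagrams_card_eq[OF u arcs_half_diagrams(2)[OF pm[OF e]]] .
    then obtain x where x: "perfect_matching n x" "top_arcs x = u" "bot_arcs x = bot_arcs e"
      using exists_join[of n u "bot_arcs e"] u partial_matching_bot_arcs[OF pm[OF e]] by (auto simp: half_diagrams_def)
    have "through_strands x = ?j"
      using x through_strands_bot_arcs[OF x(1)] through_strands_bot_arcs[OF pm[OF e]] by simp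
    then have "x \<in> C u" using x through_le[OF e] by (simp add: C_def singular_def)
    then show ?thesis by blast
  qed
  have le: "card (C u) \<le> card (C u')" if u: "u \<in> half_diagrams n ?j" and u': "u' \<in> half_diagrams n ?j" for u u'
  proof -
    obtain x y where x: "x \<in> C u" and y: "y \<in> C u'" using ex u u' by blast
    have pmx: "perfect_matching n x" "perfect_matching n y" using x y pm by (auto simp: C_def)
    \<comment> \<open>Green's bijection between two \<open>H\<close>-cells of the same left cell.\<close>
    let ?f = "\<lambda>b. stack (stack y (flip x)) b"
    have inverse: "stack (stack x (flip y)) (?f b) = b" if b: "b \<in> C u" for b
    proof -
      have "stack (stack x (flip y)) y = x" using stack_flip_stack[OF pmx(2,1)] x y by (simp add: C_def)
      moreover have "stack x (stack (flip x) b) = b"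
        using stack_stack_flip[OF pmx(1), of b] b x pm by (simp add: C_def)
      ultimately show ?thesis by (metis stack_assoc)
    qed
    have "?f b \<in> C u'" if b: "b \<in> C u" for b
    proof -
      have bN: "b \<in> singular n k" and yN: "y \<in> singular n k" and xN: "x \<in> singular n k"
        using b y x by (auto simp: C_def)
      have fN: "?f b \<in> singular n k" using N_stack N_flip bN yN xN by blast
      have "through_strands (?f b) \<le> through_strands b"
        using through_strands_stack(2) pm N_stack[OF yN N_flip[OF xN]] bN by blast
      moreover have "through_strands b \<le> through_strands (?f b)"
        using through_strands_stack(2)[OF pm[OF N_stack[OF xN N_flip[OF yN]]] pm[OF fN]] inverse[OF b] by simp
      ultimately have ts: "through_strands (?f b) = ?j" using rank[OF b] by simp
      have "top_arcs y \<subseteq> top_arcs (?f b)" using top_arcs_stack[OF pmx(2)] by (simp add: stack_assoc)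
      then have "top_arcs y = top_arcs (?f b)"
        using through_strands_antimono(2)[OF pmx(2) pm[OF fN]] ts rank[OF y] by simp
      moreover have "bot_arcs b = bot_arcs (?f b)"
        using bot_arcs_eqI[OF pm[OF bN] pm[OF fN] bot_arcs_stack[OF pm[OF bN]]] ts rank[OF b] by simp
      ultimately show ?thesis using fN y b by (simp add: C_def)
    qed
    moreover have "inj_on ?f (C u)" using inverse by (intro inj_on_inverseI[where g = "stack (stack x (flip y))"])
    ultimately show ?thesis using card_inj_on_le[of ?f "C u" "C u'"] finC by blast
  qed
  have self: "top_arcs e \<in> half_diagrams n ?j" using arcs_half_diagrams[OF pm[OF e]] by simp
  have "left_cell (Br_le n k) e = (\<Union>u\<in>half_diagrams n ?j. C u)"
  proof -
    have "top_arcs b \<in> half_diagrams n ?j" if "b \<in> singular n k" "bot_arcs b = bot_arcs e" for b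
      using arcs_half_diagrams(1)[OF pm[OF that(1)]] rank[of b "top_arcs b"] that by (simp add: C_def)
    then show ?thesis unfolding left_cell_eq[OF e] C_def by blast
  qed
  also have "card \<dots> = (\<Sum>u\<in>half_diagrams n ?j. card (C u))"
    by (rule card_UN_disjoint) (use finC finite_half_diagrams in \<open>auto simp: C_def\<close>)
  also have "\<dots> = (\<Sum>u\<in>half_diagrams n ?j. card (C (top_arcs e)))"
    by (rule sum.cong) (use le self in \<open>auto intro: le_antisym\<close>)
  also have "\<dots> = card (half_diagrams n ?j) * card (C (top_arcs e))" by simp
  also have "C (top_arcs e) = H_cell (Br_le n k) e"
    unfolding H_cell_eq[OF e] C_def by blast
  finally show ?thesis .
qed

lemma card_H_cell_pos:
  assumes kn: "k < n" and e: "e \<in> singular n k"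
  shows "card (H_cell (Br_le n k) e) > 0"
proof -
  interpret diagram_monoid "Br_le n k" n k "singular n k" using Br_diagram_monoid[OF kn] .
  have "e \<in> H_cell (Br_le n k) e" using H_cell_eq[OF e] e by auto
  moreover have "finite (H_cell (Br_le n k) e)"
    by (rule finite_subset[OF _ finite_carrier]) (auto simp: H_cell_def left_cell_def)
  ultimately show ?thesis by (auto simp: card_gt_0_iff)
qed

lemma H_cell_TL:
  assumes kn: "k < n" and e: "e \<in> planar_singular n k"
  shows "H_cell (TL_le n k) e = {e}"
proof -
  interpret diagram_monoid "TL_le n k" n k "planar_singular n k" using TL_diagram_monoid[OF kn] .
  have "b = e" if "b \<in> planar_singular n k" "top_arcs b = top_arcs e" "bot_arcs b = bot_arcs e" for b
    using planar_determined_by_arcs[of n b e] that e pm by (simp add: planar_singular_def)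
  then show ?thesis unfolding H_cell_eq[OF e] using e by blast
qed

lemma card_left_cell_TL:
  assumes kn: "k < n" and e: "e \<in> planar_singular n k"
  shows "card (left_cell (TL_le n k) e) \<le> card (half_diagrams n (through_strands e))"
proof -
  interpret diagram_monoid "TL_le n k" n k "planar_singular n k" using TL_diagram_monoid[OF kn] .
  have "inj_on top_arcs (left_cell (TL_le n k) e)"
    unfolding left_cell_eq[OF e]
  proof (rule inj_onI)
    fix a b assume a: "a \<in> {b \<in> planar_singular n k. bot_arcs b = bot_arcs e}"
      and b: "b \<in> {b \<in> planar_singular n k. bot_arcs b = bot_arcs e}" and "top_arcs a = top_arcs b"
    moreover from this have "a \<in> planar_singular n k" "b \<in> planar_singular n k" "bot_arcs a = bot_arcs b" by auto
    moreover from this have "planar n a" "planar n b" by (auto simp: planar_singular_def)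
    ultimately show "a = b" using planar_determined_by_arcs pm by blast
  qed
  moreover have "top_arcs ` left_cell (TL_le n k) e \<subseteq> half_diagrams n (through_strands e)"
  proof (rule image_subsetI)
    fix b assume "b \<in> left_cell (TL_le n k) e"
    then have b: "b \<in> planar_singular n k" "bot_arcs b = bot_arcs e" using left_cell_eq[OF e] by auto
    then have "through_strands b = through_strands e"
      using through_strands_bot_arcs[OF pm[OF b(1)]] through_strands_bot_arcs[OF pm[OF e]] by simp
    then show "top_arcs b \<in> half_diagrams n (through_strands e)"
      using arcs_half_diagrams(1)[OF pm[OF b(1)]] by simp
  qed
  ultimately show ?thesis by (intro card_inj_on_le[OF _ _ finite_half_diagrams])
qed

text \<open>
  A diagram of rank at most one is determined by its arcs, because at most one through strand remains
  to be placed; and the rank is fixed by the parity of \<open>n\<close>. So the product depends only on the top arcs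
  of \<open>a\<close> and the bottom arcs of \<open>b\<close>.
\<close>
lemma rank_le_one_absorbs:
  assumes a: "perfect_matching n a" "through_strands a \<le> 1" and b: "perfect_matching n b" "through_strands b \<le> 1"
    and c: "perfect_matching n c"
  shows "stack a (stack c b) = stack a b"
proof -
  let ?x = "stack a (stack c b)" and ?y = "stack a b"
  have x: "perfect_matching n ?x" and y: "perfect_matching n ?y" using pm_stack a b c by blast+
  have "through_strands ?x \<le> 1" "through_strands ?y \<le> 1"
    using through_strands_stack(1)[OF a(1)] pm_stack[OF c b(1)] b(1) a(2) le_trans by blast+
  then have ts: "through_strands ?x = through_strands a" "through_strands ?y = through_strands a"
    "through_strands b = through_strands a"
  proof -
    have "through_strands z = n mod 2" if "perfect_matching n z" "through_strands z \<le> 1" for z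
      using through_strands_top_arcs[OF that(1)] that(2) by presburger
    note this[OF a] this[OF b] this[OF x] this[OF y]
    then show "through_strands ?x = through_strands a" "through_strands ?y = through_strands a"
      "through_strands b = through_strands a"
      using \<open>through_strands ?x \<le> 1\<close> \<open>through_strands ?y \<le> 1\<close> by simp_all
  qed
  have tx: "top_arcs a = top_arcs ?x" and ty: "top_arcs a = top_arcs ?y"
    using through_strands_antimono(2)[OF a(1) x top_arcs_stack[OF a(1)]]
      through_strands_antimono(2)[OF a(1) y top_arcs_stack[OF a(1)]] ts by auto
  have bx: "bot_arcs b = bot_arcs ?x"
    using bot_arcs_eqI[OF b(1) x] bot_arcs_stack[OF b(1), of "stack a c"] ts by (simp add: stack_assoc)
  have "bot_arcs b = bot_arcs ?y"
    using bot_arcs_eqI[OF b(1) y bot_arcs_stack[OF b(1)]] ts by simp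
  then have bot: "bot_arcs ?x = bot_arcs ?y" using bx by simp
  have "?x \<subseteq> ?y"
  proof
    fix B assume B: "B \<in> ?x"
    obtain p q where pq: "B = {p, q}" using pm_blockE[OF x B] by metis
    have thr: "{Bot i, Top j} \<in> ?y" if ij: "{Bot i, Top j} \<in> ?x" for i j
    proof -
      have "i \<in> free n (bot_arcs ?y)" "j \<in> free n (top_arcs ?y)"
        using ij free_bot_partner[OF x] free_top_partner[OF x] tx ty bot by auto
      then obtain l where l: "{Bot i, Top l} \<in> ?y" using free_bot_partner[OF y] by blast
      then have "l \<in> free n (top_arcs ?y)" using free_top_partner[OF y] by blast
      moreover have "card (free n (top_arcs ?y)) \<le> 1" using through_strands_free[OF y] ts a(2) by simp
      moreover have "finite (free n (top_arcs ?y))" by (simp add: free_def)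
      ultimately have "l = j" using \<open>j \<in> free n (top_arcs ?y)\<close> by (auto simp: card_le_Suc0_iff_eq)
      then show ?thesis using l by simp
    qed
    show "B \<in> ?y"
    proof (cases p; cases q)
      fix i j assume "p = Bot i" "q = Bot j"
      then show ?thesis using B pq bot bot_arcs_iff by metis
    next
      fix i j assume "p = Top i" "q = Top j"
      then show ?thesis using B pq tx ty top_arcs_iff by metis
    next
      fix i j assume "p = Bot i" "q = Top j"
      then show ?thesis using B pq thr by simp
    next
      fix i j assume "p = Top i" "q = Bot j"
      then show ?thesis using B pq thr by (simp add: insert_commute)
    qed
  qed
  then show ?thesis using pm_eqI[OF x y] by simp
qed

section \<open>Sums of trivial representations\<close>

lemma invertible_mat_obtain_inverse:
  fixes P :: "'k :: field mat"
  assumes P: "P \<in> carrier_mat d d" and inv: "invertible_mat P"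
  obtains Q where "Q \<in> carrier_mat d d" "P * Q = 1\<^sub>m d" "Q * P = 1\<^sub>m d"
proof -
  obtain Q where Q: "P * Q = 1\<^sub>m (dim_row P)" "Q * P = 1\<^sub>m (dim_row Q)"
    using inv unfolding invertible_mat_def inverts_mat_def by blast
  have "dim_col Q = d" using arg_cong[OF Q(1), of dim_col] P by simp
  moreover have "dim_row Q = d" using arg_cong[OF Q(2), of dim_col] P by simp
  ultimately show ?thesis using that[of Q] Q P by auto
qed

lemma invertible_mat_cancel:
  fixes P :: "'k :: field mat"
  assumes P: "P \<in> carrier_mat d d" "invertible_mat P" and A: "A \<in> carrier_mat d c" and B: "B \<in> carrier_mat d c"
    and eq: "P * A = P * B"
  shows "A = B"
proof -
  obtain Q where Q: "Q \<in> carrier_mat d d" "Q * P = 1\<^sub>m d" using invertible_mat_obtain_inverse[OF P] by metis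
  have *: "Q * (P * C) = C" if C: "C \<in> carrier_mat d c" for C
    using assoc_mult_mat[OF Q(1) P(1) C] Q(2) left_mult_one_mat[OF C] by simp
  have "A = Q * (P * A)" using *[OF A] by simp
  also have "\<dots> = B" using *[OF B] by (simp only: eq)
  finally show ?thesis .
qed

lemma invertible_one_mat: "invertible_mat (1\<^sub>m d :: 'k :: field mat)"
  unfolding invertible_mat_def inverts_mat_def by (intro conjI exI[of _ "1\<^sub>m d"]) auto

definition trivial_sum :: "('a, 'c) monoid_scheme \<Rightarrow> nat \<Rightarrow> ('a \<Rightarrow> 'k :: field mat) \<Rightarrow> bool" where
  "trivial_sum S d \<rho> \<longleftrightarrow> (\<exists>\<sigma>s. length \<sigma>s = d \<and>
     (\<forall>\<sigma>\<in>set \<sigma>s. is_rep S 1 \<sigma> \<and> (rep_iso S 1 \<sigma> 1 (triv_b S) \<or> rep_iso S 1 \<sigma> 1 (triv_t S))) \<and>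
     rep_iso S d \<rho> d (direct_sum_rep \<sigma>s))"

lemma m_trivial_iff:
  "m_trivial TYPE('k :: field) S m \<longleftrightarrow> (\<forall>d\<le>m. \<forall>\<rho> :: 'a \<Rightarrow> 'k mat. is_rep S d \<rho> \<longrightarrow> trivial_sum S d \<rho>)"
  unfolding m_trivial_def trivial_sum_def ..

lemma m_trivial_mono: "m_trivial K S m \<Longrightarrow> l \<le> m \<Longrightarrow> m_trivial K S l"
  unfolding m_trivial_def by (meson le_trans)

text \<open>
  The common action of the non-units on a sum of trivial representations, with an entry \<open>True\<close> for each
  summand \<open>1\<^sub>t\<close> and \<open>False\<close> for each summand \<open>1\<^sub>b\<close>.
\<close>
definition bit_diag :: "bool list \<Rightarrow> 'k :: field mat" where
  "bit_diag bs = diag_block_mat (map (\<lambda>b. if b then 1\<^sub>m 1 else 0\<^sub>m 1 1) bs)"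

lemma bit_diag_carrier: "(bit_diag bs :: 'k :: field mat) \<in> carrier_mat (length bs) (length bs)"
proof -
  have "sum_list (map (\<lambda>b. dim_row (if b then 1\<^sub>m 1 else 0\<^sub>m 1 1 :: 'k mat)) bs) = length bs"
    "sum_list (map (\<lambda>b. dim_col (if b then 1\<^sub>m 1 else 0\<^sub>m 1 1 :: 'k mat)) bs) = length bs"
    by (induction bs) auto
  then show ?thesis unfolding bit_diag_def by (auto simp: dim_diag_block_mat o_def)
qed

lemma (in diagram_monoid) is_rep_triv: "is_rep S 1 (triv_b S)" "is_rep S 1 (triv_t S)"
proof -
  have prod: "stack a b = id_diagram n \<longleftrightarrow> a = id_diagram n \<and> b = id_diagram n"
    if "a \<in> carrier S" "b \<in> carrier S" for a b
    using that ideal_left[of a b] ideal_right[of a b] id_notin stack_id pm_id carrier by (metis insertE)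
  show "is_rep S 1 (triv_b S)" unfolding is_rep_def triv_b_def Units_eq by (auto simp: prod)
  show "is_rep S 1 (triv_t S)" unfolding is_rep_def triv_t_def by auto
qed

lemma rep_iso_refl:
  assumes "is_rep S d \<rho>" shows "rep_iso S d \<rho> d \<rho>"
  unfolding rep_iso_def
  using assms invertible_one_mat by (auto simp: is_rep_def intro!: bexI[of _ "1\<^sub>m d"])

text \<open>
  Conjugation does not change a scalar.
\<close>
lemma rep_iso_one_dim:
  assumes iso: "rep_iso S 1 \<sigma> 1 \<tau>" and a: "a \<in> carrier S" and \<sigma>: "\<sigma> a \<in> carrier_mat 1 1"
    and \<tau>: "\<tau> a = 1\<^sub>m 1 \<or> \<tau> a = 0\<^sub>m 1 1"
  shows "\<sigma> a = \<tau> a"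
proof -
  obtain P where P: "P \<in> carrier_mat 1 1" "invertible_mat P" "P * \<sigma> a = \<tau> a * P"
    using iso a unfolding rep_iso_def by blast
  have "\<tau> a * P = P * \<tau> a" using \<tau> P(1) by auto
  then show ?thesis using invertible_mat_cancel[OF P(1,2) \<sigma>, of "\<tau> a"] \<tau> P(3) by auto
qed

text \<open>
  This and the next lemma reduce being a sum of trivial representations to a condition on the matrices
  of the non-units that mentions neither the monoid nor its units, so that it can be carried from one
  monoid to the other.
\<close>
lemma (in diagram_monoid) trivial_sum_bits:
  assumes "trivial_sum S d \<rho>"
  obtains bs P where "length bs = d" "P \<in> carrier_mat d d" "invertible_mat P"
    "\<forall>a\<in>N. P * \<rho> a = bit_diag bs * P"
proof -
  obtain \<sigma>s where \<sigma>s: "length \<sigma>s = d"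
    "\<And>\<sigma>. \<sigma> \<in> set \<sigma>s \<Longrightarrow> is_rep S 1 \<sigma> \<and> (rep_iso S 1 \<sigma> 1 (triv_b S) \<or> rep_iso S 1 \<sigma> 1 (triv_t S))"
    and iso: "rep_iso S d \<rho> d (direct_sum_rep \<sigma>s)"
    using assms unfolding trivial_sum_def by blast
  let ?bs = "map (\<lambda>\<sigma>. rep_iso S 1 \<sigma> 1 (triv_t S)) \<sigma>s"
  obtain P where P: "P \<in> carrier_mat d d" "invertible_mat P" "\<And>a. a \<in> carrier S \<Longrightarrow> P * \<rho> a = direct_sum_rep \<sigma>s a * P"
    using iso unfolding rep_iso_def by blast
  have "direct_sum_rep \<sigma>s a = bit_diag ?bs" if a: "a \<in> N" for a
  proof -
    have "\<sigma> a = (if rep_iso S 1 \<sigma> 1 (triv_t S) then 1\<^sub>m 1 else 0\<^sub>m 1 1)" if \<sigma>: "\<sigma> \<in> set \<sigma>s" for \<sigma>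
    proof -
      have "a \<notin> Units S" using a id_notin Units_eq by auto
      then have t: "triv_t S a = 1\<^sub>m 1" "triv_b S a = 0\<^sub>m 1 1" by (simp_all add: triv_t_def triv_b_def)
      have "\<sigma> a \<in> carrier_mat 1 1" using \<sigma>s(2)[OF \<sigma>] N_in_carrier[OF a] by (auto simp: is_rep_def)
      then have "rep_iso S 1 \<sigma> 1 (triv_t S) \<Longrightarrow> \<sigma> a = 1\<^sub>m 1" "rep_iso S 1 \<sigma> 1 (triv_b S) \<Longrightarrow> \<sigma> a = 0\<^sub>m 1 1"
        using rep_iso_one_dim[OF _ N_in_carrier[OF a], of \<sigma>] t by metis+
      then show ?thesis using \<sigma>s(2)[OF \<sigma>] by presburger
    qed
    then have "map (\<lambda>\<sigma>. \<sigma> a) \<sigma>s = map (\<lambda>b. if b then 1\<^sub>m 1 else 0\<^sub>m 1 1) ?bs" by simp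
    then show ?thesis unfolding direct_sum_rep_def bit_diag_def by (rule arg_cong)
  qed
  then show ?thesis using that[of ?bs P] \<sigma>s(1) P N_in_carrier by simp
qed

lemma (in diagram_monoid) bits_trivial_sum:
  assumes \<rho>: "is_rep S d \<rho>" and "length bs = d" and P: "P \<in> carrier_mat d d" "invertible_mat P"
    and eq: "\<And>a. a \<in> N \<Longrightarrow> P * \<rho> a = bit_diag bs * P"
  shows "trivial_sum S d \<rho>"
proof -
  let ?\<sigma>s = "map (\<lambda>b. if b then triv_t S else triv_b S) bs :: (diagram \<Rightarrow> 'a mat) list"
  have "P * \<rho> a = direct_sum_rep ?\<sigma>s a * P" if a: "a \<in> carrier S" for a
  proof (cases "a \<in> N")
    case True
    then have "a \<notin> Units S" using id_notin Units_eq by auto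
    then have "direct_sum_rep ?\<sigma>s a = bit_diag bs"
      unfolding direct_sum_rep_def bit_diag_def
      by (intro arg_cong[where f = diag_block_mat]) (auto simp: triv_b_def triv_t_def)
    then show ?thesis using eq True by simp
  next
    case False
    then have a: "a = id_diagram n" "a \<in> Units S" using that carrier Units_eq by auto
    then have "map (\<lambda>\<sigma>. \<sigma> a) ?\<sigma>s = map (\<lambda>A. 1\<^sub>m (dim_row A)) (map (\<lambda>_. 1\<^sub>m 1 :: 'a mat) bs)"
      by (auto simp: triv_b_def triv_t_def)
    then have "direct_sum_rep ?\<sigma>s a = 1\<^sub>m d"
      unfolding direct_sum_rep_def using \<open>length bs = d\<close>
        diag_block_one_mat[of "map (\<lambda>_. 1\<^sub>m 1 :: 'a mat) bs"]
      by (simp add: sum_list_triv map_replicate_const sum_list_replicate del: map_map)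
    moreover have "\<rho> a = 1\<^sub>m d" using \<rho> a by (simp add: is_rep_def)
    ultimately show ?thesis using P by simp
  qed
  then have "rep_iso S d \<rho> d (direct_sum_rep ?\<sigma>s)" unfolding rep_iso_def using P by blast
  then show ?thesis unfolding trivial_sum_def
    using \<open>length bs = d\<close> is_rep_triv rep_iso_refl[OF is_rep_triv(1)] rep_iso_refl[OF is_rep_triv(2)]
    by (intro exI[of _ ?\<sigma>s]) auto
qed

lemma (in diagram_monoid) trivial_sum_constant:
  assumes \<rho>: "is_rep S d \<rho>" and triv: "trivial_sum S d \<rho>" and a: "a \<in> N" and b: "b \<in> N"
  shows "\<rho> a = \<rho> b"
proof -
  obtain bs P where P: "P \<in> carrier_mat d d" "invertible_mat P" "\<forall>a\<in>N. P * \<rho> a = bit_diag bs * P"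
    using trivial_sum_bits[OF triv] by metis
  then have "P * \<rho> a = P * \<rho> b" using a b by simp
  moreover have "\<rho> a \<in> carrier_mat d d" "\<rho> b \<in> carrier_mat d d"
    using \<rho> a b N_in_carrier by (auto simp: is_rep_def)
  ultimately show ?thesis using invertible_mat_cancel P by blast
qed

section \<open>From planar diagrams to all diagrams\<close>

lemma adjacent_projection_planar:
  assumes "j \<le> n" "j mod 2 = n mod 2" "j \<le> k"
  shows "projection n (adjacent_arcs n j) \<in> planar_singular n k"
    and "through_strands (projection n (adjacent_arcs n j)) = j"
proof -
  note u = partial_matching_adjacent_arcs[of n j]
  have "planar n (projection n (adjacent_arcs n j))"
    by (rule planar_projection[OF u]) (auto simp: adjacent_arcs_def)
  moreover show "through_strands (projection n (adjacent_arcs n j)) = j"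
    using through_strands_projection[OF u] free_adjacent_arcs[OF assms(1,2)] by simp
  ultimately show "projection n (adjacent_arcs n j) \<in> planar_singular n k"
    using pm_projection[OF u] assms(3) by (simp add: planar_singular_def singular_def)
qed

text \<open>
  Multiply a planar diagram of small rank on both sides with the diagram whose only arcs are \<open>{i, i + 1}\<close>
  at the top and at the bottom.
\<close>
lemma exists_planar_with_arc:
  assumes kn: "k < n" "k mod 2 = n mod 2" and i: "Suc i < n"
  obtains c where "c \<in> planar_singular n k" "{i, Suc i} \<in> top_arcs c" "{i, Suc i} \<in> bot_arcs c"
proof -
  let ?u = "{{i, Suc i}}"
  let ?U = "projection n ?u" and ?p = "projection n (adjacent_arcs n k)"
  have u: "partial_matching n ?u" using i by (auto simp: partial_matching_def)
  have U: "perfect_matching n ?U" "planar n ?U"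
    using pm_projection[OF u] planar_projection[OF u] by auto
  have p: "perfect_matching n ?p" "planar n ?p" "through_strands ?p \<le> k"
    using adjacent_projection_planar(1)[of k n k] kn by (auto simp: planar_singular_def singular_def)
  let ?c = "stack (stack ?U ?p) ?U"
  have pm: "perfect_matching n (stack ?U ?p)" "perfect_matching n ?c" using pm_stack U p by auto
  have "planar n ?c" using planar_stack pm U p by simp
  moreover have "through_strands ?c \<le> k"
    using through_strands_stack(1)[OF pm(1) U(1)] through_strands_stack(2)[OF U(1) p(1)] p(3) by linarith
  ultimately have "?c \<in> planar_singular n k" using pm by (simp add: planar_singular_def singular_def)
  moreover have "{i, Suc i} \<in> top_arcs ?c"
    using top_arcs_stack[OF U(1)] top_arcs_stack[OF pm(1)] top_arcs_join[OF u, of ?u id] by blast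
  moreover have "{i, Suc i} \<in> bot_arcs ?c"
    using bot_arcs_stack[OF U(1)] bot_arcs_join[OF u, of ?u id] by blast
  ultimately show ?thesis using that by blast
qed

text \<open>
  Adjacent transpositions generate: the transposition of \<open>a\<close> and \<open>b + 1\<close> is the conjugate of the
  transposition of \<open>a\<close> and \<open>b\<close> by that of \<open>b\<close> and \<open>b + 1\<close>.
\<close>
lemma permutes_adjacent_induct:
  assumes one: "P id" and adj: "\<And>i. Suc i < n \<Longrightarrow> P (transpose i (Suc i))"
    and comp: "\<And>g h. g permutes {..<n} \<Longrightarrow> h permutes {..<n} \<Longrightarrow> P g \<Longrightarrow> P h \<Longrightarrow> P (g \<circ> h)"
    and g: "g permutes {..<n}"
  shows "P g"
proof -
  have perm: "transpose a b permutes {..<n}" if "a < n" "b < n" for a b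
    using that by (intro permutes_swap_id) auto
  have tr: "P (transpose a (Suc a + m))" if "Suc a + m < n" for a m
    using that
  proof (induction m)
    case 0
    then show ?case using adj by simp
  next
    case (Suc m)
    let ?b = "Suc a + m"
    have b: "?b < n" "Suc ?b < n" using Suc by auto
    have eq: "transpose a (Suc ?b) = transpose ?b (Suc ?b) \<circ> transpose a ?b \<circ> transpose ?b (Suc ?b)"
      by (auto simp: fun_eq_iff transpose_def)
    have "P (transpose a ?b)" using Suc by simp
    then have "P (transpose ?b (Suc ?b) \<circ> transpose a ?b)"
      using comp[OF perm perm] adj b by auto
    then have "P (transpose ?b (Suc ?b) \<circ> transpose a ?b \<circ> transpose ?b (Suc ?b))"
      using comp[OF permutes_compose[OF perm perm] perm] adj b by auto
    then have "P (transpose a (Suc ?b))" by (simp only: eq)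
    then show ?case by simp
  qed
  have tr': "P (transpose a b)" if ab: "a < n" "b < n" "a \<noteq> b" for a b
  proof (cases "a < b")
    case True
    then obtain m where "b = Suc a + m" using less_imp_Suc_add by auto
    then show ?thesis using tr ab by blast
  next
    case False
    then obtain m where "a = Suc b + m" using ab less_imp_Suc_add by (metis add_Suc linorder_neqE_nat)
    then show ?thesis using tr[of b m] ab by (simp add: transpose_commute)
  qed
  have "finite {..<n}" by simp
  with g show ?thesis
  proof (induction rule: permutes_induct)
    case id
    show ?case by (rule one)
  next
    case (swap a b p)
    show ?case by (rule comp) (use swap perm tr' in auto)
  qed
qed

text \<open>
  The heart of the comparison of the representation gaps. The conjugates of planar diagrams do not
  cover all diagrams, but they contain all projections. Neighbouring conjugates share a diagram, so the
  values on them agree, and a general diagram is reached by \<open>b = b (b\<^sup>* b)\<close>.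
\<close>
lemma planar_conjugates_constant_imp_constant:
  fixes \<rho> :: "diagram \<Rightarrow> 'm :: times"
  assumes kn: "k < n" "k mod 2 = n mod 2"
    and hom: "\<And>a b. a \<in> singular n k \<Longrightarrow> b \<in> singular n k \<Longrightarrow> \<rho> (stack a b) = \<rho> a * \<rho> b"
    and const: "\<And>g a b. g permutes {..<n} \<Longrightarrow> a \<in> planar_singular n k \<Longrightarrow> b \<in> planar_singular n k \<Longrightarrow>
      \<rho> (relabel g a) = \<rho> (relabel g b)"
    and a: "a \<in> singular n k" and b: "b \<in> planar_singular n k"
  shows "\<rho> a = \<rho> b"
proof -
  interpret diagram_monoid "Br_le n k" n k "singular n k" using Br_diagram_monoid[OF kn(1)] .
  interpret T: diagram_monoid "TL_le n k" n k "planar_singular n k" using TL_diagram_monoid[OF kn(1)] .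
  have pl_sing: "c \<in> singular n k" if "c \<in> planar_singular n k" for c using that by (simp add: planar_singular_def)
  \<comment> \<open>The common value on the planar non-units conjugated by \<open>g\<close>.\<close>
  define E where "E g = \<rho> (relabel g b)" for g
  have E: "\<rho> (relabel g c) = E g" if "g permutes {..<n}" "c \<in> planar_singular n k" for g c
    unfolding E_def using const[OF that b] .
  have step: "E (g \<circ> transpose i (Suc i)) = E g" if g: "g permutes {..<n}" and i: "Suc i < n" for g i
  proof -
    obtain c where c: "c \<in> planar_singular n k" "{i, Suc i} \<in> top_arcs c" "{i, Suc i} \<in> bot_arcs c"
      using exists_planar_with_arc[OF kn i] .
    have s: "transpose i (Suc i) permutes {..<n}" using i by (intro permutes_swap_id) auto
    have "E (g \<circ> transpose i (Suc i)) = \<rho> (relabel (g \<circ> transpose i (Suc i)) c)"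
      using E[OF permutes_compose[OF s g] c(1)] by simp
    also have "relabel (g \<circ> transpose i (Suc i)) c = relabel g c"
      using relabel_transpose_fixed[OF T.pm[OF c(1)] c(2,3)] by (simp add: relabel_comp[symmetric])
    finally show ?thesis by (simp only: E[OF g c(1)])
  qed
  have "\<forall>g. g permutes {..<n} \<longrightarrow> E (g \<circ> h) = E g" if "h permutes {..<n}" for h
  proof (rule permutes_adjacent_induct[OF _ _ _ that])
    fix h h' assume "h permutes {..<n}" "\<forall>g. g permutes {..<n} \<longrightarrow> E (g \<circ> h) = E g"
      "\<forall>g. g permutes {..<n} \<longrightarrow> E (g \<circ> h') = E g"
    then show "\<forall>g. g permutes {..<n} \<longrightarrow> E (g \<circ> (h \<circ> h')) = E g"
      using permutes_compose[of h "{..<n}"] by (simp add: o_assoc)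
  qed (simp, use step in blast)
  then have E_const: "E h = E id" if "h permutes {..<n}" for h
    using that permutes_id[of "{..<n}"] by (metis id_comp)
  have proj: "\<rho> (projection n u) = E id" if u: "partial_matching n u" and s: "projection n u \<in> singular n k" for u
  proof -
    obtain g where g: "g permutes {..<n}" "image g ` u = adjacent_arcs n (card (free n u))"
      using exists_permutation_to_adjacent[OF u] by blast
    let ?j = "card (free n u)" and ?h = "Hilbert_Choice.inv g"
    have "?j \<le> k" using s through_strands_projection[OF u] by (simp add: singular_def)
    moreover have "?j \<le> n" "?j mod 2 = n mod 2" using card_free[OF u] by presburger+
    ultimately have pl: "projection n (adjacent_arcs n ?j) \<in> planar_singular n k"
      using adjacent_projection_planar by blast
    have h: "?h permutes {..<n}" by (rule permutes_inv[OF g(1)])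
    have "relabel ?h (projection n (adjacent_arcs n ?j)) = relabel ?h (relabel g (projection n u))"
      using relabel_projection[OF g(1), of u] g(2) by simp
    also have "\<dots> = projection n u"
      using permutes_inv_o(2)[OF g(1)] by (simp add: relabel_comp)
    finally have "\<rho> (projection n u) = E ?h" using E[OF h pl] by simp
    then show ?thesis using E_const[OF h] by simp
  qed
  have ff: "\<rho> (stack (flip c) c) = E id" if c: "c \<in> singular n k" for c
    using proj[OF partial_matching_bot_arcs[OF pm[OF c]]] N_stack[OF N_flip[OF c] c]
    by (simp add: stack_flip_eq_projection[OF pm[OF c]])
  have E_idem: "E id * E id = E id"
    using hom[OF pl_sing[OF b] pl_sing[OF b]] E[OF permutes_id b] E[OF permutes_id T.N_stack[OF b b]] by simp
  \<comment> \<open>A planar diagram of the smallest possible rank.\<close>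
  let ?c = "projection n (adjacent_arcs n (n mod 2))"
  have "n mod 2 \<le> k" using kn(2) by (metis mod_less_eq_dividend)
  then have c: "?c \<in> planar_singular n k" "through_strands ?c = n mod 2"
    using adjacent_projection_planar[of "n mod 2" n k] by auto
  have \<rho>c: "\<rho> ?c = E id" using E[OF permutes_id c(1)] by simp
  let ?x = "stack a ?c"
  have x: "?x \<in> singular n k" "through_strands ?x \<le> 1"
    using N_stack[OF a pl_sing[OF c(1)]] through_strands_stack(2)[OF pm[OF a] T.pm[OF c(1)]] c(2)
    by auto
  have fx: "stack (flip ?x) ?x \<in> singular n k" "stack ?x (flip ?x) \<in> singular n k"
    using x N_flip N_stack by blast+
  have "stack (stack ?x (flip ?x)) (stack (flip ?x) ?x) = ?x"
  proof -
    have "through_strands (stack (flip ?x) ?x) \<le> 1"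
      using through_strands_stack(2)[OF pm[OF N_flip[OF x(1)]] pm[OF x(1)]] x(2) by simp
    then have "stack ?x (stack (flip ?x) (stack (flip ?x) ?x)) = stack ?x (stack (flip ?x) ?x)"
      using rank_le_one_absorbs[OF pm[OF x(1)] x(2) pm[OF fx(1)]] pm[OF N_flip[OF x(1)]] by blast
    then show ?thesis
      using stack_stack_flip[OF pm[OF x(1)] pm[OF x(1)] order_refl] by (metis stack_assoc)
  qed
  then have "\<rho> ?x = \<rho> (stack ?x (flip ?x)) * \<rho> (stack (flip ?x) ?x)" using hom[OF fx(2,1)] by simp
  also have "\<dots> = E id" using ff[OF x(1)] ff[OF N_flip[OF x(1)]] E_idem by simp
  finally have \<rho>x: "\<rho> ?x = E id" .
  have "a = stack a (stack (flip a) a)" using stack_stack_flip[OF pm[OF a] pm[OF a]] by simp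
  then have "\<rho> a = \<rho> a * \<rho> (stack (flip a) a)" using hom[OF a N_stack[OF N_flip[OF a] a]] by simp
  also have "\<dots> = \<rho> a * \<rho> ?c" using ff[OF a] \<rho>c by simp
  also have "\<dots> = E id" using hom[OF a pl_sing[OF c(1)]] \<rho>x by simp
  finally show ?thesis using E[OF permutes_id b] by simp
qed

lemma is_rep_TL_of_Br: "is_rep (Br_le n k) d \<rho> \<Longrightarrow> is_rep (TL_le n k) d \<rho>"
  using TL_subset_Br[of n k] by (auto simp: is_rep_def)

lemma is_rep_relabel:
  assumes kn: "k < n" and g: "g permutes {..<n}" and \<rho>: "is_rep (Br_le n k) d \<rho>"
  shows "is_rep (Br_le n k) d (\<lambda>a. \<rho> (relabel g a))"
proof -
  have "relabel g a \<in> carrier (Br_le n k)" if "a \<in> carrier (Br_le n k)" for a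
    using that pm_relabel[OF _ g] through_strands_relabel[OF _ g] relabel_id_diagram[OF g]
    by (auto simp: carrier_Br_le singular_def)
  then show ?thesis
    using \<rho> unfolding is_rep_def
    by (simp add: relabel_id_diagram[OF g] stack_relabel[OF permutes_bij[OF g], symmetric])
qed

text \<open>
  The representations obtained by relabelling first are again representations of the Brauer monoid, so
  their restrictions to planar diagrams are sums of trivial ones, which means that the planar non-units
  act by one matrix. This is the input of \<open>planar_conjugates_constant_imp_constant\<close>.
\<close>
lemma m_trivial_Br_of_TL:
  assumes kn: "k < n" "k mod 2 = n mod 2" and m: "m_trivial TYPE('k :: field) (TL_le n k) m"
  shows "m_trivial TYPE('k) (Br_le n k) m"
  unfolding m_trivial_iff
proof (intro allI impI)
  interpret B: diagram_monoid "Br_le n k" n k "singular n k" using Br_diagram_monoid[OF kn(1)] .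
  interpret T: diagram_monoid "TL_le n k" n k "planar_singular n k" using TL_diagram_monoid[OF kn(1)] .
  fix d and \<rho> :: "diagram \<Rightarrow> 'k mat"
  assume "d \<le> m" and \<rho>: "is_rep (Br_le n k) d \<rho>"
  have triv: "trivial_sum (TL_le n k) d \<sigma>" if "is_rep (Br_le n k) d \<sigma>" for \<sigma> :: "diagram \<Rightarrow> 'k mat"
    using m[unfolded m_trivial_iff] \<open>d \<le> m\<close> is_rep_TL_of_Br[OF that] by blast
  let ?c = "projection n (adjacent_arcs n k)"
  have c: "?c \<in> planar_singular n k" using adjacent_projection_planar(1)[of k n k] kn by simp
  have const: "\<rho> a = \<rho> ?c" if a: "a \<in> singular n k" for a
  proof (rule planar_conjugates_constant_imp_constant[OF kn _ _ a c])
    show "\<rho> (stack a b) = \<rho> a * \<rho> b" if "a \<in> singular n k" "b \<in> singular n k" for a b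
      using \<rho> that B.N_in_carrier by (auto simp: is_rep_def)
    show "\<rho> (relabel g a) = \<rho> (relabel g b)"
      if g: "g permutes {..<n}" and "a \<in> planar_singular n k" "b \<in> planar_singular n k" for g a b
    proof -
      note r = is_rep_relabel[OF kn(1) g \<rho>]
      show ?thesis using T.trivial_sum_constant[OF is_rep_TL_of_Br[OF r] triv[OF r]] that by blast
    qed
  qed
  obtain bs P where P: "length bs = d" "P \<in> carrier_mat d d" "invertible_mat P"
    "\<forall>a\<in>planar_singular n k. P * \<rho> a = bit_diag bs * P"
    using T.trivial_sum_bits[OF triv[OF \<rho>]] by metis
  show "trivial_sum (Br_le n k) d \<rho>"
  proof (rule B.bits_trivial_sum[OF \<rho> P(1-3)])
    fix a assume "a \<in> singular n k"
    then show "P * \<rho> a = bit_diag bs * P" using const P(4) c by metis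
  qed
qed

section \<open>Faithful representations\<close>

text \<open>
  The left regular representation; the column of the unit distinguishes the elements.
\<close>
lemma exists_faithful_rep:
  assumes S: "monoid S" and fin: "finite (carrier S)"
  shows "\<exists>d (\<rho> :: 'a \<Rightarrow> 'k :: field mat). faithful_rep S d \<rho>"
proof -
  interpret monoid S by (rule S)
  obtain xs where xs: "set xs = carrier S" "distinct xs" using finite_distinct_list[OF fin] by blast
  define d where "d = length xs"
  define \<rho> :: "'a \<Rightarrow> 'k mat" where
    "\<rho> a = mat d d (\<lambda>(i, j). if xs ! i = a \<otimes>\<^bsub>S\<^esub> xs ! j then 1 else 0)" for a
  have mem: "xs ! i \<in> carrier S" if "i < d" for i using nth_mem[of i xs] that xs(1) by (simp add: d_def)
  have nth_eq: "xs ! i = xs ! j \<longleftrightarrow> i = j" if "i < d" "j < d" for i j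
    using that xs(2) by (simp add: d_def nth_eq_iff_index_eq)
  have index: "\<exists>i<d. xs ! i = x" if "x \<in> carrier S" for x
    using that[folded xs(1)] by (auto simp: in_set_conv_nth d_def)
  have "is_rep S d \<rho>" unfolding is_rep_def
  proof (intro conjI ballI)
    show "\<rho> a \<in> carrier_mat d d" for a by (simp add: \<rho>_def)
    show "\<rho> \<one>\<^bsub>S\<^esub> = 1\<^sub>m d"
      by (rule eq_matI) (auto simp: \<rho>_def mem nth_eq)
    fix a b assume a: "a \<in> carrier S" and b: "b \<in> carrier S"
    show "\<rho> (a \<otimes>\<^bsub>S\<^esub> b) = \<rho> a * \<rho> b"
    proof (rule eq_matI)
      fix i j assume "i < dim_row (\<rho> a * \<rho> b)" "j < dim_col (\<rho> a * \<rho> b)"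
      then have ij: "i < d" "j < d" by (simp_all add: \<rho>_def)
      obtain l where l: "l < d" "xs ! l = b \<otimes>\<^bsub>S\<^esub> xs ! j" using index b mem[OF ij(2)] by blast
      have "(\<rho> a * \<rho> b) $$ (i, j) =
        (\<Sum>m\<in>{0..<d}. (if xs ! i = a \<otimes>\<^bsub>S\<^esub> xs ! m then 1 else 0) * (if xs ! m = b \<otimes>\<^bsub>S\<^esub> xs ! j then 1 else 0))"
        using ij by (simp add: \<rho>_def scalar_prod_def)
      also have "\<dots> = (\<Sum>m\<in>{0..<d}. if m = l then (if xs ! i = a \<otimes>\<^bsub>S\<^esub> xs ! l then 1 else 0) else 0)"
        by (rule sum.cong) (use l nth_eq in \<open>auto simp: l(2)[symmetric]\<close>)
      also have "\<dots> = (if xs ! i = a \<otimes>\<^bsub>S\<^esub> xs ! l then 1 else 0)" using l(1) by simp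
      also have "\<dots> = \<rho> (a \<otimes>\<^bsub>S\<^esub> b) $$ (i, j)"
        using ij l(2) a b mem[OF ij(2)] by (simp add: \<rho>_def m_assoc)
      finally show "\<rho> (a \<otimes>\<^bsub>S\<^esub> b) $$ (i, j) = (\<rho> a * \<rho> b) $$ (i, j)" by simp
    qed (simp_all add: \<rho>_def)
  qed
  moreover have "inj_on \<rho> (carrier S)"
  proof (rule inj_onI)
    fix a b assume a: "a \<in> carrier S" and b: "b \<in> carrier S" and eq: "\<rho> a = \<rho> b"
    obtain i j where i: "i < d" "xs ! i = a" and j: "j < d" "xs ! j = \<one>\<^bsub>S\<^esub>" using index a by blast
    have "\<rho> a $$ (i, j) = 1" using i j a by (simp add: \<rho>_def)
    then have "\<rho> b $$ (i, j) = 1" using eq by simp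
    then show "a = b" using i j b by (simp add: \<rho>_def split: if_splits)
  qed
  ultimately show ?thesis unfolding faithful_rep_def by blast
qed

lemma rep_faith_mono:
  assumes kn: "k < n"
  shows "rep_faith TYPE('k :: field) (TL_le n k) \<le> rep_faith TYPE('k) (Br_le n k)"
proof -
  interpret B: diagram_monoid "Br_le n k" n k "singular n k" using Br_diagram_monoid[OF kn] .
  have "\<exists>d (\<rho> :: diagram \<Rightarrow> 'k mat). faithful_rep (Br_le n k) d \<rho>"
    by (rule exists_faithful_rep[OF B.is_monoid B.finite_carrier])
  then have "\<exists>\<rho> :: diagram \<Rightarrow> 'k mat. faithful_rep (Br_le n k) (rep_faith TYPE('k) (Br_le n k)) \<rho>"
    unfolding rep_faith_def by (rule LeastI_ex)
  then obtain \<rho> :: "diagram \<Rightarrow> 'k mat" where "faithful_rep (Br_le n k) (rep_faith TYPE('k) (Br_le n k)) \<rho>" ..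
  then have "faithful_rep (TL_le n k) (rep_faith TYPE('k) (Br_le n k)) \<rho>"
    using is_rep_TL_of_Br inj_on_subset[OF _ TL_subset_Br] unfolding faithful_rep_def by metis
  then show ?thesis unfolding rep_faith_def[of _ "TL_le n k"] by (intro Least_le) blast
qed

section \<open>The representation gap\<close>

text \<open>
  A sum of trivial representations cannot separate two non-units, but a faithful representation does.
  This bounds the dimensions up to which the monoid can be trivial, so that the maximum in the
  definition of the gap exists.
\<close>
lemma (in diagram_monoid) not_m_trivial:
  assumes "a \<in> N" "b \<in> N" "a \<noteq> b"
  shows "\<exists>d. \<not> m_trivial TYPE('k :: field) S d"
proof -
  obtain d and \<rho> :: "diagram \<Rightarrow> 'k mat" where f: "faithful_rep S d \<rho>"
    using exists_faithful_rep[OF is_monoid finite_carrier] by blast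
  have "\<not> trivial_sum S d \<rho>"
  proof
    assume "trivial_sum S d \<rho>"
    then have "\<rho> a = \<rho> b" using trivial_sum_constant assms f unfolding faithful_rep_def by blast
    then show False using f assms N_in_carrier unfolding faithful_rep_def by (auto dest: inj_onD)
  qed
  then have "\<not> m_trivial TYPE('k) S d" using f unfolding m_trivial_iff faithful_rep_def by blast
  then show ?thesis ..
qed

text \<open>
  The two exceptional monoids are those with at most one non-unit.
\<close>
lemma (in diagram_monoid) exceptional_iff:
  "(carrier S = {\<one>\<^bsub>S\<^esub>} \<or> (\<exists>a. carrier S = {\<one>\<^bsub>S\<^esub>, a} \<and> a \<otimes>\<^bsub>S\<^esub> a = a)) \<longleftrightarrow>
    (\<forall>a\<in>N. \<forall>b\<in>N. a = b)"
proof
  assume "carrier S = {\<one>\<^bsub>S\<^esub>} \<or> (\<exists>a. carrier S = {\<one>\<^bsub>S\<^esub>, a} \<and> a \<otimes>\<^bsub>S\<^esub> a = a)"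
  then obtain c where "carrier S \<subseteq> {id_diagram n, c}" by auto
  then have "a = c" if "a \<in> N" for a using that N_in_carrier[OF that] id_notin by blast
  then show "\<forall>a\<in>N. \<forall>b\<in>N. a = b" by blast
next
  assume *: "\<forall>a\<in>N. \<forall>b\<in>N. a = b"
  show "carrier S = {\<one>\<^bsub>S\<^esub>} \<or> (\<exists>a. carrier S = {\<one>\<^bsub>S\<^esub>, a} \<and> a \<otimes>\<^bsub>S\<^esub> a = a)"
  proof (cases "N = {}")
    case True
    then show ?thesis using carrier by simp
  next
    case False
    then obtain a where a: "a \<in> N" by blast
    then have "N = {a}" using * by blast
    moreover have "stack a a = a" using N_stack[OF a a] * a by blast
    ultimately show ?thesis using carrier by auto
  qed
qed

lemma (in diagram_monoid) rep_gap_eq: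
  "rep_gap TYPE('k :: field) S =
    (if \<forall>a\<in>N. \<forall>b\<in>N. a = b then 0 else GREATEST m. m > 0 \<and> m_trivial TYPE('k) S (m - 1))"
  unfolding rep_gap_def exceptional_iff ..

lemma (in diagram_monoid) rep_gap_greatest:
  assumes "a \<in> N" "b \<in> N" "a \<noteq> b"
  shows "m_trivial TYPE('k :: field) S (rep_gap TYPE('k) S - 1)" "rep_gap TYPE('k) S > 0"
    and "m_trivial TYPE('k) S (m - 1) \<Longrightarrow> m \<le> rep_gap TYPE('k) S"
proof -
  let ?P = "\<lambda>m. m > 0 \<and> m_trivial TYPE('k) S (m - 1)"
  obtain d where d: "\<not> m_trivial TYPE('k) S d" using not_m_trivial[OF assms] by blast
  have bound: "m \<le> d" if "?P m" for m
  proof (rule ccontr)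
    assume "\<not> m \<le> d"
    then have "d \<le> m - 1" by simp
    then show False using m_trivial_mono that d by blast
  qed
  have "trivial_sum S 0 \<rho>" if "is_rep S 0 \<rho>" for \<rho> :: "diagram \<Rightarrow> 'k mat"
  proof (rule bits_trivial_sum[OF that, of "[]" "1\<^sub>m 0"])
    fix a assume "a \<in> N"
    then have "\<rho> a \<in> carrier_mat 0 0" using that N_in_carrier by (auto simp: is_rep_def)
    moreover have "(bit_diag [] :: 'k mat) \<in> carrier_mat 0 0" using bit_diag_carrier[of "[]"] by simp
    ultimately show "1\<^sub>m 0 * \<rho> a = bit_diag [] * 1\<^sub>m 0" by (intro eq_matI) auto
  qed (simp_all add: invertible_one_mat)
  then have P1: "?P 1" by (auto simp: m_trivial_iff)
  have eq: "rep_gap TYPE('k) S = (GREATEST m. ?P m)" unfolding rep_gap_eq using assms by auto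
  have "?P (GREATEST m. ?P m)" by (rule GreatestI_nat[of ?P, OF P1 bound])
  then show "m_trivial TYPE('k) S (rep_gap TYPE('k) S - 1)" "rep_gap TYPE('k) S > 0" unfolding eq by blast+
  show "m \<le> rep_gap TYPE('k) S" if "m_trivial TYPE('k) S (m - 1)"
  proof (cases "m = 0")
    case False
    then show ?thesis unfolding eq using that bound by (intro Greatest_le_nat[of ?P _ d]) auto
  qed simp
qed

lemma rep_gap_mono:
  assumes kn: "k < n" "k mod 2 = n mod 2"
  shows "rep_gap TYPE('k :: field) (TL_le n k) \<le> rep_gap TYPE('k) (Br_le n k)"
proof -
  interpret B: diagram_monoid "Br_le n k" n k "singular n k" using Br_diagram_monoid[OF kn(1)] .
  interpret T: diagram_monoid "TL_le n k" n k "planar_singular n k" using TL_diagram_monoid[OF kn(1)] .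
  show ?thesis
  proof (cases "\<forall>a\<in>planar_singular n k. \<forall>b\<in>planar_singular n k. a = b")
    case True
    then show ?thesis by (simp add: T.rep_gap_eq)
  next
    case False
    then obtain a b where ab: "a \<in> planar_singular n k" "b \<in> planar_singular n k" "a \<noteq> b" by blast
    then have "a \<in> singular n k" "b \<in> singular n k" by (simp_all add: planar_singular_def)
    then show ?thesis
      using B.rep_gap_greatest(3)[of a b] T.rep_gap_greatest(1)[OF ab] m_trivial_Br_of_TL[OF kn] ab(3) by blast
  qed
qed

section \<open>Reduction along an invariant subspace\<close>

abbreviation is_subspace :: "nat \<Rightarrow> 'k :: field vec set \<Rightarrow> bool" where
  "is_subspace d W \<equiv> subspace class_ring W (module_vec TYPE('k) d)"

lemma is_subspace_iff:
  fixes W :: "'k :: field vec set"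
  shows "is_subspace d W \<longleftrightarrow> W \<subseteq> carrier_vec d \<and> 0\<^sub>v d \<in> W \<and>
    (\<forall>v\<in>W. \<forall>w\<in>W. v + w \<in> W) \<and> (\<forall>c. \<forall>v\<in>W. c \<cdot>\<^sub>v v \<in> W)"
proof -
  interpret vec_space "TYPE('k)" d .
  have "submodule class_ring W V \<longleftrightarrow> W \<subseteq> carrier_vec d \<and> 0\<^sub>v d \<in> W \<and>
    (\<forall>v\<in>W. \<forall>w\<in>W. v + w \<in> W) \<and> (\<forall>c. \<forall>v\<in>W. c \<cdot>\<^sub>v v \<in> W)"
    unfolding submodule_def using module_axioms by (auto simp: class_ring_simps module_vec_simps)
  then show ?thesis unfolding subspace_def using vectorspace_axioms by blast
qed

text \<open>
  A basis of \<open>W\<close>, extended to a basis of the whole space, both taken as maximal linearly independent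
  sets.
\<close>
lemma subspace_basis:
  fixes W :: "'k :: field vec set"
  assumes W: "is_subspace d W"
  obtains xs ys where "set xs \<subseteq> W" "set ys \<subseteq> carrier_vec d" "length xs + length ys = d"
    "W = range (\<lambda>c. mat_of_cols d xs *\<^sub>v vec (length xs) c)" "det (mat_of_cols d (xs @ ys)) \<noteq> 0"
proof -
  interpret vec_space "TYPE('k)" d .
  have Wsub: "W \<subseteq> carrier_vec d" using W unfolding is_subspace_iff by blast
  have sub: "submodule class_ring W V" using W unfolding subspace_def by blast
  have li_le: "finite A \<and> card A \<le> d" if "A \<subseteq> carrier_vec d" "lin_indpt A" for A
    using li_le_dim[OF fin_dim _ that(2)] that(1) dim_is_n by auto
  have "lin_indpt {}" by (simp add: lin_dep_def)
  then have "\<exists>A. finite A \<and> maximal A (\<lambda>S. S \<subseteq> W \<and> lin_indpt S)"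
    by (intro maximal_exists[where B = "{}" and N = d]) (use li_le Wsub in auto)
  then obtain X where X: "finite X" "maximal X (\<lambda>S. S \<subseteq> W \<and> lin_indpt S)" by blast
  then have XW: "X \<subseteq> W" "lin_indpt X" by (auto simp: maximal_def)
  have XV: "X \<subseteq> carrier_vec d" using XW Wsub by blast
  have "span X = W"
  proof
    show "span X \<subseteq> W" by (rule span_is_subset[OF XW(1) sub])
    show "W \<subseteq> span X"
    proof
      fix v assume v: "v \<in> W"
      show "v \<in> span X"
      proof (rule ccontr)
        assume nv: "v \<notin> span X"
        then have "v \<notin> X" using in_own_span[of X] XV by auto
        then have "lin_indpt (X \<union> {v})"
          using lin_dep_iff_in_span[of X v] XV XW(2) v Wsub nv by auto
        moreover have "X \<union> {v} \<subseteq> W" using XW v by auto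
        ultimately show False using X(2) \<open>v \<notin> X\<close> unfolding maximal_def by blast
      qed
    qed
  qed
  have "\<exists>A. finite A \<and> maximal A (\<lambda>S. X \<subseteq> S \<and> S \<subseteq> carrier_vec d \<and> lin_indpt S)"
    by (rule maximal_exists[where B = X and N = d]) (use li_le XV XW in auto)
  then obtain Z where Z: "finite Z" "maximal Z (\<lambda>S. X \<subseteq> S \<and> S \<subseteq> carrier_vec d \<and> lin_indpt S)" by blast
  then have XZ: "X \<subseteq> Z" "Z \<subseteq> carrier_vec d" "lin_indpt Z" by (auto simp: maximal_def)
  have "maximal Z (\<lambda>S. S \<subseteq> carrier_vec d \<and> lin_indpt S)"
    using Z(2)[unfolded maximal_def] XZ unfolding maximal_def by (metis subset_trans)
  then have "basis Z" by (rule max_li_is_basis)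
  then have card: "card Z = d" using dim_basis[OF Z(1)] dim_is_n by simp
  obtain xs where xs: "set xs = X" "distinct xs" using finite_distinct_list[OF X(1)] by blast
  obtain ys where ys: "set ys = Z - X" "distinct ys" using finite_distinct_list[of "Z - X"] Z(1) by blast
  let ?zs = "xs @ ys"
  have zs: "set ?zs = Z" "distinct ?zs" using xs ys XZ by auto
  then have len: "length ?zs = d" using card distinct_card by fastforce
  have cols: "cols (mat_of_cols d ?zs) = ?zs" using zs XZ by (intro cols_mat_of_cols) auto
  have "rank (mat_of_cols d ?zs) = d"
    by (rule lin_indpt_full_rank) (use len cols zs XZ in auto)
  then have "det (mat_of_cols d ?zs) \<noteq> 0"
    using det_rank_iff mat_of_cols_carrier(1)[of d ?zs] unfolding len by blast
  moreover have "W = range (\<lambda>c. mat_of_cols d xs *\<^sub>v vec (length xs) c)"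
  proof -
    have dims: "\<forall>w\<in>set xs. dim_vec w = d" using xs(1) XV by auto
    have "W = span_list xs" using span_list_as_span[of xs] xs(1) XV \<open>span X = W\<close> by simp
    also have "\<dots> = range (\<lambda>c. lincomb_list c xs)" by (auto simp: span_list_def class_ring_simps)
    finally show ?thesis using lincomb_list_as_mat_mult[OF dims] by simp
  qed
  ultimately show ?thesis using that[of xs ys] xs ys XW XZ len by auto
qed

lemma subspace_coordinates:
  fixes W :: "'k :: field vec set"
  assumes W: "is_subspace d W"
  obtains A B r where "A \<in> carrier_mat d d" "B \<in> carrier_mat d d" "A * B = 1\<^sub>m d" "B * A = 1\<^sub>m d" "r \<le> d"
    "\<forall>v\<in>carrier_vec d. v \<in> W \<longleftrightarrow> (\<forall>i. r \<le> i \<longrightarrow> i < d \<longrightarrow> (A *\<^sub>v v) $ i = 0)"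
proof -
  obtain xs ys where xs: "set xs \<subseteq> W" and ys: "set ys \<subseteq> carrier_vec d" and len: "length xs + length ys = d"
    and span: "W = range (\<lambda>c. mat_of_cols d xs *\<^sub>v vec (length xs) c)" and det: "det (mat_of_cols d (xs @ ys)) \<noteq> 0"
    using subspace_basis[OF W] by metis
  have Wsub: "W \<subseteq> carrier_vec d" using W unfolding is_subspace_iff by blast
  let ?r = "length xs" and ?B = "mat_of_cols d (xs @ ys)"
  have B: "?B \<in> carrier_mat d d" using len by auto
  from det_non_zero_imp_unit[OF B det, unfolded Units_def, of "()"]
  obtain A where A: "A \<in> carrier_mat d d" "A * ?B = 1\<^sub>m d" "?B * A = 1\<^sub>m d"
    by (auto simp: ring_mat_def)
  have restrict: "?B *\<^sub>v c = mat_of_cols d xs *\<^sub>v vec ?r (\<lambda>i. c $ i)"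
    if c: "c \<in> carrier_vec d" "\<forall>i. ?r \<le> i \<longrightarrow> i < d \<longrightarrow> c $ i = 0" for c
  proof (rule eq_vecI)
      fix k assume "k < dim_vec (mat_of_cols d xs *\<^sub>v vec ?r (\<lambda>i. c $ i))"
      then have k: "k < d" by simp
      have "(mat_of_cols d (xs @ ys) *\<^sub>v c) $ k = (\<Sum>i\<in>{0..<d}. (xs @ ys) ! i $ k * c $ i)"
        using k c len by (simp add: scalar_prod_def mat_of_cols_index)
      also have "\<dots> = (\<Sum>i\<in>{0..<?r}. (xs @ ys) ! i $ k * c $ i)"
        by (rule sum.mono_neutral_right) (use c len in auto)
      also have "\<dots> = (\<Sum>i\<in>{0..<?r}. xs ! i $ k * c $ i)"
        by (rule sum.cong) (auto simp: nth_append)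
      also have "\<dots> = (mat_of_cols d xs *\<^sub>v vec ?r (\<lambda>i. c $ i)) $ k"
        using k by (simp add: scalar_prod_def mat_of_cols_index)
      finally show "(mat_of_cols d (xs @ ys) *\<^sub>v c) $ k = (mat_of_cols d xs *\<^sub>v vec ?r (\<lambda>i. c $ i)) $ k" .
    qed simp
  have "v \<in> W \<longleftrightarrow> (\<forall>i. ?r \<le> i \<longrightarrow> i < d \<longrightarrow> (A *\<^sub>v v) $ i = 0)" if v: "v \<in> carrier_vec d" for v
  proof
    assume "v \<in> W"
    then obtain c where c: "v = mat_of_cols d xs *\<^sub>v vec ?r c" using span by auto
    define c' where "c' = vec d (\<lambda>i. if i < ?r then c i else 0)"
    have c': "c' \<in> carrier_vec d" "\<forall>i. ?r \<le> i \<longrightarrow> i < d \<longrightarrow> c' $ i = 0" by (simp_all add: c'_def)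
    have "vec ?r (\<lambda>i. c' $ i) = vec ?r c" using len by (auto simp: c'_def)
    then have "v = ?B *\<^sub>v c'" using restrict[OF c'] c by simp
    then have "A *\<^sub>v v = (A * ?B) *\<^sub>v c'" using assoc_mult_mat_vec[OF A(1) B c'(1)] by simp
    then show "\<forall>i. ?r \<le> i \<longrightarrow> i < d \<longrightarrow> (A *\<^sub>v v) $ i = 0" using A(2) c' by simp
  next
    assume *: "\<forall>i. ?r \<le> i \<longrightarrow> i < d \<longrightarrow> (A *\<^sub>v v) $ i = 0"
    have Av: "A *\<^sub>v v \<in> carrier_vec d" using A(1) v by auto
    have "v = (?B * A) *\<^sub>v v" using A(3) v by simp
    also have "\<dots> = ?B *\<^sub>v (A *\<^sub>v v)" by (rule assoc_mult_mat_vec[OF B A(1) v])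
    also have "\<dots> = mat_of_cols d xs *\<^sub>v vec ?r (\<lambda>i. (A *\<^sub>v v) $ i)" by (rule restrict[OF Av *])
    finally show "v \<in> W" using span by blast
  qed
  then show ?thesis using that[of A ?B ?r] A B len by auto
qed

lemma mult_mat_index_sum:
  fixes X Y :: "'k :: semiring_0 mat"
  assumes "X \<in> carrier_mat a b" "Y \<in> carrier_mat b c" "i < a" "j < c"
  shows "(X * Y) $$ (i, j) = (\<Sum>l\<in>{0..<b}. X $$ (i, l) * Y $$ (l, j))"
  using assms by (auto simp: scalar_prod_def)

text \<open>
  In coordinates adapted to the invariant subspace \<open>W\<close> all matrices become block triangular, and the
  two diagonal blocks are the representations on \<open>W\<close> and on the quotient by \<open>W\<close>. An idempotent whose
  diagonal blocks both vanish is nilpotent, hence zero; so one of the blocks is nonzero at \<open>p\<close>.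
\<close>
lemma rep_block_reduction:
  fixes \<rho> :: "'a \<Rightarrow> 'k :: field mat"
  assumes \<rho>: "is_rep S d \<rho>" and p: "p \<in> carrier S" "p \<otimes>\<^bsub>S\<^esub> p = p" "\<rho> p \<noteq> 0\<^sub>m d d"
    and Z: "\<And>a. a \<in> Z \<Longrightarrow> a \<in> carrier S \<and> \<rho> a = 0\<^sub>m d d"
    and closed: "\<And>a b. a \<in> carrier S \<Longrightarrow> b \<in> carrier S \<Longrightarrow> a \<otimes>\<^bsub>S\<^esub> b \<in> carrier S" and one: "\<one>\<^bsub>S\<^esub> \<in> carrier S"
    and W: "is_subspace d W" "\<And>a v. a \<in> carrier S \<Longrightarrow> v \<in> W \<Longrightarrow> \<rho> a *\<^sub>v v \<in> W"
    and nontriv: "W \<noteq> {0\<^sub>v d}" "W \<noteq> carrier_vec d"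
  shows "\<exists>d' < d. \<exists>\<sigma> :: 'a \<Rightarrow> 'k mat. is_rep S d' \<sigma> \<and> \<sigma> p \<noteq> 0\<^sub>m d' d' \<and> (\<forall>a\<in>Z. \<sigma> a = 0\<^sub>m d' d')"
proof -
  obtain A B r where A: "A \<in> carrier_mat d d" and B: "B \<in> carrier_mat d d"
    and AB: "A * B = 1\<^sub>m d" "B * A = 1\<^sub>m d" and r: "r \<le> d"
    and mem: "\<forall>v\<in>carrier_vec d. v \<in> W \<longleftrightarrow> (\<forall>i. r \<le> i \<longrightarrow> i < d \<longrightarrow> (A *\<^sub>v v) $ i = 0)"
    using subspace_coordinates[OF W(1)] by metis
  have Wsub: "W \<subseteq> carrier_vec d" and W0: "0\<^sub>v d \<in> W" using W(1) unfolding is_subspace_iff by blast+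
  have \<rho>c: "\<rho> a \<in> carrier_mat d d" if "a \<in> carrier S" for a using \<rho> that by (auto simp: is_rep_def)
  have "r < d"
  proof (rule ccontr)
    assume "\<not> r < d"
    then have "v \<in> W" if "v \<in> carrier_vec d" for v using mem that by auto
    then show False using nontriv(2) Wsub by blast
  qed
  have "r > 0"
  proof (rule ccontr)
    assume "\<not> r > 0"
    then have "v = 0\<^sub>v d" if v: "v \<in> W" for v
    proof -
      have vc: "v \<in> carrier_vec d" using v Wsub by blast
      have "\<forall>i<d. (A *\<^sub>v v) $ i = 0" using mem v vc \<open>\<not> r > 0\<close> by auto
      then have "A *\<^sub>v v = 0\<^sub>v d" using A by (intro eq_vecI) auto
      then have "B *\<^sub>v (A *\<^sub>v v) = 0\<^sub>v d" using B by (intro eq_vecI) auto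
      then show ?thesis using assoc_mult_mat_vec[OF B A vc] AB(2) vc by simp
    qed
    then show False using nontriv(1) W0 by blast
  qed
  \<comment> \<open>The action in the adapted coordinates.\<close>
  define T where "T a = A * \<rho> a * B" for a
  have Tc: "T a \<in> carrier_mat d d" if "a \<in> carrier S" for a using A B \<rho>c[OF that] by (simp add: T_def)
  have T_mult: "T (a \<otimes>\<^bsub>S\<^esub> b) = T a * T b" if a: "a \<in> carrier S" and b: "b \<in> carrier S" for a b
  proof -
    have "T a * T b = A * \<rho> a * B * (A * (\<rho> b * B))"
      unfolding T_def using assoc_mult_mat[OF A \<rho>c[OF b] B] by simp
    also have "\<dots> = A * \<rho> a * (B * (A * (\<rho> b * B)))"
      by (rule assoc_mult_mat[OF mult_carrier_mat[OF A \<rho>c[OF a]] B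
            mult_carrier_mat[OF A mult_carrier_mat[OF \<rho>c[OF b] B]]])
    also have "B * (A * (\<rho> b * B)) = B * A * (\<rho> b * B)"
      by (rule assoc_mult_mat[symmetric, OF B A mult_carrier_mat[OF \<rho>c[OF b] B]])
    also have "\<dots> = \<rho> b * B" using AB(2) \<rho>c[OF b] B by simp
    also have "A * \<rho> a * (\<rho> b * B) = A * \<rho> a * \<rho> b * B"
      by (rule assoc_mult_mat[symmetric, OF mult_carrier_mat[OF A \<rho>c[OF a]] \<rho>c[OF b] B])
    also have "A * \<rho> a * \<rho> b = A * (\<rho> a * \<rho> b)"
      by (rule assoc_mult_mat[OF A \<rho>c[OF a] \<rho>c[OF b]])
    also have "\<rho> a * \<rho> b = \<rho> (a \<otimes>\<^bsub>S\<^esub> b)" using \<rho> a b by (simp add: is_rep_def)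
    finally show ?thesis by (simp add: T_def)
  qed
  have T_one: "T \<one>\<^bsub>S\<^esub> = 1\<^sub>m d" using \<rho> A AB(1) by (simp add: T_def is_rep_def)
  have T_zero: "T a = 0\<^sub>m d d" if "\<rho> a = 0\<^sub>m d d" for a using that A B by (simp add: T_def)
  have block: "T a $$ (i, j) = 0" if a: "a \<in> carrier S" and ij: "r \<le> i" "i < d" "j < r" for a i j
  proof -
    have u: "unit_vec d j \<in> carrier_vec d" by simp
    let ?w = "B *\<^sub>v unit_vec d j"
    have w: "?w \<in> carrier_vec d" using B by simp
    have "A *\<^sub>v ?w = unit_vec d j" using assoc_mult_mat_vec[OF A B u] AB(1) by simp
    then have "?w \<in> W" using mem w ij r by auto
    then have "\<rho> a *\<^sub>v ?w \<in> W" using W(2) a by blast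
    then have "(A *\<^sub>v (\<rho> a *\<^sub>v ?w)) $ i = 0" using mem \<rho>c[OF a] w ij by auto
    moreover have "A *\<^sub>v (\<rho> a *\<^sub>v ?w) = T a *\<^sub>v unit_vec d j"
      using assoc_mult_mat_vec[OF A \<rho>c[OF a] w] assoc_mult_mat_vec[of "A * \<rho> a" d d B d "unit_vec d j"] A B \<rho>c[OF a]
      by (simp add: T_def)
    moreover have "(T a *\<^sub>v unit_vec d j) $ i = T a $$ (i, j)"
      using Tc[OF a] ij r by (simp add: scalar_prod_right_unit)
    ultimately show ?thesis by simp
  qed
  have T_sum: "T (a \<otimes>\<^bsub>S\<^esub> b) $$ (i, j) = (\<Sum>l\<in>{0..<d}. T a $$ (i, l) * T b $$ (l, j))"
    if "a \<in> carrier S" "b \<in> carrier S" "i < d" "j < d" for a b i j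
    unfolding T_mult[OF that(1,2)] using mult_mat_index_sum[OF Tc[OF that(1)] Tc[OF that(2)] that(3,4)] .
  define s where "s = d - r"
  have d: "d = r + s" "s < d" using \<open>r < d\<close> \<open>r > 0\<close> by (auto simp: s_def)
  define \<sigma>1 where "\<sigma>1 a = mat r r (\<lambda>(i, j). T a $$ (i, j))" for a
  define \<sigma>2 where "\<sigma>2 a = mat s s (\<lambda>(i, j). T a $$ (r + i, r + j))" for a
  have rep1: "is_rep S r \<sigma>1" unfolding is_rep_def
  proof (intro conjI ballI)
    show "\<sigma>1 a \<in> carrier_mat r r" for a by (simp add: \<sigma>1_def)
    show "\<sigma>1 \<one>\<^bsub>S\<^esub> = 1\<^sub>m r" unfolding \<sigma>1_def T_one by (rule eq_matI) (use r in auto)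
    fix a b assume a: "a \<in> carrier S" and b: "b \<in> carrier S"
    show "\<sigma>1 (a \<otimes>\<^bsub>S\<^esub> b) = \<sigma>1 a * \<sigma>1 b"
    proof (rule eq_matI)
      fix i j assume "i < dim_row (\<sigma>1 a * \<sigma>1 b)" "j < dim_col (\<sigma>1 a * \<sigma>1 b)"
      then have ij: "i < r" "j < r" by (simp_all add: \<sigma>1_def)
      have "T (a \<otimes>\<^bsub>S\<^esub> b) $$ (i, j) = (\<Sum>l\<in>{0..<r}. T a $$ (i, l) * T b $$ (l, j))"
        unfolding T_sum[OF a b order_less_le_trans[OF ij(1) r] order_less_le_trans[OF ij(2) r]]
        by (rule sum.mono_neutral_right) (use block[OF b] ij r in auto)
      then show "\<sigma>1 (a \<otimes>\<^bsub>S\<^esub> b) $$ (i, j) = (\<sigma>1 a * \<sigma>1 b) $$ (i, j)"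
        using ij by (simp add: \<sigma>1_def scalar_prod_def)
    qed (simp_all add: \<sigma>1_def)
  qed
  have rep2: "is_rep S s \<sigma>2" unfolding is_rep_def
  proof (intro conjI ballI)
    show "\<sigma>2 a \<in> carrier_mat s s" for a by (simp add: \<sigma>2_def)
    show "\<sigma>2 \<one>\<^bsub>S\<^esub> = 1\<^sub>m s" unfolding \<sigma>2_def T_one by (rule eq_matI) (use d in auto)
    fix a b assume a: "a \<in> carrier S" and b: "b \<in> carrier S"
    show "\<sigma>2 (a \<otimes>\<^bsub>S\<^esub> b) = \<sigma>2 a * \<sigma>2 b"
    proof (rule eq_matI)
      fix i j assume "i < dim_row (\<sigma>2 a * \<sigma>2 b)" "j < dim_col (\<sigma>2 a * \<sigma>2 b)"
      then have ij: "i < s" "j < s" by (simp_all add: \<sigma>2_def)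
      then have ij': "r + i < d" "r + j < d" using d by auto
      have "T (a \<otimes>\<^bsub>S\<^esub> b) $$ (r + i, r + j) = (\<Sum>l\<in>{r..<d}. T a $$ (r + i, l) * T b $$ (l, r + j))"
        unfolding T_sum[OF a b ij']
        by (rule sum.mono_neutral_right) (use block[OF a] ij' in auto)
      also have "\<dots> = (\<Sum>l\<in>{0..<s}. T a $$ (r + i, r + l) * T b $$ (r + l, r + j))"
        using sum.shift_bounds_nat_ivl[of "\<lambda>l. T a $$ (r + i, l) * T b $$ (l, r + j)" 0 r s] d
        by (simp add: add.commute)
      finally show "\<sigma>2 (a \<otimes>\<^bsub>S\<^esub> b) $$ (i, j) = (\<sigma>2 a * \<sigma>2 b) $$ (i, j)"
        using ij by (simp add: \<sigma>2_def scalar_prod_def)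
    qed (simp_all add: \<sigma>2_def)
  qed
  have zero1: "\<sigma>1 a = 0\<^sub>m r r" and zero2: "\<sigma>2 a = 0\<^sub>m s s" if "a \<in> Z" for a
    using T_zero Z[OF that] r d by (auto simp: \<sigma>1_def \<sigma>2_def intro!: eq_matI)
  have "\<sigma>1 p \<noteq> 0\<^sub>m r r \<or> \<sigma>2 p \<noteq> 0\<^sub>m s s"
  proof (rule ccontr)
    assume "\<not> ?thesis"
    then have s1: "\<sigma>1 p = 0\<^sub>m r r" and s2: "\<sigma>2 p = 0\<^sub>m s s" by auto
    have z1: "T p $$ (i, j) = 0" if "i < r" "j < r" for i j
      using arg_cong[OF s1, of "\<lambda>X. X $$ (i, j)"] that by (simp add: \<sigma>1_def)
    have z2: "T p $$ (i, j) = 0" if "r \<le> i" "i < d" "r \<le> j" "j < d" for i j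
      using arg_cong[OF s2, of "\<lambda>X. X $$ (i - r, j - r)"] that by (simp add: \<sigma>2_def s_def)
    have "T p $$ (i, j) = 0" if ij: "i < d" "j < d" for i j
    proof -
      have "T p $$ (i, j) = T (p \<otimes>\<^bsub>S\<^esub> p) $$ (i, j)" using p(2) by simp
      also have "\<dots> = (\<Sum>l\<in>{0..<d}. T p $$ (i, l) * T p $$ (l, j))" by (rule T_sum[OF p(1) p(1) ij])
      also have "\<dots> = 0"
      proof (rule sum.neutral, intro ballI)
        fix l assume "l \<in> {0..<d}"
        then have l: "l < d" by simp
        show "T p $$ (i, l) * T p $$ (l, j) = 0"
        proof (cases "l < r")
          case True
          then have "T p $$ (i, l) = 0" using z1[of i l] block[OF p(1), of i l] ij by (cases "i < r") simp_all
          then show ?thesis by simp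
        next
          case False
          then have "T p $$ (l, j) = 0" using z2[of l j] block[OF p(1), of l j] l ij by (cases "j < r") simp_all
          then show ?thesis by simp
        qed
      qed
      finally show ?thesis .
    qed
    then have "T p = 0\<^sub>m d d" using Tc[OF p(1)] by (intro eq_matI) auto
    moreover have "B * T p * A = \<rho> p"
    proof -
      have "B * T p * A = B * (A * (\<rho> p * B)) * A"
        unfolding T_def using assoc_mult_mat[OF A \<rho>c[OF p(1)] B] by simp
      also have "B * (A * (\<rho> p * B)) = B * A * (\<rho> p * B)"
        by (rule assoc_mult_mat[symmetric, OF B A mult_carrier_mat[OF \<rho>c[OF p(1)] B]])
      also have "\<dots> = \<rho> p * B" using AB(2) \<rho>c[OF p(1)] B by simp
      also have "\<rho> p * B * A = \<rho> p * (B * A)" by (rule assoc_mult_mat[OF \<rho>c[OF p(1)] B A])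
      finally show ?thesis using AB(2) \<rho>c[OF p(1)] by simp
    qed
    ultimately show False using p(3) A B by simp
  qed
  then show ?thesis
  proof
    assume "\<sigma>1 p \<noteq> 0\<^sub>m r r"
    then show ?thesis using \<open>r < d\<close> rep1 zero1 by (intro exI[of _ r] conjI exI[of _ \<sigma>1]) auto
  next
    assume "\<sigma>2 p \<noteq> 0\<^sub>m s s"
    then show ?thesis using d(2) rep2 zero2 by (intro exI[of _ s] conjI exI[of _ \<sigma>2]) auto
  qed
qed

text \<open>
  A representation of minimal dimension with the required zeros and with \<open>p\<close> acting nontrivially has no
  proper invariant subspace, as it could be reduced otherwise. Working with a single idempotent avoids
  composition series.
\<close>
lemma exists_simple_rep_with_support:
  fixes \<rho> :: "'a \<Rightarrow> 'k :: field mat"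
  assumes S: "monoid S" and p: "p \<in> carrier S" "p \<otimes>\<^bsub>S\<^esub> p = p" and Z: "Z \<subseteq> carrier S"
    and \<rho>: "is_rep S d \<rho>" "\<rho> p \<noteq> 0\<^sub>m d d" "\<And>a. a \<in> Z \<Longrightarrow> \<rho> a = 0\<^sub>m d d"
  shows "\<exists>d' (\<sigma> :: 'a \<Rightarrow> 'k mat). simple_rep S d' \<sigma> \<and> \<sigma> p \<noteq> 0\<^sub>m d' d' \<and> (\<forall>a\<in>Z. \<sigma> a = 0\<^sub>m d' d')"
  using \<rho>
proof (induction d arbitrary: \<rho> rule: less_induct)
  case (less d)
  interpret monoid S by (rule S)
  show ?case
  proof (cases "simple_rep S d \<rho>")
    case True
    then show ?thesis using less by blast
  next
    case False
    have "d > 0"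
    proof (rule ccontr)
      assume "\<not> d > 0"
      moreover have "\<rho> p \<in> carrier_mat d d" using less p by (auto simp: is_rep_def)
      ultimately have "\<rho> p = 0\<^sub>m d d" by (intro eq_matI) auto
      then show False using less by blast
    qed
    then obtain W where W: "is_subspace d W" "\<forall>a\<in>carrier S. \<forall>v\<in>W. \<rho> a *\<^sub>v v \<in> W"
      "W \<noteq> {0\<^sub>v d}" "W \<noteq> carrier_vec d"
      using False less(2) unfolding simple_rep_def by blast
    have "\<exists>d'<d. \<exists>\<sigma> :: 'a \<Rightarrow> 'k mat. is_rep S d' \<sigma> \<and> \<sigma> p \<noteq> 0\<^sub>m d' d' \<and> (\<forall>a\<in>Z. \<sigma> a = 0\<^sub>m d' d')"
      by (rule rep_block_reduction[OF less(2) p less(3) _ _ _ W(1) _ W(3,4)]) (use Z less W(2) in auto)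
    then show ?thesis using less(1) by blast
  qed
qed

section \<open>Simple representations and their apex\<close>

lemma mult_mat_zero_vec: "(X :: 'k :: field mat) \<in> carrier_mat a b \<Longrightarrow> X *\<^sub>v 0\<^sub>v b = 0\<^sub>v a"
  by (intro eq_vecI) auto

lemma zero_mat_mult_vec: "v \<in> carrier_vec b \<Longrightarrow> 0\<^sub>m a b *\<^sub>v v = (0\<^sub>v a :: 'k :: field vec)"
  by (intro eq_vecI) auto

lemma is_subspace_common_kernel:
  fixes X :: "'i \<Rightarrow> 'k :: field mat"
  assumes "\<And>i. i \<in> I \<Longrightarrow> X i \<in> carrier_mat d d"
  shows "is_subspace d {v \<in> carrier_vec d. \<forall>i\<in>I. X i *\<^sub>v v = 0\<^sub>v d}"
  unfolding is_subspace_iff using assms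
  by (auto simp: mult_add_distrib_mat_vec[of _ d d] mult_mat_vec[of _ d d] mult_mat_zero_vec)

lemma is_subspace_common_fixed:
  fixes X :: "'i \<Rightarrow> 'k :: field mat"
  assumes "\<And>i. i \<in> I \<Longrightarrow> X i \<in> carrier_mat d d"
  shows "is_subspace d {v \<in> carrier_vec d. \<forall>i\<in>I. X i *\<^sub>v v = v}"
  unfolding is_subspace_iff using assms
  by (auto simp: mult_add_distrib_mat_vec[of _ d d] mult_mat_vec[of _ d d] mult_mat_zero_vec)

text \<open>
  If all elements act by scalars, every subspace is invariant.
\<close>
lemma simple_rep_scalar_dim_one:
  fixes L :: "'a \<Rightarrow> 'k :: field mat"
  assumes L: "simple_rep S d L" and scal: "\<And>a. a \<in> carrier S \<Longrightarrow> L a = 1\<^sub>m d \<or> L a = 0\<^sub>m d d"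
  shows "d = 1"
proof (rule ccontr)
  assume "d \<noteq> 1"
  moreover have "d > 0" using L by (simp add: simple_rep_def)
  ultimately have d: "0 < d" "1 < d" by auto
  let ?W = "{v \<in> carrier_vec d :: 'k vec set. \<forall>i. 0 < i \<longrightarrow> i < d \<longrightarrow> v $ i = 0}"
  have "is_subspace d ?W" unfolding is_subspace_iff by auto
  moreover have "\<forall>a\<in>carrier S. \<forall>v\<in>?W. L a *\<^sub>v v \<in> ?W"
  proof (intro ballI)
    fix a v assume "a \<in> carrier S" and v: "v \<in> ?W"
    then consider "L a = 1\<^sub>m d" | "L a = 0\<^sub>m d d" using scal by blast
    then show "L a *\<^sub>v v \<in> ?W" using v by cases (auto simp: zero_mat_mult_vec)
  qed
  ultimately have "?W = {0\<^sub>v d} \<or> ?W = carrier_vec d" using L unfolding simple_rep_def by blast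
  then show False
  proof
    assume "?W = {0\<^sub>v d}"
    moreover have "unit_vec d 0 \<in> ?W" using d by auto
    ultimately have "unit_vec d 0 = (0\<^sub>v d :: 'k vec)" by blast
    then have "unit_vec d 0 $ 0 = (0\<^sub>v d :: 'k vec) $ 0" by simp
    then show False using d by simp
  next
    assume "?W = carrier_vec d"
    then have "unit_vec d 1 \<in> ?W" using unit_vec_carrier by blast
    then show False using d by auto
  qed
qed

lemma simple_rep_one_dim:
  fixes \<rho> :: "'a \<Rightarrow> 'k :: field mat"
  assumes "is_rep S 1 \<rho>"
  shows "simple_rep S 1 \<rho>"
  unfolding simple_rep_def
proof (intro conjI allI impI)
  fix W :: "'k vec set" assume "is_subspace 1 W \<and> (\<forall>a\<in>carrier S. \<forall>v\<in>W. \<rho> a *\<^sub>v v \<in> W)"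
  then have W: "W \<subseteq> carrier_vec 1" "0\<^sub>v 1 \<in> W" "\<And>c v. v \<in> W \<Longrightarrow> c \<cdot>\<^sub>v v \<in> W"
    unfolding is_subspace_iff by blast+
  show "W = {0\<^sub>v 1} \<or> W = carrier_vec 1"
  proof (cases "W = {0\<^sub>v 1}")
    case False
    then obtain v where v: "v \<in> W" "v \<noteq> 0\<^sub>v 1" using W(2) by blast
    then have vc: "v \<in> carrier_vec 1" using W(1) by blast
    have "v $ 0 \<noteq> 0"
    proof
      assume "v $ 0 = 0"
      then have "v = 0\<^sub>v 1" using vc by (intro eq_vecI) auto
      then show False using v by blast
    qed
    have "w \<in> W" if w: "w \<in> carrier_vec 1" for w
    proof -
      have "w = (w $ 0 / v $ 0) \<cdot>\<^sub>v v" using w vc \<open>v $ 0 \<noteq> 0\<close> by (intro eq_vecI) auto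
      then show ?thesis using W(3)[OF v(1)] by metis
    qed
    then show ?thesis using W(1) by blast
  qed simp
qed (use assms in auto)

lemma mat_eq_zeroI:
  fixes X :: "'k :: field mat"
  assumes "X \<in> carrier_mat d d" "\<And>v. v \<in> carrier_vec d \<Longrightarrow> X *\<^sub>v v = 0\<^sub>v d"
  shows "X = 0\<^sub>m d d"
proof (rule eq_matI)
  fix i j assume "i < dim_row (0\<^sub>m d d :: 'k mat)" "j < dim_col (0\<^sub>m d d :: 'k mat)"
  then have ij: "i < d" "j < d" by auto
  have "(X *\<^sub>v unit_vec d j) $ i = X $$ (i, j)" using assms(1) ij by (simp add: scalar_prod_right_unit)
  then show "X $$ (i, j) = 0\<^sub>m d d $$ (i, j)" using assms(2)[of "unit_vec d j"] ij by simp
qed (use assms(1) in auto)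

lemma mat_eq_oneI:
  fixes X :: "'k :: field mat"
  assumes "X \<in> carrier_mat d d" "\<And>v. v \<in> carrier_vec d \<Longrightarrow> X *\<^sub>v v = v"
  shows "X = 1\<^sub>m d"
proof (rule eq_matI)
  fix i j assume "i < dim_row (1\<^sub>m d :: 'k mat)" "j < dim_col (1\<^sub>m d :: 'k mat)"
  then have ij: "i < d" "j < d" by auto
  have "(X *\<^sub>v unit_vec d j) $ i = X $$ (i, j)" using assms(1) ij by (simp add: scalar_prod_right_unit)
  then show "X $$ (i, j) = 1\<^sub>m d $$ (i, j)" using assms(2)[of "unit_vec d j"] ij by auto
qed (use assms(1) in auto)

lemma simple_rep_subspace:
  assumes "simple_rep S d L" "is_subspace d W" "\<And>a v. a \<in> carrier S \<Longrightarrow> v \<in> W \<Longrightarrow> L a *\<^sub>v v \<in> W"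
    and "v \<in> W" "v \<noteq> 0\<^sub>v d"
  shows "W = carrier_vec d"
  using assms unfolding simple_rep_def by blast

lemma is_rep_mult_vec:
  assumes "is_rep S d \<rho>" "a \<in> carrier S" "b \<in> carrier S" "v \<in> carrier_vec d"
  shows "\<rho> a *\<^sub>v (\<rho> b *\<^sub>v v) = \<rho> (a \<otimes>\<^bsub>S\<^esub> b) *\<^sub>v v"
  using assms assoc_mult_mat_vec[of "\<rho> a" d d "\<rho> b" d v] by (simp add: is_rep_def)

context diagram_monoid
begin

lemma rep_iso_of_eq:
  assumes \<rho>: "is_rep S 1 \<rho>" and eq: "\<And>a. a \<in> carrier S \<Longrightarrow> \<rho> a = \<tau> a"
  shows "rep_iso S 1 \<rho> 1 \<tau>"
  using rep_iso_refl[OF \<rho>] eq unfolding rep_iso_def by auto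

lemma simple_apex_unit:
  assumes L: "simple_rep S d L" and zero: "\<And>a. a \<in> N \<Longrightarrow> L a = 0\<^sub>m d d"
  shows "rep_iso S d L 1 (triv_b S)"
proof -
  have one: "L (id_diagram n) = 1\<^sub>m d" using L by (simp add: simple_rep_def is_rep_def)
  then have d: "d = 1" using simple_rep_scalar_dim_one[OF L] zero carrier by auto
  have "L a = triv_b S a" if "a \<in> carrier S" for a
    using that one zero d carrier id_notin by (auto simp: triv_b_def Units_eq)
  moreover have "is_rep S 1 L" using L d by (simp add: simple_rep_def)
  ultimately show ?thesis using rep_iso_of_eq d by blast
qed

text \<open>
  Let \<open>J\<close> be the ideal of rank at most one. The vectors killed by \<open>J\<close> form an invariant subspace, which
  is zero because \<open>e\<close> is in \<open>J\<close>. As \<open>x (a y) = x y\<close> for \<open>x\<close> and \<open>y\<close> in \<open>J\<close>, the vectors \<open>a (y v) - y v\<close> are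
  killed by \<open>J\<close>, so \<open>J\<close> maps into the fixed vectors. These are therefore a nonzero invariant subspace, and
  everything acts as the identity.
\<close>
lemma simple_apex_minimal:
  assumes L: "simple_rep S d L" and e: "e \<in> N" "through_strands e \<le> 1" "L e \<noteq> 0\<^sub>m d d"
  shows "rep_iso S d L 1 (triv_t S)"
proof -
  have rep: "is_rep S d L" using L by (simp add: simple_rep_def)
  have Lc: "L a \<in> carrier_mat d d" if "a \<in> carrier S" for a using rep that by (simp add: is_rep_def)
  let ?J = "{a \<in> N. through_strands a \<le> 1}"
  have JN: "a \<in> N" "a \<in> carrier S" if "a \<in> ?J" for a using that N_in_carrier by auto
  have J_ideal: "stack x a \<in> ?J" "stack a x \<in> ?J" if "x \<in> ?J" "a \<in> carrier S" for x a
    using that ideal_left ideal_right through_strands_stack(1)[OF pm pm_carrier, of x a]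
      through_strands_stack(2)[OF pm_carrier pm, of a x] by auto
  \<comment> \<open>The vectors killed by the ideal of rank at most one.\<close>
  define W where "W = {v \<in> carrier_vec d. \<forall>x\<in>?J. L x *\<^sub>v v = 0\<^sub>v d}"
  have "is_subspace d W" unfolding W_def by (rule is_subspace_common_kernel) (rule Lc[OF JN(2)])
  moreover have Winv: "L a *\<^sub>v v \<in> W" if a: "a \<in> carrier S" and v: "v \<in> W" for a v
  proof -
    have vc: "v \<in> carrier_vec d" using v by (simp add: W_def)
    have "L x *\<^sub>v (L a *\<^sub>v v) = 0\<^sub>v d" if x: "x \<in> ?J" for x
      using is_rep_mult_vec[OF rep JN(2)[OF x] a vc] v J_ideal(1)[OF x a] by (simp add: W_def)
    then show ?thesis using Lc[OF a] vc by (simp add: W_def)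
  qed
  moreover have "W \<noteq> carrier_vec d"
  proof
    assume W: "W = carrier_vec d"
    have "L e = 0\<^sub>m d d"
      by (rule mat_eq_zeroI[OF Lc[OF N_in_carrier[OF e(1)]]]) (use W e in \<open>auto simp: W_def\<close>)
    then show False using e by blast
  qed
  ultimately have W0: "W = {0\<^sub>v d}" using L unfolding simple_rep_def by blast
  have fix_J: "L a *\<^sub>v (L y *\<^sub>v v) = L y *\<^sub>v v"
    if a: "a \<in> carrier S" and y: "y \<in> ?J" and v: "v \<in> carrier_vec d" for a y v
  proof -
    let ?w = "L y *\<^sub>v v"
    have wc: "?w \<in> carrier_vec d" "L a *\<^sub>v ?w \<in> carrier_vec d" 
      using mult_mat_vec_carrier[OF Lc[OF JN(2)[OF y]] v] mult_mat_vec_carrier[OF Lc[OF a]] by blast+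
    have "L a *\<^sub>v ?w - ?w \<in> W"
    proof -
      have "L x *\<^sub>v (L a *\<^sub>v ?w - ?w) = 0\<^sub>v d" if x: "x \<in> ?J" for x
      proof -
        have "L x *\<^sub>v (L a *\<^sub>v ?w) = L (stack x (stack a y)) *\<^sub>v v"
          using is_rep_mult_vec[OF rep a JN(2)[OF y] v]
            is_rep_mult_vec[OF rep JN(2)[OF x] _ v] J_ideal(2)[OF y a] JN(2) by auto
        also have "stack x (stack a y) = stack x y"
          using rank_le_one_absorbs[of n x y a] x y pm pm_carrier[OF a] by auto
        also have "L (stack x y) *\<^sub>v v = L x *\<^sub>v ?w"
          using is_rep_mult_vec[OF rep JN(2)[OF x] JN(2)[OF y] v] by simp
        finally have "L x *\<^sub>v (L a *\<^sub>v ?w) = L x *\<^sub>v ?w" .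
        then show ?thesis
          using mult_minus_distrib_mat_vec[OF Lc[OF JN(2)[OF x]] wc(2,1)] Lc[OF JN(2)[OF x]] wc(1) by simp
      qed
      then show ?thesis using wc by (simp add: W_def)
    qed
    then have "L a *\<^sub>v ?w - ?w = 0\<^sub>v d" using W0 by blast
    then have diff: "(L a *\<^sub>v ?w - ?w) $ i = 0" if "i < d" for i using that by simp
    show ?thesis
    proof (rule eq_vecI)
      fix i assume "i < dim_vec ?w"
      then have "i < d" using carrier_vecD[OF wc(1)] by (simp only:)
      then show "(L a *\<^sub>v ?w) $ i = ?w $ i" 
        using diff[of i] carrier_vecD[OF wc(1)] carrier_vecD[OF wc(2)] by (simp del: index_mult_mat_vec dim_mult_mat_vec)
    qed (simp only: carrier_vecD[OF wc(1)] carrier_vecD[OF wc(2)])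
  qed
  \<comment> \<open>The fixed vectors.\<close>
  define F where "F = {v \<in> carrier_vec d. \<forall>a\<in>carrier S. L a *\<^sub>v v = v}"
  obtain v where v: "v \<in> carrier_vec d" "L e *\<^sub>v v \<noteq> 0\<^sub>v d"
    using mat_eq_zeroI[OF Lc[OF N_in_carrier[OF e(1)]]] e(3) by blast
  have "F = carrier_vec d"
  proof (rule simple_rep_subspace[OF L])
    show "is_subspace d F" unfolding F_def by (rule is_subspace_common_fixed) (rule Lc)
    show "L a *\<^sub>v v \<in> F" if "a \<in> carrier S" "v \<in> F" for a v using that by (simp add: F_def)
    have "e \<in> ?J" using e by simp
    then show "L e *\<^sub>v v \<in> F"
      using fix_J[OF _ _ v(1)] mult_mat_vec_carrier[OF Lc[OF N_in_carrier[OF e(1)]] v(1)] unfolding F_def by blast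
  qed (rule v(2))
  then have ones: "L a = 1\<^sub>m d" if "a \<in> carrier S" for a
    by (intro mat_eq_oneI[OF Lc[OF that]]) (use that in \<open>auto simp: F_def\<close>)
  then have d: "d = 1" using simple_rep_scalar_dim_one[OF L] by blast
  then have "is_rep S 1 L" "\<And>a. a \<in> carrier S \<Longrightarrow> L a = triv_t S a" using rep ones by (simp_all add: triv_t_def)
  then show ?thesis using rep_iso_of_eq d by blast
qed

text \<open>
  The rank is monotone in the two-sided order, so everything of rank below that of the apex acts as
  zero.
\<close>
lemma nontrivial_simple_apex:
  assumes L: "simple_rep S d L" and nt: "\<not> rep_iso S d L 1 (triv_b S)" "\<not> rep_iso S d L 1 (triv_t S)"
    and e: "e \<in> carrier S" "L e \<noteq> 0\<^sub>m d d" and apex: "\<And>a. a \<in> carrier S \<Longrightarrow> \<not> le_lr S a e \<Longrightarrow> L a = 0\<^sub>m d d"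
  shows "e \<in> N" "2 \<le> through_strands e"
    "\<And>a. a \<in> carrier S \<Longrightarrow> through_strands a < through_strands e \<Longrightarrow> L a = 0\<^sub>m d d"
proof -
  show low: "L a = 0\<^sub>m d d" if "a \<in> carrier S" "through_strands a < through_strands e" for a
    using apex[OF that(1)] le_lr_through[OF _ that(1)] that(2) by (meson leD)
  show eN: "e \<in> N"
  proof (rule ccontr)
    assume "e \<notin> N"
    then have "e = id_diagram n" using e carrier by auto
    then have "L a = 0\<^sub>m d d" if "a \<in> N" for a
      using low[OF N_in_carrier[OF that]] through_le[OF that] k_less by (simp add: through_strands_id)
    then show False using simple_apex_unit[OF L] nt by blast
  qed
  show "2 \<le> through_strands e"
    using simple_apex_minimal[OF L eN] e nt by (metis not_less_eq_eq one_add_one plus_1_eq_Suc)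
qed

end

lemma (in diagram_monoid) ssdim_apex:
  assumes L: "simple_rep S d L" and nt: "\<not> rep_iso S d L 1 (triv_b S)" "\<not> rep_iso S d L 1 (triv_t S)"
    and x: "has_ssdim S d L x"
  obtains e m where "e \<in> N" "2 \<le> through_strands e" "L e \<noteq> 0\<^sub>m d d" "m > 0"
    "x = card (left_cell S e) div card (H_cell S e) * m"
    "\<forall>a\<in>carrier S. through_strands a < through_strands e \<longrightarrow> L a = 0\<^sub>m d d"
proof -
  obtain e m and V :: "diagram \<Rightarrow> 'a mat" where e: "e \<in> carrier S" and V: "simple_rep (H_group S e) m V"
    and c: "cmp_corresponds S e m V d L" and xeq: "x = card (left_cell S e) div card (H_cell S e) * m"
    using x unfolding has_ssdim_def by blast
  have Le: "L e \<noteq> 0\<^sub>m d d" and apex: "\<And>a. a \<in> carrier S \<Longrightarrow> \<not> le_lr S a e \<Longrightarrow> L a = 0\<^sub>m d d"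
    using c unfolding cmp_corresponds_def by blast+
  note n = nontrivial_simple_apex[OF L nt e Le apex]
  have "m > 0" using V by (simp add: simple_rep_def)
  then show ?thesis using that[OF n(1,2) Le _ xeq] n(3) by blast
qed

lemma ssdim_Br:
  fixes L :: "diagram \<Rightarrow> 'k :: field mat"
  assumes kn: "k < n" and L: "simple_rep (Br_le n k) d L"
    and nt: "\<not> rep_iso (Br_le n k) d L 1 (triv_b (Br_le n k))" "\<not> rep_iso (Br_le n k) d L 1 (triv_t (Br_le n k))"
    and x: "has_ssdim (Br_le n k) d L x"
  obtains e where "e \<in> singular n k" "2 \<le> through_strands e" "L e \<noteq> 0\<^sub>m d d"
    "card (half_diagrams n (through_strands e)) \<le> x"
    "\<forall>a\<in>carrier (Br_le n k). through_strands a < through_strands e \<longrightarrow> L a = 0\<^sub>m d d"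
proof -
  interpret diagram_monoid "Br_le n k" n k "singular n k" using Br_diagram_monoid[OF kn] .
  obtain e m where e: "e \<in> singular n k" "2 \<le> through_strands e" "L e \<noteq> 0\<^sub>m d d" "m > 0"
    "x = card (left_cell (Br_le n k) e) div card (H_cell (Br_le n k) e) * m"
    "\<forall>a\<in>carrier (Br_le n k). through_strands a < through_strands e \<longrightarrow> L a = 0\<^sub>m d d"
    using ssdim_apex[OF L nt x] by metis
  have "x = card (half_diagrams n (through_strands e)) * m"
    using e(5) card_left_cell_Br[OF kn e(1)] card_H_cell_pos[OF kn e(1)] by simp
  then show ?thesis using that e by simp
qed

lemma projection_idem:
  assumes u: "partial_matching n u"
  shows "stack (projection n u) (projection n u) = projection n u"
proof -
  let ?p = "projection n u"
  have p: "stack (flip ?p) ?p = ?p"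
    using stack_flip_eq_projection[OF pm_projection[OF u]] u by simp
  then have "flip ?p = ?p" by (metis flip_flip flip_stack)
  then show ?thesis using p by simp
qed

section \<open>Comparison of the semisimple gaps\<close>

text \<open>
  Elements of the same rank generate the same two-sided ideal: with \<open>s\<close> having the top arcs of \<open>e\<close> and
  the bottom arcs of \<open>p\<close>, one has \<open>e = s (s\<^sup>* e)\<close> and \<open>s = (s p\<^sup>*) p\<close>.
\<close>
lemma same_rank_not_annihilated:
  fixes L :: "diagram \<Rightarrow> 'k :: field mat"
  assumes kn: "k < n" and rep: "is_rep (Br_le n k) d L"
    and e: "e \<in> singular n k" "L e \<noteq> 0\<^sub>m d d"
    and p: "p \<in> singular n k" "through_strands p = through_strands e"
  shows "L p \<noteq> 0\<^sub>m d d"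
proof
  interpret B: diagram_monoid "Br_le n k" n k "singular n k" using Br_diagram_monoid[OF kn] .
  assume Lp: "L p = 0\<^sub>m d d"
  have "card (top_arcs e) = card (bot_arcs p)"
    using half_diagrams_card_eq[OF arcs_half_diagrams(1)[OF B.pm[OF e(1)]]]
      arcs_half_diagrams(2)[OF B.pm[OF p(1)]] p(2) by simp
  then obtain s where s: "perfect_matching n s" "top_arcs s = top_arcs e" "bot_arcs s = bot_arcs p"
    using exists_join[OF partial_matching_top_arcs[OF B.pm[OF e(1)]] partial_matching_bot_arcs[OF B.pm[OF p(1)]]] by metis
  have "through_strands s = through_strands e"
    using through_strands_top_arcs[OF s(1)] through_strands_top_arcs[OF B.pm[OF e(1)]] s(2) by simp
  then have sN: "s \<in> singular n k" using s(1) B.through_le[OF e(1)] by (simp add: singular_def)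
  have 1: "stack s (stack (flip s) e) = e" using stack_stack_flip[OF s(1) B.pm[OF e(1)]] s(2) by simp
  have 2: "stack (stack s (flip p)) p = s" using stack_flip_stack[OF B.pm[OF p(1)] s(1)] s(3) by simp
  have N: "stack s (flip p) \<in> singular n k" "stack (flip s) e \<in> singular n k"
    using sN p(1) e(1) B.N_flip B.N_stack by blast+
  have hom: "L (stack a b) = L a * L b" if "a \<in> singular n k" "b \<in> singular n k" for a b
    using rep that B.N_in_carrier by (simp add: is_rep_def)
  have Lc: "L a \<in> carrier_mat d d" if "a \<in> singular n k" for a
    using rep that B.N_in_carrier by (simp add: is_rep_def)
  have "L s = L (stack s (flip p)) * L p" using hom[OF N(1) p(1)] 2 by simp
  also have "\<dots> = 0\<^sub>m d d" using Lp Lc[OF N(1)] by simp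
  finally have "L s = 0\<^sub>m d d" .
  moreover have "L e = L s * L (stack (flip s) e)" using hom[OF sN N(2)] 1 by simp
  ultimately have "L e = 0\<^sub>m d d" using Lc[OF N(2)] by simp
  then show False using e(2) by blast
qed

text \<open>
  Otherwise the vectors killed by all \<open>p s\<close> would form a proper invariant subspace containing the image
  of \<open>b\<close>. This is what makes the elements that do not act by zero form a single two-sided cell at the
  bottom of the representation.
\<close>
lemma simple_rep_link:
  fixes M :: "'a \<Rightarrow> 'k :: field mat"
  assumes S: "monoid S" and M: "simple_rep S d M" and p: "p \<in> carrier S" "M p \<noteq> 0\<^sub>m d d"
    and b: "b \<in> carrier S" "M b \<noteq> 0\<^sub>m d d"
  shows "\<exists>s\<in>carrier S. M (p \<otimes>\<^bsub>S\<^esub> (s \<otimes>\<^bsub>S\<^esub> b)) \<noteq> 0\<^sub>m d d"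
proof (rule ccontr)
  interpret monoid S by (rule S)
  have rep: "is_rep S d M" using M by (simp add: simple_rep_def)
  have Mc: "M a \<in> carrier_mat d d" if "a \<in> carrier S" for a using rep that by (simp add: is_rep_def)
  assume none: "\<not> (\<exists>s\<in>carrier S. M (p \<otimes>\<^bsub>S\<^esub> (s \<otimes>\<^bsub>S\<^esub> b)) \<noteq> 0\<^sub>m d d)"
  define W where "W = {v \<in> carrier_vec d. \<forall>s\<in>carrier S. M (p \<otimes>\<^bsub>S\<^esub> s) *\<^sub>v v = 0\<^sub>v d}"
  have "is_subspace d W" unfolding W_def
    by (rule is_subspace_common_kernel[where X = "\<lambda>s. M (p \<otimes>\<^bsub>S\<^esub> s)"]) (rule Mc[OF m_closed[OF p(1)]])
  moreover have "M a *\<^sub>v v \<in> W" if a: "a \<in> carrier S" and v: "v \<in> W" for a v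
  proof -
    have vc: "v \<in> carrier_vec d" using v by (simp add: W_def)
    have "M (p \<otimes>\<^bsub>S\<^esub> s) *\<^sub>v (M a *\<^sub>v v) = 0\<^sub>v d" if s: "s \<in> carrier S" for s
      using is_rep_mult_vec[OF rep m_closed[OF p(1) s] a vc] v m_closed[OF s a] m_assoc[OF p(1) s a]
      by (simp add: W_def)
    then show ?thesis using Mc[OF a] vc by (simp add: W_def)
  qed
  moreover obtain v where v: "v \<in> carrier_vec d" "M b *\<^sub>v v \<noteq> 0\<^sub>v d"
    using mat_eq_zeroI[OF Mc[OF b(1)]] b(2) by blast
  moreover have "M b *\<^sub>v v \<in> W"
  proof -
    have "M (p \<otimes>\<^bsub>S\<^esub> s) *\<^sub>v (M b *\<^sub>v v) = 0\<^sub>v d" if s: "s \<in> carrier S" for s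
      using is_rep_mult_vec[OF rep m_closed[OF p(1) s] b(1) v(1)] none s v(1) m_assoc[OF p(1) s b(1)]
      by (simp add: zero_mat_mult_vec)
    then show ?thesis using Mc[OF b(1)] v by (simp add: W_def)
  qed
  ultimately have "W = carrier_vec d" using simple_rep_subspace[OF M] by blast
  then have "M (p \<otimes>\<^bsub>S\<^esub> \<one>\<^bsub>S\<^esub>) *\<^sub>v v = 0\<^sub>v d" if "v \<in> carrier_vec d" for v
    using that one_closed unfolding W_def by blast
  then have "M p = 0\<^sub>m d d" using mat_eq_zeroI[OF Mc[OF p(1)]] p(1) by simp
  then show False using p(2) by blast
qed

lemma is_subspace_common_line:
  fixes X :: "'i \<Rightarrow> 'k :: field mat"
  assumes X: "\<And>i. i \<in> I \<Longrightarrow> X i \<in> carrier_mat d d" and v: "v \<in> carrier_vec d"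
  shows "is_subspace d {w \<in> carrier_vec d. \<forall>i\<in>I. \<exists>c. X i *\<^sub>v w = c \<cdot>\<^sub>v v}"
    (is "is_subspace d ?W")
  unfolding is_subspace_iff
proof (intro conjI ballI allI)
  have "X i *\<^sub>v 0\<^sub>v d = 0 \<cdot>\<^sub>v v" if "i \<in> I" for i using X[OF that] v by auto
  then show "0\<^sub>v d \<in> ?W" using zero_carrier_vec by blast
next
  fix w w' assume w: "w \<in> ?W" "w' \<in> ?W"
  have "\<exists>c. X i *\<^sub>v (w + w') = c \<cdot>\<^sub>v v" if i: "i \<in> I" for i
  proof -
    obtain c c' where "X i *\<^sub>v w = c \<cdot>\<^sub>v v" "X i *\<^sub>v w' = c' \<cdot>\<^sub>v v" using w i by blast
    then have "X i *\<^sub>v (w + w') = (c + c') \<cdot>\<^sub>v v"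
      using mult_add_distrib_mat_vec[OF X[OF i]] w by (simp add: add_smult_distrib_vec)
    then show ?thesis ..
  qed
  then show "w + w' \<in> ?W" using w by simp
next
  fix c w assume w: "w \<in> ?W"
  have "\<exists>c'. X i *\<^sub>v (c \<cdot>\<^sub>v w) = c' \<cdot>\<^sub>v v" if i: "i \<in> I" for i
  proof -
    obtain c' where "X i *\<^sub>v w = c' \<cdot>\<^sub>v v" using w i by blast
    then have "X i *\<^sub>v (c \<cdot>\<^sub>v w) = (c * c') \<cdot>\<^sub>v v"
      using mult_mat_vec[OF X[OF i]] w by (simp add: smult_smult_assoc)
    then show ?thesis ..
  qed
  then show "c \<cdot>\<^sub>v w \<in> ?W" using w by simp
qed auto

text \<open>
  The image of \<open>p\<close> is a simple module over the corner \<open>p S p\<close>. If that corner acts on it by zero or the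
  identity only, the image is a line.
\<close>
lemma simple_rep_idempotent_line:
  fixes M :: "'a \<Rightarrow> 'k :: field mat"
  assumes S: "monoid S" and M: "simple_rep S d M" and p: "p \<in> carrier S" "p \<otimes>\<^bsub>S\<^esub> p = p" "M p \<noteq> 0\<^sub>m d d"
    and corner: "\<And>s. s \<in> carrier S \<Longrightarrow>
      M (p \<otimes>\<^bsub>S\<^esub> (s \<otimes>\<^bsub>S\<^esub> p)) = 0\<^sub>m d d \<or> M (p \<otimes>\<^bsub>S\<^esub> (s \<otimes>\<^bsub>S\<^esub> p)) = M p"
  obtains v where "v \<in> carrier_vec d" "v \<noteq> 0\<^sub>v d" "M p *\<^sub>v v = v"
    "\<forall>w\<in>carrier_vec d. \<exists>c. M p *\<^sub>v w = c \<cdot>\<^sub>v v"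
proof -
  interpret monoid S by (rule S)
  have rep: "is_rep S d M" using M by (simp add: simple_rep_def)
  have Mc: "M a \<in> carrier_mat d d" if "a \<in> carrier S" for a using rep that by (simp add: is_rep_def)
  note Mvec = is_rep_mult_vec[OF rep]
  obtain u where u: "u \<in> carrier_vec d" "M p *\<^sub>v u \<noteq> 0\<^sub>v d"
    using mat_eq_zeroI[OF Mc[OF p(1)]] p(3) by blast
  define v where "v = M p *\<^sub>v u"
  have v: "v \<in> carrier_vec d" "v \<noteq> 0\<^sub>v d"
    using u mult_mat_vec_carrier[OF Mc[OF p(1)] u(1)] by (auto simp: v_def)
  have pv: "M p *\<^sub>v v = v" using Mvec[OF p(1) p(1) u(1)] p(2) by (simp add: v_def)
  define W where "W = {w \<in> carrier_vec d. \<forall>s\<in>carrier S. \<exists>c. M (p \<otimes>\<^bsub>S\<^esub> s) *\<^sub>v w = c \<cdot>\<^sub>v v}"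
  have W: "W = carrier_vec d"
  proof (rule simple_rep_subspace[OF M])
    show "is_subspace d W" unfolding W_def
      by (rule is_subspace_common_line[where X = "\<lambda>s. M (p \<otimes>\<^bsub>S\<^esub> s)", OF Mc[OF m_closed[OF p(1)]] v(1)])
    show "M a *\<^sub>v w \<in> W" if a: "a \<in> carrier S" and w: "w \<in> W" for a w
    proof -
      have wc: "w \<in> carrier_vec d" using w by (simp add: W_def)
      have "\<exists>c. M (p \<otimes>\<^bsub>S\<^esub> s) *\<^sub>v (M a *\<^sub>v w) = c \<cdot>\<^sub>v v" if s: "s \<in> carrier S" for s
        using Mvec[OF m_closed[OF p(1) s] a wc] w m_closed[OF s a] m_assoc[OF p(1) s a] unfolding W_def by simp
      then show ?thesis using Mc[OF a] wc by (simp add: W_def)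
    qed
    have "\<exists>c. M (p \<otimes>\<^bsub>S\<^esub> s) *\<^sub>v v = c \<cdot>\<^sub>v v" if s: "s \<in> carrier S" for s
    proof -
      have "M (p \<otimes>\<^bsub>S\<^esub> s) *\<^sub>v v = M (p \<otimes>\<^bsub>S\<^esub> (s \<otimes>\<^bsub>S\<^esub> p)) *\<^sub>v u"
        using Mvec[OF m_closed[OF p(1) s] p(1) u(1)] m_assoc[OF p(1) s p(1)] by (simp add: v_def)
      then have "M (p \<otimes>\<^bsub>S\<^esub> s) *\<^sub>v v = 0 \<cdot>\<^sub>v v \<or> M (p \<otimes>\<^bsub>S\<^esub> s) *\<^sub>v v = 1 \<cdot>\<^sub>v v"
        using corner[OF s] u(1) v(1) zero_mat_mult_vec[OF u(1), of d] by (auto simp: v_def[symmetric])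
      then show ?thesis by blast
    qed
    then show "v \<in> W" using v by (simp add: W_def)
  qed (rule v(2))
  have "\<exists>c. M p *\<^sub>v w = c \<cdot>\<^sub>v v" if "w \<in> carrier_vec d" for w
  proof -
    have "w \<in> W" using that W by simp
    then have "\<exists>c. M (p \<otimes>\<^bsub>S\<^esub> \<one>\<^bsub>S\<^esub>) *\<^sub>v w = c \<cdot>\<^sub>v v" using one_closed unfolding W_def by blast
    then show ?thesis using p(1) by simp
  qed
  then show ?thesis using that v pv by blast
qed

text \<open>
  With a singleton \<open>H\<close>-cell the group of \<open>p\<close> is trivial, and its only simple representation, of
  dimension one, is matched with the line that is the image of \<open>p\<close>.
\<close>
lemma has_ssdim_of_line:
  fixes M :: "'a \<Rightarrow> 'k :: field mat"
  assumes M: "M p \<in> carrier_mat d d" "M p \<noteq> 0\<^sub>m d d"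
    and p: "p \<in> carrier S" "p \<otimes>\<^bsub>S\<^esub> p = p" "H_cell S p = {p}"
    and apex: "\<And>a. a \<in> carrier S \<Longrightarrow> \<not> le_lr S a p \<Longrightarrow> M a = 0\<^sub>m d d"
    and v: "v \<in> carrier_vec d" "v \<noteq> 0\<^sub>v d" "M p *\<^sub>v v = v" "\<forall>w\<in>carrier_vec d. \<exists>c. M p *\<^sub>v w = c \<cdot>\<^sub>v v"
  shows "has_ssdim S d M (card (left_cell S p))"
proof -
  \<comment> \<open>The embedding of the one-dimensional representation onto the line through \<open>v\<close>.\<close>
  define P where "P = mat_of_cols d [v]"
  have P: "P \<in> carrier_mat d 1" using mat_of_cols_carrier(1)[of d "[v]"] by (simp add: P_def)
  have Pw: "P *\<^sub>v w = w $ 0 \<cdot>\<^sub>v v" if "w \<in> carrier_vec 1" for w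
    using that v(1) by (intro eq_vecI) (auto simp: P_def scalar_prod_def mat_of_cols_index)
  define V :: "'a \<Rightarrow> 'k mat" where "V = (\<lambda>_. 1\<^sub>m 1)"
  have simpleV: "simple_rep (H_group S p) 1 V"
    by (rule simple_rep_one_dim) (simp add: is_rep_def V_def)
  have "cmp_corresponds S p 1 V d M" unfolding cmp_corresponds_def
  proof (intro conjI bexI[OF _ P] ballI impI)
    show "M p \<noteq> 0\<^sub>m d d" by (rule M(2))
    show "M a = 0\<^sub>m d d" if "a \<in> carrier S" "\<not> le_lr S a p" for a using apex that .
    show "mat_kernel P = {0\<^sub>v 1}"
    proof (intro equalityI subsetI)
      fix w assume "w \<in> mat_kernel P"
      then have w: "w \<in> carrier_vec 1" "P *\<^sub>v w = 0\<^sub>v d" using mat_kernelD[OF P] by auto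
      then have z: "w $ 0 \<cdot>\<^sub>v v = 0\<^sub>v d" using Pw by simp
      obtain i where i: "i < d" "v $ i \<noteq> 0"
      proof (rule ccontr)
        assume "\<not> thesis"
        then have "v = 0\<^sub>v d" using that v(1) by (intro eq_vecI) auto
        then show False using v(2) by blast
      qed
      have "(w $ 0 \<cdot>\<^sub>v v) $ i = 0" using z i by simp
      then have "w $ 0 = 0" using i v(1) by simp
      then show "w \<in> {0\<^sub>v 1}" using w(1) by (auto intro!: eq_vecI)
    next
      fix w :: "'k vec" assume "w \<in> {0\<^sub>v 1}"
      then show "w \<in> mat_kernel P" using P by (auto intro!: mat_kernelI)
    qed
    show "(\<lambda>v. P *\<^sub>v v) ` carrier_vec 1 = (\<lambda>v. M p *\<^sub>v v) ` carrier_vec d"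
    proof (intro equalityI subsetI)
      fix z assume "z \<in> (\<lambda>v. P *\<^sub>v v) ` carrier_vec 1"
      then obtain w :: "'k vec" where "z = w $ 0 \<cdot>\<^sub>v v" using Pw by auto
      then have "z = M p *\<^sub>v (w $ 0 \<cdot>\<^sub>v v)" using mult_mat_vec[OF M(1) v(1)] v(3) by simp
      then show "z \<in> (\<lambda>v. M p *\<^sub>v v) ` carrier_vec d" using v(1) by auto
    next
      fix z assume "z \<in> (\<lambda>v. M p *\<^sub>v v) ` carrier_vec d"
      then obtain c where c: "z = c \<cdot>\<^sub>v v" using v(4) by blast
      have "P *\<^sub>v vec 1 (\<lambda>_. c) = z" using Pw[of "vec 1 (\<lambda>_. c)"] c by simp
      then show "z \<in> (\<lambda>v. P *\<^sub>v v) ` carrier_vec 1" by (metis imageI vec_carrier)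
    qed
    show "P * V h = M h * P" if "h \<in> H_cell S p" for h
    proof -
      have "M p * P = P"
      proof (rule eq_matI)
        fix i l assume "i < dim_row P" "l < dim_col P"
        then have il: "i < d" "l = 0" using P by auto
        have "col P 0 = v" using v(1) by (simp add: P_def)
        then have "(M p * P) $$ (i, 0) = (M p *\<^sub>v v) $ i" using il P M(1) by simp
        then show "(M p * P) $$ (i, l) = P $$ (i, l)" using v(3) il by (simp add: P_def mat_of_cols_index)
      qed (use P M(1) in auto)
      then show ?thesis using that p(3) P by (simp add: V_def)
    qed
  qed
  then have "has_ssdim S d M (card (left_cell S p) div card (H_cell S p) * 1)"
    unfolding has_ssdim_def using p(1,2) simpleV by (intro exI[of _ p] exI[of _ 1] exI[of _ V]) auto
  then show ?thesis using p(3) by simp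
qed

lemma (in diagram_monoid) not_triv_b:
  assumes M: "is_rep S d M" and p: "p \<in> N" "M p \<noteq> 0\<^sub>m d d"
  shows "\<not> rep_iso S d M 1 (triv_b S)"
proof
  assume "rep_iso S d M 1 (triv_b S)"
  then obtain Q where d: "d = 1" and Q: "Q \<in> carrier_mat d d" "invertible_mat Q" "Q * M p = triv_b S p * Q"
    unfolding rep_iso_def using N_in_carrier[OF p(1)] by blast
  have "triv_b S p = (0\<^sub>m d d :: 'a mat)" using d p id_notin by (auto simp: triv_b_def Units_eq)
  then have "Q * M p = Q * 0\<^sub>m d d" using Q by simp
  moreover have "M p \<in> carrier_mat d d" using M N_in_carrier[OF p(1)] by (simp add: is_rep_def)
  ultimately show False using invertible_mat_cancel[OF Q(1,2), of "M p" d "0\<^sub>m d d"] p(2) by simp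
qed

lemma (in diagram_monoid) not_triv_t:
  fixes M :: "diagram \<Rightarrow> 'k :: field mat"
  assumes q: "q \<in> N" "M q = 0\<^sub>m d d"
  shows "\<not> rep_iso S d M 1 (triv_t S)"
proof
  assume "rep_iso S d M 1 (triv_t S)"
  then obtain Q where d: "d = 1" and Q: "Q \<in> carrier_mat d d" "invertible_mat Q" "Q * M q = triv_t S q * Q"
    unfolding rep_iso_def using N_in_carrier[OF q(1)] by blast
  then have Q0: "Q = 0\<^sub>m d d" using q(2) by (simp add: triv_t_def)
  obtain R where R: "R \<in> carrier_mat d d" "Q * R = 1\<^sub>m d" using invertible_mat_obtain_inverse[OF Q(1,2)] by metis
  then have "(0\<^sub>m d d :: 'k mat) = 1\<^sub>m d" using Q0 by simp
  then have "(0\<^sub>m d d :: 'k mat) $$ (0, 0) = 1\<^sub>m d $$ (0, 0)" by simp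
  then show False using d by simp
qed

text \<open>
  If \<open>p s\<close> does not act by zero, its rank is that of \<open>p\<close>, so it has the top arcs of \<open>p\<close> and generates \<open>p\<close>
  again; this gives the apex. If \<open>p s p\<close> does not act by zero, it has both the top and the bottom arcs
  of \<open>p\<close>, so it is \<open>p\<close> by planarity; this gives the line. The representation is not \<open>1\<^sub>t\<close> because planar
  diagrams of rank \<open>j - 2\<close> act by zero.
\<close>
lemma exists_TL_simple:
  fixes L :: "diagram \<Rightarrow> 'k :: field mat"
  assumes kn: "k < n" and rep: "is_rep (Br_le n k) d L"
    and e: "e \<in> singular n k" "2 \<le> through_strands e" "L e \<noteq> 0\<^sub>m d d"
    and low: "\<And>a. a \<in> carrier (Br_le n k) \<Longrightarrow> through_strands a < through_strands e \<Longrightarrow> L a = 0\<^sub>m d d"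
  shows "\<exists>d' (M :: diagram \<Rightarrow> 'k mat) y. simple_rep (TL_le n k) d' M \<and>
    \<not> rep_iso (TL_le n k) d' M 1 (triv_b (TL_le n k)) \<and> \<not> rep_iso (TL_le n k) d' M 1 (triv_t (TL_le n k)) \<and>
    has_ssdim (TL_le n k) d' M y \<and> y \<le> card (half_diagrams n (through_strands e))"
proof -
  interpret B: diagram_monoid "Br_le n k" n k "singular n k" using Br_diagram_monoid[OF kn] .
  interpret T: diagram_monoid "TL_le n k" n k "planar_singular n k" using TL_diagram_monoid[OF kn] .
  let ?j = "through_strands e" and ?T = "TL_le n k"
  define p where "p = projection n (adjacent_arcs n ?j)"
  have j: "?j \<le> k" "?j \<le> n" "?j mod 2 = n mod 2"
    using B.through_le[OF e(1)] kn through_strands_top_arcs[OF B.pm[OF e(1)]] by presburger+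
  have pT: "p \<in> planar_singular n k" and pj: "through_strands p = ?j"
    using adjacent_projection_planar[OF j(2,3,1)] by (simp_all add: p_def)
  have pc: "p \<in> carrier ?T" using T.N_in_carrier[OF pT] .
  have pp: "stack p p = p" unfolding p_def by (rule projection_idem[OF partial_matching_adjacent_arcs])
  have pS: "p \<in> singular n k" using pT by (simp add: planar_singular_def)
  \<comment> \<open>The planar diagrams that must act by zero.\<close>
  define Z where "Z = {a \<in> planar_singular n k. through_strands a < ?j}"
  have LZ: "L a = 0\<^sub>m d d" if "a \<in> Z" for a
    using low[of a] that B.N_in_carrier by (simp add: Z_def planar_singular_def)
  have "\<exists>d' (M :: diagram \<Rightarrow> 'k mat). simple_rep ?T d' M \<and> M p \<noteq> 0\<^sub>m d' d' \<and> (\<forall>a\<in>Z. M a = 0\<^sub>m d' d')"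
    by (rule exists_simple_rep_with_support[OF T.is_monoid pc _ _ is_rep_TL_of_Br[OF rep]
        same_rank_not_annihilated[OF kn rep e(1,3) pS pj] LZ])
      (use T.N_in_carrier pp in \<open>auto simp: Z_def\<close>)
  then obtain d' and M :: "diagram \<Rightarrow> 'k mat" where M: "simple_rep ?T d' M" "M p \<noteq> 0\<^sub>m d' d'"
    and MZ: "\<And>a. a \<in> Z \<Longrightarrow> M a = 0\<^sub>m d' d'" by blast
  have Mrep: "is_rep ?T d' M" using M by (simp add: simple_rep_def)
  have closed: "stack a b \<in> carrier ?T" if "a \<in> carrier ?T" "b \<in> carrier ?T" for a b
    using monoid.m_closed[OF T.is_monoid that] by simp
  have top: "top_arcs p = top_arcs (stack p s)" "through_strands (stack p s) = ?j"
    if s: "s \<in> carrier ?T" and Ms: "M (stack p s) \<noteq> 0\<^sub>m d' d'" for s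
  proof -
    have y: "stack p s \<in> planar_singular n k" using T.ideal_right[OF pT s] .
    then have "\<not> through_strands (stack p s) < ?j" using MZ Ms unfolding Z_def by blast
    then show ps: "through_strands (stack p s) = ?j"
      using through_strands_stack(1)[OF T.pm[OF pT] T.pm_carrier[OF s]] pj by simp
    show "top_arcs p = top_arcs (stack p s)"
      using through_strands_antimono(2)[OF T.pm[OF pT] T.pm[OF y] top_arcs_stack[OF T.pm[OF pT]]] ps pj by simp
  qed
  have apex: "M b = 0\<^sub>m d' d'" if b: "b \<in> carrier ?T" and nle: "\<not> le_lr ?T b p" for b
  proof (rule ccontr)
    assume "M b \<noteq> 0\<^sub>m d' d'"
    then obtain s where s: "s \<in> carrier ?T" "M (stack p (stack s b)) \<noteq> 0\<^sub>m d' d'"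
      using simple_rep_link[OF T.is_monoid M(1) pc M(2) b] by auto
    let ?y = "stack p (stack s b)"
    have sb: "stack s b \<in> carrier ?T" using closed s b by blast
    have y: "?y \<in> planar_singular n k" using T.ideal_right[OF pT sb] .
    have "stack ?y (stack (flip ?y) p) = p"
      using stack_stack_flip[OF T.pm[OF y] T.pm[OF pT]] top(1)[OF sb s(2)] by simp
    then have "p = stack (stack (stack p s) b) (stack (flip ?y) p)" by (simp add: stack_assoc)
    moreover have "stack p s \<in> carrier ?T" "stack (flip ?y) p \<in> carrier ?T"
      using closed[OF pc s(1)] closed[OF T.N_in_carrier[OF T.N_flip[OF y]] pc] by auto
    ultimately have "le_lr ?T b p" unfolding le_lr_def T.mult by blast
    then show False using nle by blast
  qed
  have corner: "M (stack p (stack s p)) = 0\<^sub>m d' d' \<or> M (stack p (stack s p)) = M p"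
    if s: "s \<in> carrier ?T" for s
  proof (cases "M (stack p (stack s p)) = 0\<^sub>m d' d'")
    case False
    let ?y = "stack p (stack s p)"
    have sp: "stack s p \<in> carrier ?T" using closed s pc by blast
    have y: "?y \<in> planar_singular n k" using T.ideal_right[OF pT sp] .
    have "bot_arcs p = bot_arcs ?y"
      using bot_arcs_eqI[OF T.pm[OF pT] T.pm[OF y]] bot_arcs_stack[OF T.pm[OF pT], of "stack p s"]
        top(2)[OF sp False] pj by (simp add: stack_assoc)
    then have "p = ?y"
      using planar_determined_by_arcs[OF T.pm[OF pT] _ T.pm[OF y] _ top(1)[OF sp False]] pT y
      by (simp add: planar_singular_def)
    then show ?thesis by simp
  qed simp
  obtain v where v: "v \<in> carrier_vec d'" "v \<noteq> 0\<^sub>v d'" "M p *\<^sub>v v = v"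
    "\<forall>w\<in>carrier_vec d'. \<exists>c. M p *\<^sub>v w = c \<cdot>\<^sub>v v"
    using simple_rep_idempotent_line[OF T.is_monoid M(1) pc _ M(2)] pp corner by (metis T.mult)
  have Mp: "M p \<in> carrier_mat d' d'" using Mrep pc by (simp add: is_rep_def)
  have ss: "has_ssdim ?T d' M (card (left_cell ?T p))"
    by (rule has_ssdim_of_line[where M = M and p = p and v = v]) (use Mp M(2) pc pp H_cell_TL[OF kn pT] apex v in simp_all)
  let ?q = "projection n (adjacent_arcs n (?j - 2))"
  have q: "?q \<in> planar_singular n k" "through_strands ?q = ?j - 2"
    using adjacent_projection_planar[of "?j - 2" n k] j e(2) by (auto simp: le_mod_geq)
  then have "M ?q = 0\<^sub>m d' d'" using MZ e(2) by (simp add: Z_def)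
  then show ?thesis
    using M(1) T.not_triv_b[OF Mrep pT M(2)] T.not_triv_t[OF q(1)] ss card_left_cell_TL[OF kn pT] pj by metis
qed

lemma rep_ssgap_mono:
  assumes kn: "k < n"
  shows "rep_ssgap TYPE('k :: field) (TL_le n k) \<le> rep_ssgap TYPE('k) (Br_le n k)"
  unfolding rep_ssgap_def
proof (rule Inf_mono)
  fix b assume "b \<in> {enat x | x. \<exists>d. \<exists>L :: diagram \<Rightarrow> 'k mat. simple_rep (Br_le n k) d L \<and>
        \<not> rep_iso (Br_le n k) d L 1 (triv_b (Br_le n k)) \<and> \<not> rep_iso (Br_le n k) d L 1 (triv_t (Br_le n k)) \<and>
        has_ssdim (Br_le n k) d L x}"
  then obtain x d and L :: "diagram \<Rightarrow> 'k mat" where b: "b = enat x" and L: "simple_rep (Br_le n k) d L"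
    "\<not> rep_iso (Br_le n k) d L 1 (triv_b (Br_le n k))" "\<not> rep_iso (Br_le n k) d L 1 (triv_t (Br_le n k))"
    "has_ssdim (Br_le n k) d L x" by blast
  obtain e where e: "e \<in> singular n k" "2 \<le> through_strands e" "L e \<noteq> 0\<^sub>m d d"
    "card (half_diagrams n (through_strands e)) \<le> x"
    "\<forall>a\<in>carrier (Br_le n k). through_strands a < through_strands e \<longrightarrow> L a = 0\<^sub>m d d"
    using ssdim_Br[OF kn L] by metis
  have rep: "is_rep (Br_le n k) d L" using L by (simp add: simple_rep_def)
  then obtain d' y and M :: "diagram \<Rightarrow> 'k mat" where "simple_rep (TL_le n k) d' M"
    "\<not> rep_iso (TL_le n k) d' M 1 (triv_b (TL_le n k))" "\<not> rep_iso (TL_le n k) d' M 1 (triv_t (TL_le n k))"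
    "has_ssdim (TL_le n k) d' M y" "y \<le> card (half_diagrams n (through_strands e))"
    using exists_TL_simple[OF kn rep e(1-3)] e(5) by blast
  then show "\<exists>a\<in>{enat x | x. \<exists>d. \<exists>L :: diagram \<Rightarrow> 'k mat. simple_rep (TL_le n k) d L \<and>
        \<not> rep_iso (TL_le n k) d L 1 (triv_b (TL_le n k)) \<and> \<not> rep_iso (TL_le n k) d L 1 (triv_t (TL_le n k)) \<and>
        has_ssdim (TL_le n k) d L x}. a \<le> b"
    using e(4) b by (intro bexI[of _ "enat y"]) auto
qed

lemma rep_ssgap_Br_ge:
  assumes kn: "k < n"
    and bound: "\<And>j. 2 \<le> j \<Longrightarrow> j \<le> k \<Longrightarrow> j mod 2 = n mod 2 \<Longrightarrow> c \<le> card (half_diagrams n j)"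
  shows "enat c \<le> rep_ssgap TYPE('k :: field) (Br_le n k)"
  unfolding rep_ssgap_def
proof (rule Inf_greatest)
  interpret B: diagram_monoid "Br_le n k" n k "singular n k" using Br_diagram_monoid[OF kn] .
  fix b assume "b \<in> {enat x | x. \<exists>d. \<exists>L :: diagram \<Rightarrow> 'k mat. simple_rep (Br_le n k) d L \<and>
        \<not> rep_iso (Br_le n k) d L 1 (triv_b (Br_le n k)) \<and> \<not> rep_iso (Br_le n k) d L 1 (triv_t (Br_le n k)) \<and>
        has_ssdim (Br_le n k) d L x}"
  then obtain x d and L :: "diagram \<Rightarrow> 'k mat" where b: "b = enat x" and L: "simple_rep (Br_le n k) d L"
    "\<not> rep_iso (Br_le n k) d L 1 (triv_b (Br_le n k))" "\<not> rep_iso (Br_le n k) d L 1 (triv_t (Br_le n k))"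
    "has_ssdim (Br_le n k) d L x" by blast
  obtain e where e: "e \<in> singular n k" "2 \<le> through_strands e"
    "card (half_diagrams n (through_strands e)) \<le> x"
    using ssdim_Br[OF kn L] by metis
  have "through_strands e mod 2 = n mod 2"
    using through_strands_top_arcs[OF B.pm[OF e(1)]] by presburger
  then show "enat c \<le> b" using bound[OF e(2) B.through_le[OF e(1)]] e(3) b by simp
qed

section \<open>Counting half diagrams\<close>

definition matchings_on :: "nat set \<Rightarrow> nat set set set" where
  "matchings_on A = {u. (\<forall>B\<in>u. B \<subseteq> A \<and> card B = 2) \<and> disjoint u \<and> \<Union>u = A}"

lemma finite_matchings_on: "finite A \<Longrightarrow> finite (matchings_on A)"
  by (rule finite_subset[of _ "Pow (Pow A)"]) (auto simp: matchings_on_def)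

lemma insert_matchings_on:
  assumes x: "x \<in> A" and y: "y \<in> A" "y \<noteq> x" and u: "u \<in> matchings_on (A - {x, y})"
  shows "insert {x, y} u \<in> matchings_on A"
proof -
  have "B \<inter> {x, y} = {}" if "B \<in> u" for B using u that by (auto simp: matchings_on_def)
  then have "disjoint (insert {x, y} u)"
    using u by (auto simp: matchings_on_def disjoint_def pairwise_def disjnt_def)
  then show ?thesis using u x y by (auto simp: matchings_on_def)
qed

text \<open>
  Choose the partner of a fixed point and match the rest.
\<close>
lemma card_matchings_on:
  assumes "finite A" "even (card A)"
  shows "double_fact (card A - 1) \<le> card (matchings_on A)"
  using assms
proof (induction "card A" arbitrary: A rule: less_induct)
  case (less A)
  show ?case
  proof (cases "A = {}")
    case True
    then have "{} \<in> matchings_on A" by (simp add: matchings_on_def)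
    then have "card (matchings_on A) > 0" using finite_matchings_on[OF less(2)] by (auto simp: card_gt_0_iff)
    then show ?thesis using True by simp
  next
    case False
    then obtain x where x: "x \<in> A" by blast
    define m where "m = card A - 2"
    have "card A \<noteq> 0" "card A \<noteq> 1" using False less(2,3) by auto
    then have m: "card A = Suc (Suc m)" "even m" using less(3) by (auto simp: m_def)
    let ?I = "\<lambda>y. insert {x, y} ` matchings_on (A - {x, y})"
    have card: "double_fact (m - 1) \<le> card (?I y)" if y: "y \<in> A - {x}" for y
    proof -
      have cA: "card (A - {x, y}) = m"
        using card_Diff_subset[of "{x, y}" A] x y m by (auto simp: card_insert_if)
      have "inj_on (insert {x, y}) (matchings_on (A - {x, y}))"
      proof (rule inj_onI)
        fix u v assume u: "u \<in> matchings_on (A - {x, y})" and v: "v \<in> matchings_on (A - {x, y})"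
          and eq: "insert {x, y} u = insert {x, y} v"
        have "{x, y} \<notin> u" "{x, y} \<notin> v" using u v by (auto simp: matchings_on_def)
        then show "u = v" using eq by (metis insert_ident)
      qed
      then have "card (?I y) = card (matchings_on (A - {x, y}))" by (rule card_image)
      then show ?thesis using less(1)[of "A - {x, y}"] cA m less(2) by simp
    qed
    have "double_fact (card A - 1) = (card A - 1) * double_fact (m - 1)"
      using m by (cases m) auto
    also have "\<dots> = (\<Sum>y\<in>A - {x}. double_fact (m - 1))" using x by simp
    also have "\<dots> \<le> (\<Sum>y\<in>A - {x}. card (?I y))" by (rule sum_mono) (rule card)
    also have "\<dots> = card (\<Union>y\<in>A - {x}. ?I y)"
    proof (rule card_UN_disjoint[symmetric])
      show "\<forall>y\<in>A - {x}. \<forall>z\<in>A - {x}. y \<noteq> z \<longrightarrow> ?I y \<inter> ?I z = {}"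
      proof (intro ballI impI, rule ccontr)
        fix y z assume y: "y \<in> A - {x}" and z: "z \<in> A - {x}" and "y \<noteq> z" "?I y \<inter> ?I z \<noteq> {}"
        then obtain u v where uv: "u \<in> matchings_on (A - {x, y})" "v \<in> matchings_on (A - {x, z})"
          "insert {x, y} u = insert {x, z} v" by auto
        have "insert {x, y} u \<in> matchings_on A" using insert_matchings_on[OF x _ _ uv(1)] y by auto
        then have "disjoint (insert {x, y} u)" by (simp add: matchings_on_def)
        moreover have "{x, y} \<in> insert {x, y} u" "{x, z} \<in> insert {x, y} u" using uv(3) by auto
        moreover have "{x, y} \<noteq> {x, z}" using \<open>y \<noteq> z\<close> by (auto simp: doubleton_eq_iff)
        ultimately have "{x, y} \<inter> {x, z} = {}" by (rule disjointD)
        then show False by auto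
      qed
    qed (use less(2) finite_matchings_on in auto)
    also have "\<dots> \<le> card (matchings_on A)"
      by (rule card_mono[OF finite_matchings_on[OF less(2)]]) (use insert_matchings_on[OF x] in auto)
    finally show ?thesis .
  qed
qed

text \<open>
  Choose the free points and match the rest.
\<close>
lemma card_half_diagrams:
  assumes "j \<le> n" "j mod 2 = n mod 2"
  shows "(n choose j) * double_fact (n - j - 1) \<le> card (half_diagrams n j)"
proof -
  let ?F = "{F. F \<subseteq> {..<n} \<and> card F = j}"
  have finF: "finite F" if "F \<in> ?F" for F using that finite_subset[of F "{..<n}"] by auto
  have cF: "card ({..<n} - F) = n - j" if "F \<in> ?F" for F
    using that card_Diff_subset[OF finF[OF that], of "{..<n}"] by simp
  have ev: "even (n - j)" using mod_eq_dvd_iff_nat[of j n 2] assms by simp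
  have "(n choose j) * double_fact (n - j - 1) = (\<Sum>F\<in>?F. double_fact (n - j - 1))"
    using n_subsets[of "{..<n}" j] by simp
  also have "\<dots> \<le> (\<Sum>F\<in>?F. card (matchings_on ({..<n} - F)))"
  proof (rule sum_mono)
    fix F assume F: "F \<in> ?F"
    show "double_fact (n - j - 1) \<le> card (matchings_on ({..<n} - F))"
      using card_matchings_on[of "{..<n} - F"] cF[OF F] ev by simp
  qed
  also have "\<dots> = card (\<Union>F\<in>?F. matchings_on ({..<n} - F))"
    by (rule card_UN_disjoint[symmetric])
      (auto simp: finite_matchings_on, auto simp: matchings_on_def)
  also have "\<dots> \<le> card (half_diagrams n j)"
  proof (rule card_mono[OF finite_half_diagrams], rule UN_least)
    fix F assume F: "F \<in> ?F"
    show "matchings_on ({..<n} - F) \<subseteq> half_diagrams n j"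
    proof
      fix u assume u: "u \<in> matchings_on ({..<n} - F)"
      then have "free n u = F" using F by (auto simp: matchings_on_def free_def)
      then show "u \<in> half_diagrams n j" using u F by (auto simp: half_diagrams_def partial_matching_def matchings_on_def)
    qed
  qed
  finally show ?thesis .
qed

lemma double_fact_mono: "double_fact n \<le> double_fact (Suc n)"
proof (induction n rule: double_fact.induct)
  case (3 n)
  have "Suc (Suc n) * double_fact n \<le> Suc (Suc (Suc n)) * double_fact (Suc n)"
    using 3 by (intro mult_le_mono) auto
  then show ?case by (simp only: double_fact.simps)
qed auto

lemma double_fact_pos: "double_fact n > 0"
  by (induction n rule: double_fact.induct) auto

lemma half_diagram_count_step:
  assumes "j + 2 \<le> n"
  shows "(n choose (j + 2)) * double_fact (n - (j + 2) - 1) * ((j + 1) * (j + 2)) =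
    (n choose j) * double_fact (n - j - 1) * (n - j)"
proof -
  have 1: "(n choose Suc j) * Suc j = (n choose j) * (n - j)" for j
    using binomial_absorption[of j n] binomial_absorb_comp[of n j] by (simp add: mult.commute)
  have "(n choose (j + 2)) * ((j + 1) * (j + 2)) = ((n choose Suc (Suc j)) * Suc (Suc j)) * Suc j"
    by (simp add: algebra_simps)
  also have "\<dots> = ((n choose Suc j) * (n - Suc j)) * Suc j" by (simp only: 1)
  also have "\<dots> = ((n choose Suc j) * Suc j) * (n - Suc j)" by (simp only: ac_simps)
  also have "\<dots> = (n choose j) * (n - j) * (n - Suc j)" by (simp only: 1)
  finally have 2: "(n choose (j + 2)) * ((j + 1) * (j + 2)) = (n choose j) * (n - j) * (n - Suc j)" .
  have 3: "double_fact (n - j - 1) = (n - Suc j) * double_fact (n - (j + 2) - 1)"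
  proof (cases "n = j + 2")
    case False
    then have "n - j - 1 = Suc (Suc (n - (j + 2) - 1))" using assms by simp
    then show ?thesis by simp
  qed simp
  have "(n choose (j + 2)) * double_fact (n - (j + 2) - 1) * ((j + 1) * (j + 2)) =
    ((n choose (j + 2)) * ((j + 1) * (j + 2))) * double_fact (n - (j + 2) - 1)" by (simp only: ac_simps)
  also have "\<dots> = (n choose j) * double_fact (n - j - 1) * (n - j)" unfolding 2 3 by (simp only: ac_simps)
  finally show ?thesis .
qed

text \<open>
  The steps from \<open>j\<close> to \<open>j + 2\<close> are multiplied up, starting with \<open>(n - 1)!!\<close> at \<open>j = 0\<close> and with
  \<open>n (n - 2)!! = n!!\<close> at \<open>j = 1\<close>, and each numerator is replaced by the smallest one.
\<close>
lemma half_diagram_count_lower: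
  assumes "j \<le> n" "j mod 2 = n mod 2"
  shows "double_fact (n - 1) * (n - j) ^ (j div 2) \<le> (n choose j) * double_fact (n - j - 1) * fact j"
  using assms
proof (induction j rule: less_induct)
  case (less j)
  consider "j = 0" | "j = 1" | i where "j = i + 2" by (metis One_nat_def Suc_1 add_2_eq_Suc' not0_implies_Suc)
  then show ?case
  proof cases
    case 1
    then show ?thesis by simp
  next
    case 2
    show ?thesis
    proof (cases "n = 1")
      case False
      then obtain l where n: "n = Suc (Suc l)" using 2 less(2) by (metis One_nat_def Suc_le_D le_antisym less_eq_Suc_le not_less_eq_eq)
      have "double_fact (n - 1) \<le> double_fact n" using double_fact_mono[of "n - 1"] n by simp
      then show ?thesis using 2 n by simp
    qed (use 2 in simp)
  next
    case 3
    then have i: "i \<le> n" "i mod 2 = n mod 2" "i < j" using less by auto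
    have IH: "double_fact (n - 1) * (n - i) ^ (i div 2) \<le> (n choose i) * double_fact (n - i - 1) * fact i"
      using less(1)[OF i(3,1,2)] .
    have "double_fact (n - 1) * (n - j) ^ (j div 2) \<le> double_fact (n - 1) * (n - i) ^ (j div 2)"
      using 3 by (intro mult_le_mono power_mono) auto
    also have "\<dots> = double_fact (n - 1) * (n - i) ^ (i div 2) * (n - i)" using 3 by simp
    also have "\<dots> \<le> (n choose i) * double_fact (n - i - 1) * fact i * (n - i)" using IH by simp
    also have "\<dots> = ((n choose i) * double_fact (n - i - 1) * (n - i)) * fact i" by (simp only: ac_simps)
    also have "\<dots> = ((n choose j) * double_fact (n - j - 1) * ((i + 1) * (i + 2))) * fact i"
      using half_diagram_count_step[of i n] 3 less(2) by simp
    also have "\<dots> = (n choose j) * double_fact (n - j - 1) * fact j"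
      using 3 by (simp add: algebra_simps)
    finally show ?thesis .
  qed
qed

section \<open>The bound by the double factorial\<close>

lemma one_plus_power_ge_quadratic:
  assumes "0 \<le> (x :: real)"
  shows "1 + real n * x + real n * (real n - 1) / 2 * x\<^sup>2 \<le> (1 + x) ^ n"
proof (induction n)
  case (Suc n)
  have "real n * (real n - 1) \<ge> 0" by (cases n) auto
  then have "real n * (real n - 1) / 2 * x ^ 3 \<ge> 0" using assms by simp
  then have "1 + real (Suc n) * x + real (Suc n) * (real (Suc n) - 1) / 2 * x\<^sup>2 \<le>
    (1 + real n * x + real n * (real n - 1) / 2 * x\<^sup>2) * (1 + x)"
    by (simp add: field_simps power2_eq_square power3_eq_cube)
  also have "\<dots> \<le> (1 + x) ^ n * (1 + x)" using Suc.IH assms by (intro mult_right_mono) auto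
  finally show ?case by (simp add: mult.commute)
qed simp

text \<open>
  Asymptotically the quotient of both sides grows like \<open>(e / 2)^(2 m)\<close> up to polynomial factors. From \<open>m\<close>
  to \<open>m + 1\<close> the left side is multiplied by about \<open>4 m\<^sup>2\<close> and the right side by at least \<open>5 - 2 / m\<close> times
  \<open>m\<^sup>2 - 1\<close>, which is enough from \<open>m = 14\<close> on; the inequality fails for \<open>m = 13\<close>.
\<close>
lemma fact_le_square_power:
  assumes "14 \<le> m"
  shows "fact (2 * m + 1) \<le> (real m * (real m - 2)) ^ m"
  using assms
proof (induction m rule: nat_induct_at_least)
  case base
  show ?case by (simp add: fact_numeral)
next
  case (Suc m)
  let ?m = "real m"
  let ?a = "?m * (?m - 2)" and ?b = "(?m + 1) * (?m - 1)"
  have m: "?m \<ge> 14" using Suc by simp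
  have "5 - 2 / ?m = 1 + ?m * (2 / ?m) + ?m * (?m - 1) / 2 * (2 / ?m)\<^sup>2"
    using m by (simp add: field_simps power2_eq_square)
  also have "\<dots> \<le> (1 + 2 / ?m) ^ m" using m by (intro one_plus_power_ge_quadratic) simp
  finally have quad: "5 - 2 / ?m \<le> (1 + 2 / ?m) ^ m" .
  have "?a * (1 + 2 / ?m) \<le> ?b" using m by (simp add: field_simps)
  then have "(?a * (1 + 2 / ?m)) ^ m \<le> ?b ^ m" using m by (intro power_mono) auto
  then have pow: "?a ^ m * (1 + 2 / ?m) ^ m \<le> ?b ^ m" by (simp add: power_mult_distrib)
  have "14 * ?m\<^sup>2 \<le> ?m * ?m\<^sup>2" "14 * ?m \<le> ?m * ?m" using m by (intro mult_right_mono; simp)+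
  then have "12 * (?m * ?m) + 11 * ?m \<le> ?m * (?m * ?m)" by (simp only: power2_eq_square)
  then have poly: "(2 * ?m + 3) * (2 * ?m + 2) \<le> ?b * (5 - 2 / ?m)"
    using m by (simp add: field_simps power2_eq_square)
  have "2 * Suc m + 1 = Suc (Suc (2 * m + 1))" by simp
  then have "fact (2 * Suc m + 1) = (2 * ?m + 3) * (2 * ?m + 2) * fact (2 * m + 1)"
    by (simp add: algebra_simps)
  also have "\<dots> \<le> (?b * (5 - 2 / ?m)) * ?a ^ m"
    by (rule mult_mono[OF poly Suc.IH order_trans[OF _ poly]]) simp_all
  also have "\<dots> \<le> ?b * ((1 + 2 / ?m) ^ m * ?a ^ m)"
    using quad m by (simp add: mult.assoc mult_left_mono mult_right_mono)
  also have "\<dots> \<le> ?b * ?b ^ m" using pow m by (intro mult_left_mono) (simp_all add: mult.commute)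
  finally show ?case by (simp add: algebra_simps)
qed

lemma fact_le_square_power_nat:
  assumes "14 \<le> m"
  shows "fact (2 * m + 1) \<le> (m * m - 2 * m) ^ m"
proof -
  have "2 * m \<le> m * m" using assms by simp
  then have "real (m * m - 2 * m) = real m * (real m - 2)" by (simp add: of_nat_diff algebra_simps)
  then have "real (fact (2 * m + 1)) \<le> real ((m * m - 2 * m) ^ m)"
    using fact_le_square_power[OF assms] by (simp only: of_nat_fact of_nat_power)
  then show ?thesis by (simp only: of_nat_le_iff)
qed

text \<open>
  For bounded \<open>j\<close> the single factor \<open>n - j\<close> already exceeds \<open>j!\<close>. For larger \<open>j\<close> one uses \<open>n \<ge> j\<^sup>2 / 4\<close>,
  which gives \<open>n - j \<ge> m\<^sup>2 - 2 m\<close> for \<open>m = j div 2\<close>.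
\<close>
lemma eventually_half_diagrams_bound:
  "\<forall>\<^sub>F n in sequentially. \<forall>j. 2 \<le> j \<longrightarrow> j < n \<longrightarrow> real j \<le> 2 * sqrt (real n) \<longrightarrow> j mod 2 = n mod 2 \<longrightarrow>
     double_fact (n - 1) \<le> card (half_diagrams n j)"
proof -
  define M :: nat where "M = 14"
  have M: "fact (2 * m + 1) \<le> ((m * m - 2 * m) ^ m :: nat)" if "m \<ge> M" for m
    using fact_le_square_power_nat that by (simp add: M_def)
  show ?thesis
    using eventually_ge_at_top[of "fact (2 * M) + 2 * M"]
  proof eventually_elim
    case (elim n)
    show ?case
    proof (intro allI impI)
      fix j assume j: "2 \<le> j" "j < n" "real j \<le> 2 * sqrt (real n)" "j mod 2 = n mod 2"
      have "fact j \<le> (n - j) ^ (j div 2)"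
      proof (cases "j < 2 * M")
        case True
        have "fact j \<le> (fact (2 * M) :: nat)" using True by (intro fact_mono_nat) simp
        also have "\<dots> \<le> n - j" using elim True by simp
        also have "\<dots> \<le> (n - j) ^ (j div 2)" using j by (intro self_le_power) auto
        finally show ?thesis .
      next
        case False
        let ?m = "j div 2"
        have "real j ^ 2 \<le> (2 * sqrt (real n)) ^ 2" using j(3) by (intro power_mono) auto
        then have "real (j * j) \<le> real (4 * n)" by (simp add: power2_eq_square)
        then have jn: "j * j \<le> 4 * n" by (simp only: of_nat_le_iff)
        have "?m * ?m - 2 * ?m \<le> n - j"
        proof -
          consider "j = 2 * ?m" | "j = 2 * ?m + 1" by linarith
          then show ?thesis
          proof cases
            case 1
            then have "4 * (?m * ?m) \<le> 4 * n" using jn by (metis mult.assoc mult.commute mult_2_right numeral_Bit0 mult_2)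
            then show ?thesis using 1 by linarith
          next
            case 2
            then have "(2 * ?m + 1) * (2 * ?m + 1) \<le> 4 * n" using jn by metis
            then have "4 * (?m * ?m) + 4 * ?m + 1 \<le> 4 * n" by (simp add: algebra_simps)
            then show ?thesis using 2 by linarith
          qed
        qed
        then have "(?m * ?m - 2 * ?m) ^ ?m \<le> (n - j) ^ ?m" by (intro power_mono) auto
        moreover have "fact (2 * ?m + 1) \<le> (?m * ?m - 2 * ?m) ^ ?m" using M False by simp
        moreover have "fact j \<le> (fact (2 * ?m + 1) :: nat)" by (intro fact_mono_nat) linarith
        ultimately show ?thesis by linarith
      qed
      then have "double_fact (n - 1) * fact j \<le> double_fact (n - 1) * (n - j) ^ (j div 2)" by simp
      also have "\<dots> \<le> (n choose j) * double_fact (n - j - 1) * fact j"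
        using half_diagram_count_lower[of j n] j by simp
      finally have "double_fact (n - 1) \<le> (n choose j) * double_fact (n - j - 1)" by simp
      also have "\<dots> \<le> card (half_diagrams n j)" using card_half_diagrams j by simp
      finally show "double_fact (n - 1) \<le> card (half_diagrams n j)" .
    qed
  qed
qed

section \<open>Growth of the double factorial\<close>

text \<open>
  Let \<open>h\<close> be the logarithm of the quotient of both sides. It changes by \<open>\<delta> n = O(1 / n\<^sup>2)\<close> from \<open>n\<close> to
  \<open>n + 2\<close>, so it is bounded, separately along even and odd \<open>n\<close>.
\<close>
lemma double_fact_theta:
  "(\<lambda>n. real (double_fact (n - 1))) \<in> \<Theta>(\<lambda>n. real n powr (real n / 2) * exp (- (real n / 2)))"
proof -
  define G where "G n = real n powr (real n / 2) * exp (- (real n / 2))" for n :: nat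
  define h where "h n = ln (real (double_fact (n - 1))) - (real n / 2 * ln (real n) - real n / 2)" for n
  define \<delta> where "\<delta> n = ln (real n + 1) - ((real n + 2) / 2 * ln (real n + 2) - real n / 2 * ln (real n) - 1)" for n :: nat
  have step: "h (Suc (Suc n)) = h n + \<delta> n" if "n \<ge> 1" for n
  proof -
    have "double_fact (Suc (Suc n) - 1) = Suc n * double_fact (n - 1)" using that by (cases n) auto
    then have "ln (real (double_fact (Suc (Suc n) - 1))) = ln (real n + 1) + ln (real (double_fact (n - 1)))"
      using ln_mult_pos[of "real n + 1" "real (double_fact (n - 1))"] double_fact_pos[of "n - 1"]
      by (simp add: algebra_simps)
    then show ?thesis by (simp add: h_def \<delta>_def field_simps)
  qed
  let ?t = "\<lambda>n. 1 / real (n + 1) - 1 / real (Suc n + 1)"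
  have "\<delta> \<in> O(?t)" unfolding \<delta>_def by real_asymp
  moreover have "summable (\<lambda>n. norm (?t n))"
  proof -
    have "(\<lambda>n. 1 / real (n + 1)) \<longlonglongrightarrow> 0" by real_asymp
    then have "summable ?t" by (rule telescope_summable')
    moreover have "norm (?t n) = ?t n" for n by (simp add: frac_le)
    ultimately show ?thesis by simp
  qed
  ultimately have summ: "summable (\<lambda>n. \<bar>\<delta> n\<bar>)"
    using summable_comparison_test_bigo[of ?t "\<lambda>n. \<bar>\<delta> n\<bar>"] by simp
  define C where "C = \<bar>h 1\<bar> + \<bar>h 2\<bar>"
  have bound: "\<bar>h n\<bar> \<le> C + (\<Sum>i<n. \<bar>\<delta> i\<bar>)" if "n \<ge> 1" for n
    using that
  proof (induction n rule: less_induct)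
    case (less n)
    consider "n = 1" | "n = 2" | i where "n = Suc (Suc i)" "i \<ge> 1"
      using less(2) by (metis One_nat_def Suc_1 less_eq_Suc_le not0_implies_Suc not_gr_zero)
    then show ?case
    proof cases
      case 3
      have "\<bar>h n\<bar> \<le> \<bar>h i\<bar> + \<bar>\<delta> i\<bar>" using step[OF 3(2)] 3(1) by simp
      also have "\<dots> \<le> C + (\<Sum>l<i. \<bar>\<delta> l\<bar>) + \<bar>\<delta> i\<bar>" using less(1)[of i] 3 by simp
      also have "\<dots> \<le> C + (\<Sum>l<n. \<bar>\<delta> l\<bar>)" using 3 by simp
      finally show ?thesis .
    qed (auto simp: C_def intro: add_increasing2 sum_nonneg)
  qed
  define D where "D = C + suminf (\<lambda>n. \<bar>\<delta> n\<bar>)"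
  have hD: "\<bar>h n\<bar> \<le> D" if "n \<ge> 1" for n
    using bound[OF that] sum_le_suminf[OF summ, of "{..<n}"] by (simp add: D_def)
  have eq: "real (double_fact (n - 1)) = exp (h n) * G n" if "n \<ge> 1" for n
  proof -
    have "G n = exp (real n / 2 * ln (real n) - real n / 2)"
      using that by (simp add: G_def powr_def mult_exp_exp)
    then have "exp (h n) * G n = exp (ln (real (double_fact (n - 1))))" by (simp add: h_def exp_diff)
    then show ?thesis using double_fact_pos[of "n - 1"] by simp
  qed
  have G: "G n \<ge> 0" for n by (simp add: G_def)
  have "(\<lambda>n. real (double_fact (n - 1))) \<in> O(G)"
  proof (rule bigoI[of _ "exp D"])
    show "\<forall>\<^sub>F n in sequentially. norm (real (double_fact (n - 1))) \<le> exp D * norm (G n)"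
      using eventually_ge_at_top[of 1]
    proof eventually_elim
      case (elim n)
      have "exp (h n) \<le> exp D" using hD[OF elim] by simp
      then show ?case using eq[OF elim] G[of n] by (simp add: mult_right_mono)
    qed
  qed
  moreover have "G \<in> O(\<lambda>n. real (double_fact (n - 1)))"
  proof (rule bigoI[of _ "exp D"])
    show "\<forall>\<^sub>F n in sequentially. norm (G n) \<le> exp D * norm (real (double_fact (n - 1)))"
      using eventually_ge_at_top[of 1]
    proof eventually_elim
      case (elim n)
      have "1 \<le> exp D * exp (h n)" using hD[OF elim] by (simp add: exp_add[symmetric])
      then have "1 * G n \<le> exp D * exp (h n) * G n" by (intro mult_right_mono G)
      then show ?case using eq[OF elim] G[of n] by (simp add: mult.assoc)
    qed
  qed
  ultimately show ?thesis unfolding G_def[symmetric] by (simp add: bigtheta_def bigomega_iff_bigo)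
qed

section \<open>The lower bounds\<close>

theorem theorem5p5p1:
  assumes "CHAR('k :: field) \<noteq> 2"
  shows
    "(\<forall>n k. k < n \<and> k mod 2 = n mod 2 \<longrightarrow>
        rep_gap TYPE('k) (Br_le n k) \<ge> rep_gap TYPE('k) (TL_le n k) \<and>
        rep_ssgap TYPE('k) (Br_le n k) \<ge> rep_ssgap TYPE('k) (TL_le n k) \<and>
        rep_faith TYPE('k) (Br_le n k) \<ge> rep_faith TYPE('k) (TL_le n k)) \<and>
     (\<forall>\<^sub>F n in sequentially. \<forall>k. k < n \<and> k mod 2 = n mod 2 \<and> real k \<le> 2 * sqrt (real n) \<longrightarrow>
        rep_ssgap TYPE('k) (Br_le n k) \<ge> enat (double_fact (n - 1))) \<and>
     (\<lambda>n. real (double_fact (n - 1))) \<in>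
        \<Theta>(\<lambda>n. real n powr (real n / 2) * exp (- (real n / 2)))"
proof (intro conjI)
  show "\<forall>n k. k < n \<and> k mod 2 = n mod 2 \<longrightarrow>
        rep_gap TYPE('k) (Br_le n k) \<ge> rep_gap TYPE('k) (TL_le n k) \<and>
        rep_ssgap TYPE('k) (Br_le n k) \<ge> rep_ssgap TYPE('k) (TL_le n k) \<and>
        rep_faith TYPE('k) (Br_le n k) \<ge> rep_faith TYPE('k) (TL_le n k)"
    using rep_gap_mono rep_ssgap_mono rep_faith_mono by blast
  show "\<forall>\<^sub>F n in sequentially. \<forall>k. k < n \<and> k mod 2 = n mod 2 \<and> real k \<le> 2 * sqrt (real n) \<longrightarrow>
        rep_ssgap TYPE('k) (Br_le n k) \<ge> enat (double_fact (n - 1))"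
    using eventually_half_diagrams_bound
  proof eventually_elim
    case (elim n)
    show ?case
    proof (intro allI impI, elim conjE)
      fix k assume k: "k < n" "real k \<le> 2 * sqrt (real n)"
      show "enat (double_fact (n - 1)) \<le> rep_ssgap TYPE('k) (Br_le n k)"
      proof (rule rep_ssgap_Br_ge[OF k(1)])
        fix j assume "2 \<le> j" "j \<le> k" "j mod 2 = n mod 2"
        moreover from this have "real j \<le> 2 * sqrt (real n)" "j < n" using k by auto
        ultimately show "double_fact (n - 1) \<le> card (half_diagrams n j)" using elim by blast
      qed
    qed
  qed
qed (rule double_fact_theta)

end
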